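(* Let $(X_n)_{n\in\mathbb{Z}}$ be an adapted stationary sequence of real random variables in $\mathbb{L}^2$. Assume that $$\sum_{k=1}^{\infty}\frac{\|\mathbb{E}_{0}(S_{k})\|_2}{k^{3/2}}<\infty .$$ Let $M_n=\sum_{k=1}^{n}D\circ\theta^k$ where $D=\sum_{n\geq0}\sum_{k\geq n}\frac{\mathcal{P}_0(X_k)}{k+1}$ (convergent in $\mathbb{L}^2$). Then $\mathbb{E}_0\bigl[(S_n-M_n-\mathbb{E}_0(S_n))^2\bigr]=o(n)$ $\mathbb{P}$-a.s. and $\mathbb{E}_0(S_n)=o(\sqrt n)$ $\mathbb{P}$-a.s. In particular, $$\mathbb{E}_0\bigl[(S_n-M_n)^2\bigr]=o(n)\qquad\mathbb{P}\text{-a.s.}$$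
   Context: Setting. $(\Omega,\mathcal{A},\mathbb{P})$ is a probability space and $\theta:\Omega\to\Omega$ is a bijective bi-measurable transformation preserving $\mathbb{P}$. $\mathcal{F}_0\subseteq\mathcal{A}$ is a $\sigma$-algebra with $\mathcal{F}_0\subseteq\theta^{-1}(\mathcal{F}_0)$, and $\mathcal{F}_i=\theta^{-i}(\mathcal{F}_0)$ for $i\in\mathbb{Z}$. An adapted stationary sequence in $\mathbb{L}^2$ is a sequence $X_i=X_0\circ\theta^i$, $i\in\mathbb{Z}$, where $X_0\in\mathbb{L}^2$ is real-valued, centered and $\mathcal{F}_0$-measurable. Notation: $S_n=X_1+\cdots+X_n$; $\mathbb{E}_k(X)=\mathbb{E}(X|\mathcal{F}_k)$; $\mathcal{P}_k(X)=\mathbb{E}_k(X)-\mathbb{E}_{k-1}(X)$; $\|\cdot\|_2$ is the $\mathbb{L}^2$ norm. *)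

theory Defs
  imports "HOL-Probability.Probability"
begin

text \<open>Integer iterates of a bijection \<open>\<theta>\<close> of the underlying space of \<open>M\<close>; the inverse
  is taken on \<open>space M\<close> only, as \<open>\<theta>\<close> is unconstrained outside of it.\<close>

definition theta_pow :: "'a measure \<Rightarrow> ('a \<Rightarrow> 'a) \<Rightarrow> int \<Rightarrow> 'a \<Rightarrow> 'a" where
  "theta_pow M \<theta> i =
     (if 0 \<le> i then \<theta> ^^ nat i else the_inv_into (space M) \<theta> ^^ nat (- i))"

definition bimeasurable_preserving :: "'a measure \<Rightarrow> ('a \<Rightarrow> 'a) \<Rightarrow> bool" where
  "bimeasurable_preserving M \<theta> \<longleftrightarrow>
     bij_betw \<theta> (space M) (space M) \<and>
     \<theta> \<in> measurable M M \<and>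
     the_inv_into (space M) \<theta> \<in> measurable M M \<and>
     distr M M \<theta> = M"

text \<open>\<open>\<F>\<^sub>i = \<theta>\<^sup>-\<^sup>i(\<F>\<^sub>0)\<close>. Only the underlying set system matters (the measure
  carried by a \<open>vimage_algebra\<close> is irrelevant for \<open>real_cond_exp\<close>).\<close>

definition Filt :: "'a measure \<Rightarrow> ('a \<Rightarrow> 'a) \<Rightarrow> 'a measure \<Rightarrow> int \<Rightarrow> 'a measure" where
  "Filt M \<theta> F0 i = vimage_algebra (space M) (theta_pow M \<theta> i) F0"

definition cexp ::
  "'a measure \<Rightarrow> ('a \<Rightarrow> 'a) \<Rightarrow> 'a measure \<Rightarrow> int \<Rightarrow> ('a \<Rightarrow> real) \<Rightarrow> 'a \<Rightarrow> real" where
  "cexp M \<theta> F0 k f = real_cond_exp M (Filt M \<theta> F0 k) f"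

definition Proj ::
  "'a measure \<Rightarrow> ('a \<Rightarrow> 'a) \<Rightarrow> 'a measure \<Rightarrow> int \<Rightarrow> ('a \<Rightarrow> real) \<Rightarrow> 'a \<Rightarrow> real" where
  "Proj M \<theta> F0 k f = (\<lambda>x. cexp M \<theta> F0 k f x - cexp M \<theta> F0 (k - 1) f x)"

definition stat_seq ::
  "'a measure \<Rightarrow> ('a \<Rightarrow> 'a) \<Rightarrow> ('a \<Rightarrow> real) \<Rightarrow> int \<Rightarrow> 'a \<Rightarrow> real" where
  "stat_seq M \<theta> X0 i = (\<lambda>x. X0 (theta_pow M \<theta> i x))"

text \<open>\<open>Y \<circ> \<theta> + \<cdots> + Y \<circ> \<theta>\<^sup>n\<close>: this is \<open>S\<^sub>n\<close> for \<open>Y = X\<^sub>0\<close> and \<open>M\<^sub>n\<close> for \<open>Y = D\<close>.\<close>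

definition psum ::
  "'a measure \<Rightarrow> ('a \<Rightarrow> 'a) \<Rightarrow> ('a \<Rightarrow> real) \<Rightarrow> nat \<Rightarrow> 'a \<Rightarrow> real" where
  "psum M \<theta> Y n = (\<lambda>x. \<Sum>k=1..n. stat_seq M \<theta> Y (int k) x)"

definition in_L2 :: "'a measure \<Rightarrow> ('a \<Rightarrow> real) \<Rightarrow> bool" where
  "in_L2 M f \<longleftrightarrow> f \<in> borel_measurable M \<and> integrable M (\<lambda>x. (f x)\<^sup>2)"

definition L2_norm :: "'a measure \<Rightarrow> ('a \<Rightarrow> real) \<Rightarrow> real" where
  "L2_norm M f = sqrt (integral\<^sup>L M (\<lambda>x. (f x)\<^sup>2))"

text \<open>Membership in \<open>L\<^sup>2\<close> is part of the definition because \<open>L2_norm\<close> is \<open>0\<close> for functions that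
  are not square integrable. The sum \<open>g\<close> is determined only up to almost sure equality.\<close>

definition L2_sums :: "'a measure \<Rightarrow> (nat \<Rightarrow> 'a \<Rightarrow> real) \<Rightarrow> ('a \<Rightarrow> real) \<Rightarrow> bool" where
  "L2_sums M f g \<longleftrightarrow>
     (\<forall>n. in_L2 M (f n)) \<and> in_L2 M g \<and>
     (\<lambda>N. L2_norm M (\<lambda>x. (\<Sum>n<N. f n x) - g x)) \<longlonglongrightarrow> 0"

text \<open>\<open>D = (\<Sum>n\<ge>0. \<Sum>k\<ge>n. P\<^sub>0(X\<^sub>k) / (k+1))\<close> as an iterated series, both the inner series and the
  outer one converging in \<open>L\<^sup>2\<close>; the inner index is \<open>k = n + j\<close>.\<close>

definition is_mart_increment ::
  "'a measure \<Rightarrow> ('a \<Rightarrow> 'a) \<Rightarrow> 'a measure \<Rightarrow> ('a \<Rightarrow> real) \<Rightarrow> ('a \<Rightarrow> real) \<Rightarrow> bool" where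
  "is_mart_increment M \<theta> F0 X0 D \<longleftrightarrow>
     (\<exists>Y. (\<forall>n. L2_sums M
                 (\<lambda>j x. Proj M \<theta> F0 0 (stat_seq M \<theta> X0 (int (n + j))) x / (real (n + j) + 1))
                 (Y n)) \<and>
          L2_sums M Y D)"

end

(* A Markov-operator form of the Peligrad-Utev dyadic decomposition. With Q f = E_0(f o theta) and
   V_p = E_0(S_p), the sum S_n splits into martingales built from V_{2^k}, one for every k, plus
   leftover blocks. Conditionally on F_0 the squares of the martingales are ergodic sums of
   V_{2^k}^2 along Q^{2^k}. Hopf's maximal inequality makes the square root of the corresponding
   maximal function integrable, so sup_n (E_0(S_n^2)/n)^{1/2} has expectation at most a constant
   times MW(X) = |X|_2 + sum_k 2^{-k/2} |V_{2^k}|_2, which is finite under the hypothesis.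

   The partial sums of the series for D are limits of P_0(H), where H is a weighted sum of the Q^k X
   such that R = X - (H - QH) is a convex combination of Q^k X with large k and hence MW(R) is small.
   Then S_n(X) - M_n = S_n(R) + (martingale with increment P_0(H) - D) + coboundary, and all three
   terms are negligible in the quenched sense. The annealed version of the same inequality shows
   that the P_0(H) are Cauchy, which gives the existence of D. Finally E_0(M_n) = 0, so that
   E_0(S_n) and the centred error are dominated by E_0((S_n - M_n)^2). *)

theory Submission
  imports Defs
begin

text \<open>Almost sure statements along all \<open>n\<close> do not follow from L2 bounds at each
  \<open>n\<close>; they need one random bound valid for every \<open>n\<close>, hence a maximal
  function. Hopf's lemma gives only a weak type (1,1) bound for averages of squares, which does not
  make their supremum integrable. A conditional L2 norm is the square root of such an average: its
  tail is of order \<open>t^-2\<close>, which is integrable, and the conditional Minkowski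
  inequality allows these roots to be added over the dyadic levels. The weights in H are forced by
  the double series for D. Summation by parts turns them into nonnegative coefficients of total mass
  one, and this convexity is the point: \<open>|V_p(R)|_2 \<le> |V_p(X)|_2\<close> for every p, so
  the series in MW(R) is dominated by the fixed series of X, and only \<open>|R|_2\<close> has to be
  made small. That follows by Abel summation, because the L2 norm of
  \<open>X + Q X + ... + Q^(n-1) X\<close> grows at most like sqrt n by the annealed
  inequality.\<close>

section \<open>Square integrable functions\<close>

text \<open>For positive \<open>F\<close> and \<open>G\<close> the right-hand side is smallest at
  the weight \<open>sqrt G / sqrt F\<close>, where it equals the square of
  \<open>sqrt F + sqrt G\<close>. Only rational weights are assumed, so that a pointwise application
  after conditioning has to avoid only countably many null sets.\<close>

lemma sqrt_triangle_of_weighted_bounds: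
  fixes Z F G :: real
  assumes bd: "\<And>q::rat. 0 < q \<Longrightarrow> Z \<le> (1 + of_rat q) * F + (1 + 1 / of_rat q) * G"
    and F: "0 \<le> F" and G: "0 \<le> G"
  shows "sqrt Z \<le> sqrt F + sqrt G"
proof -
  have real_bd: "Z \<le> (1 + a) * F + (1 + 1 / a) * G" if a: "0 < a" for a :: real
  proof (rule field_le_epsilon)
    fix e :: real assume e: "0 < e"
    \<comment> \<open>Raising the weight by at most \<open>e / (F + 1)\<close> costs at most
      \<open>e\<close> in the first term, because \<open>F / (F + 1) \<le> 1\<close>, and can only
      lower the second.\<close>
    have "0 < e / (F + 1)" using e F by simp
    then obtain q :: rat where q: "a < of_rat q" "of_rat q < a + e / (F + 1)"
      using of_rat_dense[of a "a + e / (F + 1)"] by auto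
    then have "0 < q" using a by (metis of_rat_0 of_rat_less order_less_trans)
    then have "Z \<le> (1 + of_rat q) * F + (1 + 1 / of_rat q) * G" by (rule bd)
    also have "\<dots> \<le> (1 + (a + e / (F + 1))) * F + (1 + 1 / a) * G"
      using q a F G by (intro add_mono mult_right_mono) (auto intro!: frac_le)
    also have "\<dots> = (1 + a) * F + (1 + 1 / a) * G + e * (F / (F + 1))"
      by (simp add: algebra_simps)
    also have "e * (F / (F + 1)) \<le> e * 1"
      using e F by (intro mult_left_mono) auto
    finally show "Z \<le> (1 + a) * F + (1 + 1 / a) * G + e" by simp
  qed
  show ?thesis
  proof (rule field_le_epsilon)
    fix e :: real assume e: "0 < e"
    \<comment> \<open>Adding \<open>e / 2\<close> keeps both roots positive, so that the optimal
      weight \<open>g / f\<close> makes sense even if \<open>F\<close> or \<open>G\<close>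
      vanishes.\<close>
    define f g where "f = sqrt F + e / 2" and "g = sqrt G + e / 2"
    have pos: "0 < f" "0 < g" using e F G by (auto simp: f_def g_def add_nonneg_pos)
    have le: "F \<le> f\<^sup>2" "G \<le> g\<^sup>2"
      using e F G by (auto simp: f_def g_def intro!: sqrt_le_D)
    have "Z \<le> (1 + g / f) * F + (1 + 1 / (g / f)) * G"
      using pos by (intro real_bd) simp
    also have "\<dots> \<le> (1 + g / f) * f\<^sup>2 + (1 + 1 / (g / f)) * g\<^sup>2"
      using pos le by (intro add_mono mult_left_mono) auto
    also have "\<dots> = (f + g)\<^sup>2"
      using pos by (simp add: field_simps power2_eq_square)
    finally have "sqrt Z \<le> f + g"
      using pos by (intro real_le_lsqrt) auto
    then show "sqrt Z \<le> sqrt F + sqrt G + e" by (simp add: f_def g_def)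
  qed
qed

lemma square_add_le_weighted:
  fixes a b t :: real
  assumes "0 < t"
  shows "(a + b)\<^sup>2 \<le> (1 + t) * a\<^sup>2 + (1 + 1 / t) * b\<^sup>2"
proof -
  have "0 \<le> (t * a - b)\<^sup>2 / t" using assms by simp
  also have "(t * a - b)\<^sup>2 / t = t * a\<^sup>2 - 2 * a * b + b\<^sup>2 / t"
    using assms by (simp add: field_simps power2_eq_square)
  finally show ?thesis by (simp add: field_simps power2_eq_square)
qed

lemma in_L2_borel [measurable_dest]: "in_L2 M f \<Longrightarrow> f \<in> borel_measurable M"
  by (simp add: in_L2_def)

lemma in_L2_sq: "in_L2 M f \<Longrightarrow> integrable M (\<lambda>x. (f x)\<^sup>2)"
  by (simp add: in_L2_def)

lemma in_L2_mult:
  assumes "in_L2 M f" "in_L2 M g"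
  shows "integrable M (\<lambda>x. f x * g x)"
proof (rule Bochner_Integration.integrable_bound)
  show "integrable M (\<lambda>x. (f x)\<^sup>2 + (g x)\<^sup>2)" using assms by (simp add: in_L2_def)
  show "(\<lambda>x. f x * g x) \<in> borel_measurable M" using assms by (auto simp: in_L2_def)
  show "AE x in M. norm (f x * g x) \<le> norm ((f x)\<^sup>2 + (g x)\<^sup>2)"
  proof (rule AE_I2)
    fix x
    have "2 * \<bar>f x\<bar> * \<bar>g x\<bar> \<le> \<bar>f x\<bar>\<^sup>2 + \<bar>g x\<bar>\<^sup>2" by (rule sum_squares_bound)
    moreover have "0 \<le> \<bar>f x\<bar> * \<bar>g x\<bar>" by simp
    moreover have "norm ((f x)\<^sup>2 + (g x)\<^sup>2) = \<bar>f x\<bar>\<^sup>2 + \<bar>g x\<bar>\<^sup>2" by simp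
    ultimately show "norm (f x * g x) \<le> norm ((f x)\<^sup>2 + (g x)\<^sup>2)"
      unfolding real_norm_def abs_mult by linarith
  qed
qed

lemma in_L2_add:
  assumes "in_L2 M f" "in_L2 M g"
  shows "in_L2 M (\<lambda>x. f x + g x)"
  unfolding in_L2_def power2_sum
  using assms in_L2_mult[OF assms] by (auto simp: in_L2_def mult.assoc)

lemma in_L2_cmult:
  assumes "in_L2 M f"
  shows "in_L2 M (\<lambda>x. c * f x)"
  using assms by (auto simp: in_L2_def power_mult_distrib)

lemma in_L2_divide:
  assumes "in_L2 M f"
  shows "in_L2 M (\<lambda>x. f x / c)"
  using in_L2_cmult[OF assms, of "1 / c"] by simp

lemma in_L2_diff:
  assumes "in_L2 M f" "in_L2 M g"
  shows "in_L2 M (\<lambda>x. f x - g x)"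
  using in_L2_add[OF assms(1) in_L2_cmult[OF assms(2), of "-1"]] by simp

lemma in_L2_zero: "in_L2 M (\<lambda>x. 0)"
  by (simp add: in_L2_def)

lemma in_L2_sum:
  assumes "\<And>i. i \<in> I \<Longrightarrow> in_L2 M (f i)"
  shows "in_L2 M (\<lambda>x. \<Sum>i\<in>I. f i x)"
  using assms
  by (induction I rule: infinite_finite_induct) (auto simp: in_L2_zero intro: in_L2_add)

lemmas in_L2_intros = in_L2_add in_L2_cmult in_L2_divide in_L2_diff in_L2_zero in_L2_sum

lemma L2_norm_nonneg [simp]: "0 \<le> L2_norm M f"
  by (simp add: L2_norm_def)

lemma L2_norm_power2: "(L2_norm M f)\<^sup>2 = (\<integral>x. (f x)\<^sup>2 \<partial>M)"
  by (simp add: L2_norm_def)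

lemma L2_norm_cong_AE:
  assumes "AE x in M. f x = g x" "f \<in> borel_measurable M" "g \<in> borel_measurable M"
  shows "L2_norm M f = L2_norm M g"
  unfolding L2_norm_def
  using assms by (intro arg_cong[where f = sqrt] integral_cong_AE) auto

lemma L2_norm_cmult: "L2_norm M (\<lambda>x. c * f x) = \<bar>c\<bar> * L2_norm M f"
  by (simp add: L2_norm_def power_mult_distrib real_sqrt_mult)

lemma L2_norm_minus_commute: "L2_norm M (\<lambda>x. f x - g x) = L2_norm M (\<lambda>x. g x - f x)"
  by (simp add: L2_norm_def power2_commute)

lemma L2_norm_zero [simp]: "L2_norm M (\<lambda>x. 0) = 0"
  by (simp add: L2_norm_def)

lemma L2_norm_add:
  assumes "in_L2 M f" "in_L2 M g"
  shows "L2_norm M (\<lambda>x. f x + g x) \<le> L2_norm M f + L2_norm M g"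
  unfolding L2_norm_def
proof (rule sqrt_triangle_of_weighted_bounds)
  fix q :: rat assume "0 < q"
  then have q: "0 < (of_rat q :: real)" by simp
  note int = in_L2_sq[OF assms(1)] in_L2_sq[OF assms(2)] in_L2_sq[OF in_L2_add[OF assms]]
  have "(\<integral>x. (f x + g x)\<^sup>2 \<partial>M) \<le> (\<integral>x. (1 + of_rat q) * (f x)\<^sup>2 + (1 + 1 / of_rat q) * (g x)\<^sup>2 \<partial>M)"
    using int q by (intro integral_mono square_add_le_weighted) auto
  also have "\<dots> = (1 + of_rat q) * (\<integral>x. (f x)\<^sup>2 \<partial>M) + (1 + 1 / of_rat q) * (\<integral>x. (g x)\<^sup>2 \<partial>M)"
    using int by simp
  finally show "(\<integral>x. (f x + g x)\<^sup>2 \<partial>M)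
    \<le> (1 + of_rat q) * (\<integral>x. (f x)\<^sup>2 \<partial>M) + (1 + 1 / of_rat q) * (\<integral>x. (g x)\<^sup>2 \<partial>M)" .
qed auto

lemma L2_norm_diff:
  assumes "in_L2 M f" "in_L2 M g"
  shows "L2_norm M (\<lambda>x. f x - g x) \<le> L2_norm M f + L2_norm M g"
  using L2_norm_add[OF assms(1) in_L2_cmult[OF assms(2), of "-1"]] L2_norm_cmult[of M "-1" g]
  by simp

lemma L2_norm_diff_triangle:
  assumes "in_L2 M f" "in_L2 M g" "in_L2 M h"
  shows "L2_norm M (\<lambda>x. f x - h x) \<le> L2_norm M (\<lambda>x. f x - g x) + L2_norm M (\<lambda>x. g x - h x)"
  using L2_norm_add[OF in_L2_diff[OF assms(1,2)] in_L2_diff[OF assms(2,3)]] by simp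

lemma L2_norm_sum:
  assumes "\<And>i. i \<in> I \<Longrightarrow> in_L2 M (f i)"
  shows "L2_norm M (\<lambda>x. \<Sum>i\<in>I. f i x) \<le> (\<Sum>i\<in>I. L2_norm M (f i))"
  using assms
proof (induction I rule: infinite_finite_induct)
  case (insert i I)
  have "L2_norm M (\<lambda>x. f i x + (\<Sum>i\<in>I. f i x)) \<le> L2_norm M (f i) + L2_norm M (\<lambda>x. \<Sum>i\<in>I. f i x)"
    using insert.prems by (intro L2_norm_add in_L2_sum) auto
  then show ?case using insert by simp
qed auto

lemma L2_norm_zero_imp_AE:
  assumes "in_L2 M f" "L2_norm M f = 0"
  shows "AE x in M. f x = 0"
proof -
  have "(\<integral>x. (f x)\<^sup>2 \<partial>M) = 0" using assms(2) by (simp add: L2_norm_def)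
  then have "AE x in M. (f x)\<^sup>2 = 0"
    using assms(1) integral_nonneg_eq_0_iff_AE[of M "\<lambda>x. (f x)\<^sup>2"] by (simp add: in_L2_def)
  then show ?thesis by simp
qed

section \<open>Completeness of L2 on a probability space\<close>

context prob_space
begin

lemma in_L2_integrable:
  assumes "in_L2 M f"
  shows "integrable M f"
  by (rule square_integrable_imp_integrable[OF in_L2_borel[OF assms] in_L2_sq[OF assms]])

text \<open>The variance of \<open>\<bar>f\<bar>\<close> is nonnegative; total mass one enters
  through the constant term.\<close>

lemma integral_abs_le_L2_norm:
  assumes "in_L2 M f"
  shows "(\<integral>x. \<bar>f x\<bar> \<partial>M) \<le> L2_norm M f"
proof -
  have i: "integrable M (\<lambda>x. \<bar>f x\<bar>)" using in_L2_integrable[OF assms] by simp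
  define m where "m = (\<integral>x. \<bar>f x\<bar> \<partial>M)"
  have "0 \<le> (\<integral>x. (\<bar>f x\<bar> - m)\<^sup>2 \<partial>M)" by simp
  also have "\<dots> = (\<integral>x. (f x)\<^sup>2 - 2 * m * \<bar>f x\<bar> + m\<^sup>2 \<partial>M)"
    by (simp add: power2_diff algebra_simps)
  also have "\<dots> = (\<integral>x. (f x)\<^sup>2 \<partial>M) - 2 * m * m + m\<^sup>2"
    using i in_L2_sq[OF assms] by (simp add: m_def prob_space)
  finally have "m\<^sup>2 \<le> (\<integral>x. (f x)\<^sup>2 \<partial>M)" by (simp add: power2_eq_square)
  then show ?thesis unfolding m_def L2_norm_def by (intro real_le_rsqrt)
qed

text \<open>Fast Cauchy subsequences converge almost surely, and Fatou's lemma identifies the limit.\<close>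

lemma L2_complete:
  assumes L2: "\<And>n. in_L2 M (f n)"
    and cauchy: "\<And>e. 0 < e \<Longrightarrow> \<exists>N. \<forall>m\<ge>N. \<forall>n\<ge>N. L2_norm M (\<lambda>x. f m x - f n x) \<le> e"
  shows "\<exists>g. in_L2 M g \<and> (\<lambda>n. L2_norm M (\<lambda>x. f n x - g x)) \<longlonglongrightarrow> 0"
proof -
  have [measurable]: "f n \<in> borel_measurable M" for n using L2 by (rule in_L2_borel)
  have "\<forall>k. \<exists>N. \<forall>m\<ge>N. \<forall>n\<ge>N. L2_norm M (\<lambda>x. f m x - f n x) \<le> (1/2)^k"
    using cauchy by simp
  then obtain r0 where r0: "\<And>k m n. m \<ge> r0 k \<Longrightarrow> n \<ge> r0 k \<Longrightarrow> L2_norm M (\<lambda>x. f m x - f n x) \<le> (1/2)^k"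
    by metis
  \<comment> \<open>The running maximum makes the chosen indices monotone, so that two consecutive
    members of the subsequence both lie beyond \<open>r k\<close> and differ by at most
    \<open>(1/2)^k\<close>.\<close>
  define r where "r k = Max (r0 ` {..k})" for k
  have r_mono: "r j \<le> r k" if "j \<le> k" for j k
    unfolding r_def using that by (intro Max_mono) auto
  have r0_le: "r0 k \<le> r k" for k unfolding r_def by (intro Max_ge) auto
  have r: "L2_norm M (\<lambda>x. f m x - f n x) \<le> (1/2)^k" if "m \<ge> r k" "n \<ge> r k" for m n k
    using r0[of k m n] r0_le[of k] that by auto
  define d where "d k x = f (r (Suc k)) x - f (r k) x" for k x
  have d_L2: "in_L2 M (d k)" for k unfolding d_def by (intro in_L2_diff L2)
  have [measurable]: "d k \<in> borel_measurable M" for k using d_L2 by (rule in_L2_borel)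
  have d_int: "(\<integral>\<^sup>+x. ennreal \<bar>d k x\<bar> \<partial>M) \<le> ennreal ((1/2)^k)" for k
  proof -
    have "(\<integral>x. \<bar>d k x\<bar> \<partial>M) \<le> L2_norm M (d k)" by (rule integral_abs_le_L2_norm[OF d_L2])
    also have "\<dots> \<le> (1/2)^k" unfolding d_def by (intro r r_mono) auto
    finally show ?thesis
      using in_L2_integrable[OF d_L2] by (subst nn_integral_eq_integral) (auto simp: ennreal_leI)
  qed
  have "(\<integral>\<^sup>+x. (\<Sum>k. ennreal \<bar>d k x\<bar>) \<partial>M) = (\<Sum>k. \<integral>\<^sup>+x. ennreal \<bar>d k x\<bar> \<partial>M)"
    by (intro nn_integral_suminf) auto
  also have "\<dots> \<le> (\<Sum>k. ennreal ((1/2)^k))" by (intro suminf_le d_int) auto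
  also have "\<dots> = ennreal (\<Sum>k. (1/2)^k)"
    by (intro suminf_ennreal2) auto
  also have "\<dots> < \<infinity>" by simp
  finally have "(\<integral>\<^sup>+x. (\<Sum>k. ennreal \<bar>d k x\<bar>) \<partial>M) \<noteq> \<infinity>" by simp
  then have "AE x in M. (\<Sum>k. ennreal \<bar>d k x\<bar>) \<noteq> \<infinity>"
    by (intro nn_integral_noteq_infinite) auto
  then have conv: "AE x in M. convergent (\<lambda>k. f (r k) x)"
  proof eventually_elim
    case (elim x)
    have "summable (\<lambda>k. \<bar>d k x\<bar>)"
      using elim by (intro summable_suminf_not_top) auto
    then have "summable (\<lambda>k. d k x)" by (rule summable_rabs_cancel)
    then have "convergent (\<lambda>n. (\<Sum>k<n. d k x) + f (r 0) x)"
      by (intro convergent_add convergent_const) (simp add: summable_iff_convergent)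
    moreover have "(\<Sum>k<n. d k x) + f (r 0) x = f (r n) x" for n
      unfolding d_def by (induction n) auto
    ultimately show ?case by simp
  qed
  define g where "g x = lim (\<lambda>k. f (r k) x)" for x
  have [measurable]: "g \<in> borel_measurable M" unfolding g_def by measurable
  have lim: "AE x in M. (\<lambda>k. f (r k) x) \<longlonglongrightarrow> g x"
    using conv by eventually_elim (simp add: g_def convergent_LIMSEQ_iff)
  have fatou: "(\<integral>\<^sup>+x. ennreal ((f n x - g x)\<^sup>2) \<partial>M) \<le> ennreal (((1/2)^k)\<^sup>2)" if n: "n \<ge> r k" for n k
  proof -
    have "(\<integral>\<^sup>+x. ennreal ((f n x - g x)\<^sup>2) \<partial>M)
        = (\<integral>\<^sup>+x. liminf (\<lambda>j. ennreal ((f n x - f (r j) x)\<^sup>2)) \<partial>M)"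
    proof (rule nn_integral_cong_AE)
      show "AE x in M. ennreal ((f n x - g x)\<^sup>2) = liminf (\<lambda>j. ennreal ((f n x - f (r j) x)\<^sup>2))"
        using lim
      proof eventually_elim
        case (elim x)
        have "(\<lambda>j. ennreal ((f n x - f (r j) x)\<^sup>2)) \<longlonglongrightarrow> ennreal ((f n x - g x)\<^sup>2)"
          by (intro tendsto_intros elim)
        then show ?case by (intro lim_imp_Liminf[symmetric]) auto
      qed
    qed
    also have "\<dots> \<le> liminf (\<lambda>j. \<integral>\<^sup>+x. ennreal ((f n x - f (r j) x)\<^sup>2) \<partial>M)"
      by (rule nn_integral_liminf) auto
    also have "\<dots> \<le> limsup (\<lambda>j. \<integral>\<^sup>+x. ennreal ((f n x - f (r j) x)\<^sup>2) \<partial>M)"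
      by (rule Liminf_le_Limsup) auto
    also have "\<dots> \<le> ennreal (((1/2)^k)\<^sup>2)"
    proof (rule Limsup_bounded)
      show "\<forall>\<^sub>F j in sequentially. (\<integral>\<^sup>+x. ennreal ((f n x - f (r j) x)\<^sup>2) \<partial>M) \<le> ennreal (((1/2)^k)\<^sup>2)"
        using eventually_ge_at_top[of k]
      proof eventually_elim
        case (elim j)
        have "(\<integral>\<^sup>+x. ennreal ((f n x - f (r j) x)\<^sup>2) \<partial>M) = ennreal ((L2_norm M (\<lambda>x. f n x - f (r j) x))\<^sup>2)"
          unfolding L2_norm_power2
          by (intro nn_integral_eq_integral in_L2_sq in_L2_diff L2) auto
        also have "\<dots> \<le> ennreal (((1/2)^k)\<^sup>2)"
          using r[OF n r_mono[OF elim]] by (intro ennreal_leI power_mono) auto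
        finally show ?case .
      qed
    qed
    finally show ?thesis .
  qed
  have diff_L2: "in_L2 M (\<lambda>x. f n x - g x)" if "n \<ge> r 0" for n
    unfolding in_L2_def
  proof
    show "integrable M (\<lambda>x. (f n x - g x)\<^sup>2)"
      using fatou[OF that] by (intro integrableI_nonneg) (auto intro: le_less_trans)
  qed simp
  have g_L2: "in_L2 M g"
    using in_L2_diff[OF L2 diff_L2[OF order_refl], of "r 0"] by simp
  have bound: "L2_norm M (\<lambda>x. f n x - g x) \<le> (1/2)^k" if n: "n \<ge> r k" for n k
  proof -
    have "ennreal ((L2_norm M (\<lambda>x. f n x - g x))\<^sup>2) = (\<integral>\<^sup>+x. ennreal ((f n x - g x)\<^sup>2) \<partial>M)"
      unfolding L2_norm_power2
      by (intro nn_integral_eq_integral[symmetric] in_L2_sq in_L2_diff L2 g_L2) auto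
    then have "ennreal ((L2_norm M (\<lambda>x. f n x - g x))\<^sup>2) \<le> ennreal (((1/2)^k)\<^sup>2)"
      using fatou[OF n] by (simp only:)
    then have "(L2_norm M (\<lambda>x. f n x - g x))\<^sup>2 \<le> ((1/2)^k)\<^sup>2"
      by (subst (asm) ennreal_le_iff) simp_all
    then show ?thesis by (rule power2_le_imp_le) simp
  qed
  have "(\<lambda>n. L2_norm M (\<lambda>x. f n x - g x)) \<longlonglongrightarrow> 0"
  proof (rule LIMSEQ_I)
    fix e :: real assume "0 < e"
    then obtain k where k: "(1/2)^k < e" using real_arch_pow_inv[of e "1/2"] by auto
    show "\<exists>no. \<forall>n\<ge>no. norm (L2_norm M (\<lambda>x. f n x - g x) - 0) < e"
      using bound[of k] k by (intro exI[of _ "r k"]) (auto intro: le_less_trans)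
  qed
  then show ?thesis using g_L2 by blast
qed

end

section \<open>Conditional Minkowski and Jensen inequalities\<close>

context sigma_finite_subalgebra
begin

text \<open>For one fixed weight, \<open>square_add_le_weighted\<close> passes through the
  conditional expectation by linearity and monotonicity, off a null set depending on the weight. The
  rational weights share one null set, and off it the weight can be optimised separately at each
  point.\<close>

lemma real_cond_exp_minkowski:
  assumes "in_L2 M f" "in_L2 M g"
  shows "AE x in M. sqrt (real_cond_exp M F (\<lambda>y. (f y + g y)\<^sup>2) x)
    \<le> sqrt (real_cond_exp M F (\<lambda>y. (f y)\<^sup>2) x) + sqrt (real_cond_exp M F (\<lambda>y. (g y)\<^sup>2) x)"
proof -
  have [measurable]: "f \<in> borel_measurable M" "g \<in> borel_measurable M"
    using assms by (auto intro: in_L2_borel)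
  note int = in_L2_sq[OF assms(1)] in_L2_sq[OF assms(2)] in_L2_sq[OF in_L2_add[OF assms]]
  have "AE x in M. 0 < q \<longrightarrow> real_cond_exp M F (\<lambda>y. (f y + g y)\<^sup>2) x
      \<le> (1 + of_rat q) * real_cond_exp M F (\<lambda>y. (f y)\<^sup>2) x
        + (1 + 1 / of_rat q) * real_cond_exp M F (\<lambda>y. (g y)\<^sup>2) x" for q :: rat
  proof (cases "0 < q")
    case True
    then have q: "0 < (of_rat q :: real)" by simp
    have "AE x in M. real_cond_exp M F (\<lambda>y. (f y + g y)\<^sup>2) x
        \<le> real_cond_exp M F (\<lambda>x. (1 + of_rat q) * (f x)\<^sup>2 + (1 + 1 / of_rat q) * (g x)\<^sup>2) x"
      using int by (intro real_cond_exp_mono) (auto intro!: square_add_le_weighted q)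
    moreover have "AE x in M. real_cond_exp M F (\<lambda>x. (1 + of_rat q) * (f x)\<^sup>2 + (1 + 1 / of_rat q) * (g x)\<^sup>2) x
       = real_cond_exp M F (\<lambda>x. (1 + of_rat q) * (f x)\<^sup>2) x + real_cond_exp M F (\<lambda>x. (1 + 1 / of_rat q) * (g x)\<^sup>2) x"
      using int by (intro real_cond_exp_add) auto
    moreover note real_cond_exp_cmult[OF int(1), of "1 + of_rat q"] real_cond_exp_cmult[OF int(2), of "1 + 1 / of_rat q"]
    ultimately show ?thesis by eventually_elim auto
  qed auto
  then have "AE x in M. \<forall>q::rat. 0 < q \<longrightarrow> real_cond_exp M F (\<lambda>y. (f y + g y)\<^sup>2) x
      \<le> (1 + of_rat q) * real_cond_exp M F (\<lambda>y. (f y)\<^sup>2) x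
        + (1 + 1 / of_rat q) * real_cond_exp M F (\<lambda>y. (g y)\<^sup>2) x"
    by (simp add: AE_all_countable)
  moreover have "AE x in M. 0 \<le> real_cond_exp M F (\<lambda>y. (f y)\<^sup>2) x"
    by (intro real_cond_exp_pos) auto
  moreover have "AE x in M. 0 \<le> real_cond_exp M F (\<lambda>y. (g y)\<^sup>2) x"
    by (intro real_cond_exp_pos) auto
  ultimately show ?thesis
    by eventually_elim (intro sqrt_triangle_of_weighted_bounds, auto)
qed

lemma real_cond_exp_minkowski_sum:
  assumes "finite I" "\<And>i. i \<in> I \<Longrightarrow> in_L2 M (f i)"
  shows "AE x in M. sqrt (real_cond_exp M F (\<lambda>y. (\<Sum>i\<in>I. f i y)\<^sup>2) x)
    \<le> (\<Sum>i\<in>I. sqrt (real_cond_exp M F (\<lambda>y. (f i y)\<^sup>2) x))"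
  using assms
proof (induction I)
  case empty
  have "AE x in M. real_cond_exp M F (\<lambda>y. 0) x = 0" by (intro real_cond_exp_F_meas) auto
  then show ?case by eventually_elim simp
next
  case (insert i I)
  have "AE x in M. sqrt (real_cond_exp M F (\<lambda>y. (f i y + (\<Sum>i\<in>I. f i y))\<^sup>2) x)
    \<le> sqrt (real_cond_exp M F (\<lambda>y. (f i y)\<^sup>2) x) + sqrt (real_cond_exp M F (\<lambda>y. (\<Sum>i\<in>I. f i y)\<^sup>2) x)"
    using insert.prems by (intro real_cond_exp_minkowski in_L2_sum) auto
  moreover have "AE x in M. sqrt (real_cond_exp M F (\<lambda>y. (\<Sum>i\<in>I. f i y)\<^sup>2) x)
    \<le> (\<Sum>i\<in>I. sqrt (real_cond_exp M F (\<lambda>y. (f i y)\<^sup>2) x))"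
    using insert by auto
  ultimately show ?case by eventually_elim (use insert.hyps in auto)
qed

end

lemma (in finite_measure_subalgebra) real_cond_exp_power2:
  assumes "in_L2 M f"
  shows in_L2_real_cond_exp: "in_L2 M (real_cond_exp M F f)"
    and real_cond_exp_power2_le: "AE x in M. (real_cond_exp M F f x)\<^sup>2 \<le> real_cond_exp M F (\<lambda>x. (f x)\<^sup>2) x"
    and L2_norm_real_cond_exp: "L2_norm M (real_cond_exp M F f) \<le> L2_norm M f"
proof -
  have int: "integrable M f"
    by (rule square_integrable_imp_integrable[OF in_L2_borel[OF assms] in_L2_sq[OF assms]])
  have cv: "convex_on UNIV (\<lambda>x::real. x\<^sup>2)" by (rule convex_power2)
  have sq: "integrable M (\<lambda>x. (f x)\<^sup>2)" by (rule in_L2_sq[OF assms])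
  show le: "AE x in M. (real_cond_exp M F f x)\<^sup>2 \<le> real_cond_exp M F (\<lambda>x. (f x)\<^sup>2) x"
    using real_cond_exp_jensens_inequality(2)[OF int, where q = "\<lambda>x. x\<^sup>2" and I = UNIV] cv sq by auto
  have i: "integrable M (\<lambda>x. (real_cond_exp M F f x)\<^sup>2)"
    using integrable_convex_cond_exp[OF int, where q = "\<lambda>x. x\<^sup>2" and I = UNIV] cv sq by auto
  then show "in_L2 M (real_cond_exp M F f)" by (simp add: in_L2_def)
  have "(\<integral>x. (real_cond_exp M F f x)\<^sup>2 \<partial>M) \<le> (\<integral>x. real_cond_exp M F (\<lambda>x. (f x)\<^sup>2) x \<partial>M)"
    using le i sq by (intro integral_mono_AE) auto
  also have "\<dots> = (\<integral>x. (f x)\<^sup>2 \<partial>M)" using sq by (rule real_cond_exp_int)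
  finally show "L2_norm M (real_cond_exp M F f) \<le> L2_norm M f" by (simp add: L2_norm_def)
qed

section \<open>The stationary system\<close>

locale stationary_system = prob_space M for M :: "'a measure" +
  fixes \<theta> :: "'a \<Rightarrow> 'a" and F0 :: "'a measure"
  assumes preserving: "bimeasurable_preserving M \<theta>"
    and F0_subalgebra: "subalgebra M F0"
    and F0_incl: "sets F0 \<subseteq> sets (vimage_algebra (space M) \<theta> F0)"
begin

abbreviation T :: "int \<Rightarrow> 'a \<Rightarrow> 'a" where "T \<equiv> theta_pow M \<theta>"
abbreviation \<F> :: "int \<Rightarrow> 'a measure" where "\<F> \<equiv> Filt M \<theta> F0"
abbreviation E :: "int \<Rightarrow> ('a \<Rightarrow> real) \<Rightarrow> 'a \<Rightarrow> real" where "E \<equiv> cexp M \<theta> F0"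
abbreviation \<phi> :: "'a \<Rightarrow> 'a" where "\<phi> \<equiv> the_inv_into (space M) \<theta>"

lemma T_0 [simp]: "T 0 x = x"
  by (simp add: theta_pow_def)

lemma theta_bij: "bij_betw \<theta> (space M) (space M)"
  using preserving by (simp add: bimeasurable_preserving_def)

lemma phi_theta: "x \<in> space M \<Longrightarrow> \<phi> (\<theta> x) = x"
  using theta_bij by (intro the_inv_into_f_f) (auto simp: bij_betw_def)

lemma theta_phi: "x \<in> space M \<Longrightarrow> \<theta> (\<phi> x) = x"
  using theta_bij by (intro f_the_inv_into_f) (auto simp: bij_betw_def)

lemma theta_measurable [measurable]: "\<theta> \<in> measurable M M"
  and phi_measurable [measurable]: "\<phi> \<in> measurable M M"
  and theta_distr: "distr M M \<theta> = M"
  using preserving by (auto simp: bimeasurable_preserving_def)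

lemma phi_distr: "distr M M \<phi> = M"
proof -
  have "distr M M \<phi> = distr (distr M M \<theta>) M \<phi>" by (simp add: theta_distr)
  also have "\<dots> = distr M M (\<phi> \<circ> \<theta>)" by (rule distr_distr) auto
  also have "\<dots> = distr M M (\<lambda>x. x)"
    by (rule distr_cong) (auto simp: phi_theta)
  also have "\<dots> = M" by (rule distr_id)
  finally show ?thesis .
qed

lemma funpow_measure_preserving:
  assumes [measurable]: "f \<in> measurable M M" and d: "distr M M f = M"
  shows "f ^^ n \<in> measurable M M \<and> distr M M (f ^^ n) = M"
proof (induction n)
  case 0
  show ?case using distr_id[of M] by (simp add: id_def)
next
  case (Suc n)
  then have [measurable]: "f ^^ n \<in> measurable M M" by simp
  have "distr M M (f \<circ> f ^^ n) = distr (distr M M (f ^^ n)) M f"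
    by (rule distr_distr[symmetric]) auto
  then have "distr M M (f \<circ> f ^^ n) = M" using Suc d by simp
  then show ?case using measurable_comp[OF _ assms(1), of "f ^^ n" M] by (simp only: funpow.simps) simp
qed

lemma T_measurable [measurable]: "T i \<in> measurable M M"
  and T_distr: "distr M M (T i) = M"
  using funpow_measure_preserving[OF theta_measurable theta_distr]
    funpow_measure_preserving[OF phi_measurable phi_distr]
  by (simp_all add: theta_pow_def)

lemma T_space: "x \<in> space M \<Longrightarrow> T i x \<in> space M"
  by (rule measurable_space[OF T_measurable])

lemma T_plus_1:
  assumes "x \<in> space M"
  shows "T (i + 1) x = \<theta> (T i x)"
proof (cases "0 \<le> i")
  case True
  then have "nat (i + 1) = Suc (nat i)" by simp
  then show ?thesis using True by (simp add: theta_pow_def)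
next
  case False
  define n where "n = nat (- i - 1)"
  have i: "i = - int (Suc n)" using False by (simp add: n_def)
  have "\<theta> (T i x) = \<theta> (\<phi> (T (- int n) x))"
    using i by (auto simp: theta_pow_def nat_add_distrib)
  also have "\<dots> = T (- int n) x" by (intro theta_phi T_space assms)
  finally show ?thesis using i by simp
qed

lemma T_minus_1:
  assumes "x \<in> space M"
  shows "T (i - 1) x = \<phi> (T i x)"
proof -
  have "\<phi> (T i x) = \<phi> (\<theta> (T (i - 1) x))" using T_plus_1[OF assms, of "i - 1"] by simp
  then show ?thesis using assms by (simp add: phi_theta T_space)
qed

lemma T_add:
  assumes x: "x \<in> space M"
  shows "T (i + j) x = T i (T j x)"
proof (induction i rule: int_induct[where k = 0])
  case base
  then show ?case by simp
next
  case (step1 i)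
  have "T (i + 1 + j) x = \<theta> (T (i + j) x)"
    using T_plus_1[OF x, of "i + j"] by (simp add: algebra_simps)
  also have "\<dots> = T (i + 1) (T j x)"
    using step1 T_plus_1[OF T_space[OF x], of i j] by simp
  finally show ?case .
next
  case (step2 i)
  have "T (i - 1 + j) x = \<phi> (T (i + j) x)"
    using T_minus_1[OF x, of "i + j"] by (simp add: algebra_simps)
  also have "\<dots> = T (i - 1) (T j x)"
    using step2 T_minus_1[OF T_space[OF x], of i j] by simp
  finally show ?case .
qed

lemma AE_shift:
  assumes "AE x in M. P x"
  shows "AE x in M. P (T i x)"
proof -
  have "AE x in distr M M (T i). P x" using assms by (simp only: T_distr)
  then show ?thesis by (rule AE_distrD[OF T_measurable])
qed

lemma integrable_shift:
  fixes f :: "'a \<Rightarrow> real"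
  assumes "integrable M f"
  shows "integrable M (\<lambda>x. f (T i x))"
proof -
  have "integrable (distr M M (T i)) f" using assms by (simp only: T_distr)
  then show ?thesis by (rule integrable_distr[OF T_measurable])
qed

lemma integral_shift:
  fixes f :: "'a \<Rightarrow> real"
  assumes "f \<in> borel_measurable M"
  shows "(\<integral>x. f (T i x) \<partial>M) = (\<integral>x. f x \<partial>M)"
  using integral_distr[OF T_measurable[of i] assms] by (simp add: T_distr)

lemma in_L2_shift:
  assumes "in_L2 M f"
  shows "in_L2 M (\<lambda>x. f (T i x))"
proof -
  have "(\<lambda>x. f (T i x)) \<in> borel_measurable M"
    using in_L2_borel[OF assms] by measurable
  then show ?thesis
    using integrable_shift[OF in_L2_sq[OF assms], of i] by (simp add: in_L2_def)
qed

lemma L2_norm_shift: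
  assumes "in_L2 M f"
  shows "L2_norm M (\<lambda>x. f (T i x)) = L2_norm M f"
  unfolding L2_norm_def
  using integral_shift[of "\<lambda>x. (f x)\<^sup>2" i] in_L2_sq[OF assms] by simp

section \<open>The filtration generated by the shift\<close>

lemma space_Filt [simp]: "space (\<F> i) = space M"
  by (simp add: Filt_def)

lemma space_F0: "space F0 = space M"
  using F0_subalgebra by (simp add: subalgebra_def)

lemma T_measurable_F0: "T i \<in> measurable M F0"
  by (rule measurableI) (use T_space space_F0 F0_subalgebra measurable_sets[OF T_measurable] in \<open>auto simp: subalgebra_def\<close>)

lemma sets_Filt: "sets (\<F> i) = {T i -` A \<inter> space M |A. A \<in> sets F0}"
  unfolding Filt_def
  by (rule sets_vimage_algebra2) (use T_space space_F0 in auto)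

lemma sets_Filt_0: "sets (\<F> 0) = sets F0"
proof -
  have "T 0 -` A \<inter> space M = A" if "A \<in> sets F0" for A
    using sets.sets_into_space[OF that] space_F0 by auto
  then show ?thesis unfolding sets_Filt by (auto intro: sym)
qed

lemma Filt_subalgebra: "subalgebra M (\<F> i)"
  unfolding subalgebra_def sets_Filt using measurable_sets[OF T_measurable_F0] by auto

lemma sets_Filt_Suc: "sets (\<F> i) \<subseteq> sets (\<F> (i + 1))"
proof
  fix A assume "A \<in> sets (\<F> i)"
  then obtain B where B: "B \<in> sets F0" "A = T i -` B \<inter> space M" by (auto simp: sets_Filt)
  have "sets (vimage_algebra (space M) \<theta> F0) = {\<theta> -` A \<inter> space M |A. A \<in> sets F0}"
    using measurable_space[OF theta_measurable] space_F0 by (intro sets_vimage_algebra2) auto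
  then obtain C where C: "C \<in> sets F0" "B = \<theta> -` C \<inter> space M"
    using B(1) F0_incl by auto
  have "A = T (i + 1) -` C \<inter> space M"
    unfolding B(2) C(2) by (auto simp: T_plus_1 T_space)
  then show "A \<in> sets (\<F> (i + 1))" using C by (auto simp: sets_Filt)
qed

lemma Filt_mono:
  assumes "i \<le> j"
  shows "subalgebra (\<F> j) (\<F> i)"
proof -
  have "sets (\<F> i) \<subseteq> sets (\<F> j)"
    using assms by (induction j rule: int_ge_induct) (use sets_Filt_Suc in blast)+
  then show ?thesis by (simp add: subalgebra_def)
qed

lemma T_measurable_Filt: "T i \<in> measurable (\<F> (i + j)) (\<F> j)"
proof (rule measurableI)
  fix A assume "A \<in> sets (\<F> j)"
  then obtain B where B: "B \<in> sets F0" "A = T j -` B \<inter> space M" by (auto simp: sets_Filt)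
  have "T i -` A \<inter> space (\<F> (i + j)) = T (j + i) -` B \<inter> space M"
    unfolding B(2) by (auto simp: T_add T_space)
  then show "T i -` A \<inter> space (\<F> (i + j)) \<in> sets (\<F> (i + j))"
    using B by (auto simp: sets_Filt add.commute)
qed (simp add: T_space)

lemma borel_measurable_Filt_mono:
  "i \<le> j \<Longrightarrow> f \<in> borel_measurable (\<F> i) \<Longrightarrow> f \<in> borel_measurable (\<F> j)"
  by (rule measurable_from_subalg[OF Filt_mono])

lemma shift_borel_measurable_Filt:
  assumes "f \<in> borel_measurable (\<F> j)" "i + j \<le> k"
  shows "(\<lambda>x. f (T i x)) \<in> borel_measurable (\<F> k)"
  by (rule borel_measurable_Filt_mono[OF assms(2)])
    (rule measurable_compose[OF T_measurable_Filt assms(1)])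

lemma Filt_fms: "finite_measure_subalgebra M (\<F> k)"
  by unfold_locales (rule Filt_subalgebra)

lemma Filt_sfs: "sigma_finite_subalgebra M (\<F> k)"
proof -
  interpret finite_measure_subalgebra M "\<F> k" by (rule Filt_fms)
  show ?thesis by unfold_locales
qed

section \<open>Conditional expectations along the filtration and their shifts\<close>

lemmas E_add = sigma_finite_subalgebra.real_cond_exp_add[OF Filt_sfs, folded cexp_def]
lemmas E_diff = sigma_finite_subalgebra.real_cond_exp_diff[OF Filt_sfs, folded cexp_def]
lemmas E_cmult = sigma_finite_subalgebra.real_cond_exp_cmult[OF Filt_sfs, folded cexp_def]
lemmas E_sum = sigma_finite_subalgebra.real_cond_exp_sum[OF Filt_sfs, folded cexp_def]
lemmas E_mult = sigma_finite_subalgebra.real_cond_exp_mult[OF Filt_sfs, folded cexp_def]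
lemmas E_mono = sigma_finite_subalgebra.real_cond_exp_mono[OF Filt_sfs, folded cexp_def]
lemmas E_nonneg = sigma_finite_subalgebra.real_cond_exp_pos[OF Filt_sfs, folded cexp_def]
lemmas E_cong = sigma_finite_subalgebra.real_cond_exp_cong[OF Filt_sfs, folded cexp_def]
lemmas E_F_meas = sigma_finite_subalgebra.real_cond_exp_F_meas[OF Filt_sfs, folded cexp_def]
lemmas E_integrable = sigma_finite_subalgebra.real_cond_exp_int(1)[OF Filt_sfs, folded cexp_def]
lemmas E_integral = sigma_finite_subalgebra.real_cond_exp_int(2)[OF Filt_sfs, folded cexp_def]
lemmas E_minkowski = sigma_finite_subalgebra.real_cond_exp_minkowski[OF Filt_sfs, folded cexp_def]
lemmas E_minkowski_sum = sigma_finite_subalgebra.real_cond_exp_minkowski_sum[OF Filt_sfs, folded cexp_def]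
lemmas E_in_L2 = finite_measure_subalgebra.in_L2_real_cond_exp[OF Filt_fms, folded cexp_def]
lemmas E_power2_le = finite_measure_subalgebra.real_cond_exp_power2_le[OF Filt_fms, folded cexp_def]
lemmas E_L2_norm = finite_measure_subalgebra.L2_norm_real_cond_exp[OF Filt_fms, folded cexp_def]

lemma E_borel [measurable]: "E k f \<in> borel_measurable (\<F> k)"
  and E_borel_M [measurable]: "E k f \<in> borel_measurable M"
  by (auto simp: cexp_def)

lemma E_nested:
  assumes "k \<le> j" "integrable M f"
  shows "AE x in M. E k (E j f) x = E k f x"
  unfolding cexp_def
  by (rule sigma_finite_subalgebra.real_cond_exp_nested_subalg[OF Filt_sfs])
    (use assms Filt_subalgebra Filt_mono in auto)

text \<open>Sets of \<open>\<F> (i + j)\<close> are preimages under \<open>T i\<close> of sets of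
  \<open>\<F> j\<close>, and \<open>T i\<close> preserves the measure, so the integrals
  characterising both sides agree.\<close>

lemma E_shift:
  assumes f: "integrable M f"
  shows "AE x in M. E (i + j) (\<lambda>y. f (T i y)) x = E j f (T i x)"
proof -
  interpret G: sigma_finite_subalgebra M "\<F> (i + j)" by (rule Filt_sfs)
  interpret H: sigma_finite_subalgebra M "\<F> j" by (rule Filt_sfs)
  have [measurable]: "f \<in> borel_measurable M" using f by simp
  show ?thesis
    unfolding cexp_def
  proof (rule G.real_cond_exp_charact)
    fix A assume A: "A \<in> sets (\<F> (i + j))"
    then obtain C where C: "C \<in> sets F0" "A = T (i + j) -` C \<inter> space M" by (auto simp: sets_Filt)
    define B where "B = T j -` C \<inter> space M"
    have B: "B \<in> sets (\<F> j)" using C by (auto simp: B_def sets_Filt)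
    then have [measurable]: "B \<in> sets M" using Filt_subalgebra by (auto simp: subalgebra_def)
    have ind: "indicator A x = (indicator B (T i x) :: real)" if "x \<in> space M" for x
      using that by (auto simp: C(2) B_def indicator_def T_space add.commute[of i] T_add)
    have *: "(\<integral>x\<in>A. g (T i x) \<partial>M) = (\<integral>x\<in>B. g x \<partial>M)"
      if [measurable]: "g \<in> borel_measurable M" for g :: "'a \<Rightarrow> real"
    proof -
      have "(\<integral>x\<in>A. g (T i x) \<partial>M) = (\<integral>x. indicator B (T i x) *\<^sub>R g (T i x) \<partial>M)"
        unfolding set_lebesgue_integral_def
        by (intro Bochner_Integration.integral_cong) (auto simp: ind)
      also have "\<dots> = (\<integral>x\<in>B. g x \<partial>M)"
        unfolding set_lebesgue_integral_def by (rule integral_shift) measurable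
      finally show ?thesis .
    qed
    show "(\<integral>x\<in>A. f (T i x) \<partial>M) = (\<integral>x\<in>A. real_cond_exp M (\<F> j) f (T i x) \<partial>M)"
      using H.real_cond_exp_intA[OF f B] by (simp add: *)
  next
    show "integrable M (\<lambda>x. f (T i x))" by (rule integrable_shift[OF f])
    show "integrable M (\<lambda>x. real_cond_exp M (\<F> j) f (T i x))"
      by (rule integrable_shift) (rule H.real_cond_exp_int[OF f])
    show "(\<lambda>x. real_cond_exp M (\<F> j) f (T i x)) \<in> borel_measurable (\<F> (i + j))"
      by (rule shift_borel_measurable_Filt) auto
  qed
qed

text \<open>\<open>E 0 f\<close> composed with \<open>T i\<close> is the conditional expectation of
  the shifted \<open>f\<close> at time \<open>i\<close>, and \<open>\<F> 0\<close> is contained in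
  \<open>\<F> i\<close> for \<open>0 \<le> i\<close>. With \<open>Q^i f\<close> standing for
  \<open>E 0 (f o T i)\<close>, this yields the semigroup law
  \<open>Q^i Q^j = Q^(i+j)\<close>.\<close>

lemma E_nested_shift:
  assumes f: "integrable M f" and i: "0 \<le> i"
  shows "AE x in M. E 0 (\<lambda>y. E 0 f (T i y)) x = E 0 (\<lambda>y. f (T i y)) x"
proof -
  have "AE x in M. E i (\<lambda>y. f (T i y)) x = E 0 f (T i x)"
    using E_shift[OF f, of i 0] by simp
  then have "AE x in M. E 0 (E i (\<lambda>y. f (T i y))) x = E 0 (\<lambda>x. E 0 f (T i x)) x"
    by (rule E_cong) measurable
  moreover have "AE x in M. E 0 (E i (\<lambda>y. f (T i y))) x = E 0 (\<lambda>y. f (T i y)) x"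
    by (rule E_nested[OF i integrable_shift[OF f]])
  ultimately show ?thesis by eventually_elim simp
qed

end

section \<open>Hopf's maximal inequality\<close>

text \<open>A discrete layer cake formula: if \<open>a 2^N\<close> is the last level below
  \<open>y\<close>, then \<open>a\<close> and the levels crossed add up to \<open>a 2^(N+1)\<close>.
  It turns tail estimates at dyadic levels into a bound on an integral.\<close>

lemma ennreal_le_dyadic_levels:
  fixes y :: ennreal and a :: real
  assumes a: "0 < a"
  shows "y \<le> ennreal a + (\<Sum>i. ennreal (a * 2 ^ i) * indicator {z. ennreal (a * 2 ^ i) < z} y)"
proof -
  define S where "S N = (\<Sum>i<N. ennreal (a * 2 ^ i) * indicator {z. ennreal (a * 2 ^ i) < z} y)" for N
  \<comment> \<open>Truncating \<open>y\<close> at the next level makes the induction work also for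
    \<open>y\<close> infinite.\<close>
  have min_le: "min y (ennreal (a * 2 ^ N)) \<le> ennreal a + S N" for N
  proof (induction N)
    case 0
    then show ?case by (simp add: S_def)
  next
    case (Suc N)
    have "min y (ennreal (a * 2 ^ Suc N))
      \<le> min y (ennreal (a * 2 ^ N)) + ennreal (a * 2 ^ N) * indicator {z. ennreal (a * 2 ^ N) < z} y"
    proof (cases "ennreal (a * 2 ^ N) < y")
      case True
      have "ennreal (a * 2 ^ Suc N) = ennreal (a * 2 ^ N) + ennreal (a * 2 ^ N)"
        using a by (subst ennreal_plus[symmetric]) auto
      then show ?thesis using True by (simp add: min.coboundedI2)
    next
      case False
      then show ?thesis by (simp add: min.coboundedI1)
    qed
    also have "\<dots> \<le> ennreal a + S N + ennreal (a * 2 ^ N) * indicator {z. ennreal (a * 2 ^ N) < z} y"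
      by (intro add_right_mono Suc)
    finally show ?case by (simp add: S_def add.assoc)
  qed
  show ?thesis
  proof (rule dense_le)
    fix z assume z: "z < y"
    then have "z < top" by (auto intro: less_le_trans)
    then obtain r where r: "0 \<le> r" "z = ennreal r" by (cases z) auto
    obtain N :: nat where N: "r / a < 2 ^ N" using real_arch_pow[of 2 "r / a"] by auto
    then have "r \<le> a * 2 ^ N" using a by (simp add: field_simps)
    then have "z \<le> min y (ennreal (a * 2 ^ N))" using z r by (simp add: ennreal_leI)
    also have "\<dots> \<le> ennreal a + S N" by (rule min_le)
    also have "S N \<le> (\<Sum>i. ennreal (a * 2 ^ i) * indicator {z. ennreal (a * 2 ^ i) < z} y)"
      unfolding S_def by (rule sum_le_suminf) auto
    finally show "z \<le> ennreal a + (\<Sum>i. ennreal (a * 2 ^ i) * indicator {z. ennreal (a * 2 ^ i) < z} y)"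
      by (simp add: add_left_mono)
  qed
qed

context stationary_system
begin

text \<open>Garsia's proof of Hopf's maximal lemma for the operator \<open>f \<mapsto> E 0 (f \<circ> T i)\<close>.\<close>

lemma hopf_maximal:
  fixes s :: "nat \<Rightarrow> 'a \<Rightarrow> real"
  assumes f: "integrable M f" and s: "\<And>k. integrable M (s k)" and s0: "\<And>x. s 0 x = 0"
    and rec: "\<And>k. AE x in M. s (Suc k) x = f x + E 0 (\<lambda>y. s k (T i y)) x"
  shows "0 \<le> (\<integral>x. indicator {x. \<exists>k\<le>n. 0 < s k x} x * f x \<partial>M)"
proof -
  \<comment> \<open>Index 0 takes part in the maximum and \<open>s 0 = 0\<close>, so
    \<open>m\<close> is nonnegative and \<open>0 < m x\<close> describes exactly the set in the
    statement.\<close>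
  define m where "m x = Max ((\<lambda>k. s k x) ` {..n})" for x
  have m_int: "integrable M m"
  proof -
    have "integrable M (\<lambda>x. Max ((\<lambda>k. s k x) ` {..n}))"
    proof (induction n)
      case (Suc n)
      have "Max ((\<lambda>k. s k x) ` {..Suc n}) = max (s (Suc n) x) (Max ((\<lambda>k. s k x) ` {..n}))" for x
        by (simp add: atMost_Suc)
      then show ?case using Suc s by simp
    qed (simp add: s)
    then show ?thesis by (simp add: m_def[abs_def])
  qed
  have s_le_m: "s k x \<le> m x" if "k \<le> n" for k x
    unfolding m_def using that by (intro Max_ge) auto
  have m_nonneg: "0 \<le> m x" for x using s_le_m[of 0 x] s0 by simp
  have m_attained: "\<exists>k\<le>n. m x = s k x" for x
  proof -
    have "m x \<in> (\<lambda>k. s k x) ` {..n}" unfolding m_def by (rule Max_in) auto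
    then show ?thesis by auto
  qed
  have pos_iff: "(\<exists>k\<le>n. 0 < s k x) \<longleftrightarrow> 0 < m x" for x
    using m_attained[of x] s_le_m[of _ x] by (auto intro: less_le_trans)
  define Q where "Q g = E 0 (\<lambda>y. g (T i y))" for g :: "'a \<Rightarrow> real"
  have Qm_int: "integrable M (Q m)" "(\<integral>x. Q m x \<partial>M) = (\<integral>x. m x \<partial>M)"
    unfolding Q_def using integral_shift[of m i] m_int
    by (auto intro!: E_integrable integrable_shift simp: E_integral integrable_shift)
  have "AE x in M. s (Suc k) x \<le> f x + Q m x" if "k \<le> n" for k
  proof -
    have "AE x in M. Q (s k) x \<le> Q m x"
      unfolding Q_def using s_le_m[OF that] by (intro E_mono integrable_shift m_int s) auto
    with rec[of k] show ?thesis by eventually_elim (simp add: Q_def)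
  qed
  then have s_le: "AE x in M. \<forall>k. k \<le> n \<longrightarrow> s (Suc k) x \<le> f x + Q m x"
    unfolding AE_all_countable by (auto simp: AE_conjI)
  have Q_nonneg: "AE x in M. 0 \<le> Q m x"
    unfolding Q_def using m_nonneg integrable_shift[OF m_int] by (intro E_nonneg) auto
  \<comment> \<open>Where \<open>m\<close> is positive, the maximum is attained at a successor index
    and the recursion gives \<open>m \<le> f + Q m\<close>; elsewhere \<open>m\<close> is 0 and
    \<open>Q m\<close> is nonnegative.\<close>
  have "AE x in M. m x - Q m x \<le> indicator {x. \<exists>k\<le>n. 0 < s k x} x * f x"
    using s_le Q_nonneg
  proof eventually_elim
    case (elim x)
    show ?case
    proof (cases "0 < m x")
      case True
      obtain k where k: "k \<le> n" "m x = s k x" using m_attained by blast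
      then obtain j where "k = Suc j" using True s0 by (cases k) auto
      then have "m x \<le> f x + Q m x" using elim k by auto
      then show ?thesis using True pos_iff by simp
    next
      case False
      then have "m x = 0" using m_nonneg[of x] by simp
      then show ?thesis using False elim pos_iff by simp
    qed
  qed
  \<comment> \<open>The operator preserves integrals, so the left-hand side is 0.\<close>
  then have "(\<integral>x. m x - Q m x \<partial>M) \<le> (\<integral>x. indicator {x. \<exists>k\<le>n. 0 < s k x} x * f x \<partial>M)"
  proof (intro integral_mono_AE)
    have [measurable]: "m \<in> borel_measurable M" "f \<in> borel_measurable M" using m_int f by auto
    show "integrable M (\<lambda>x. indicator {x. \<exists>k\<le>n. 0 < s k x} x * f x)"
      unfolding pos_iff
      by (rule Bochner_Integration.integrable_bound[OF f]) (auto simp: indicator_def)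
    show "integrable M (\<lambda>x. m x - Q m x)" using m_int Qm_int by simp
  qed
  moreover have "(\<integral>x. m x - Q m x \<partial>M) = 0" using m_int Qm_int by simp
  ultimately show ?thesis by simp
qed

section \<open>Ergodic sums and the integrable maximal function\<close>

definition erg_sum :: "nat \<Rightarrow> ('a \<Rightarrow> real) \<Rightarrow> nat \<Rightarrow> 'a \<Rightarrow> real" where
  "erg_sum p g n x = (\<Sum>j<n. E 0 (\<lambda>y. g (T (int (p * j)) y)) x)"

text \<open>The root is taken inside the supremum because conditional L2 norms are compared with it.
  Extended values allow an infinite supremum, and \<open>ennreal\<close> sends the negative values
  that may occur on a null set to 0.\<close>

definition maxfun :: "nat \<Rightarrow> ('a \<Rightarrow> real) \<Rightarrow> 'a \<Rightarrow> ennreal" where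
  "maxfun p g x = (SUP n. ennreal (sqrt (erg_sum p g (Suc n) x / real (Suc n))))"

lemma erg_sum_borel [measurable]: "erg_sum p g n \<in> borel_measurable M"
  unfolding erg_sum_def[abs_def] by measurable

lemma maxfun_borel [measurable]: "maxfun p g \<in> borel_measurable M"
  unfolding maxfun_def[abs_def] by measurable

lemma erg_sum_integrable:
  assumes "integrable M g"
  shows "integrable M (erg_sum p g n)"
  unfolding erg_sum_def[abs_def] using assms
  by (intro Bochner_Integration.integrable_sum E_integrable integrable_shift)

text \<open>By the semigroup law the operator moves each term to the next one; the missing zeroth
  term is \<open>g\<close> itself because \<open>g\<close> is \<open>\<F> 0\<close>-measurable. This
  is the recursion that \<open>hopf_maximal\<close> asks for.\<close>

lemma erg_sum_Suc:
  assumes g: "integrable M g" "g \<in> borel_measurable (\<F> 0)"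
  shows "AE x in M. erg_sum p g (Suc n) x = g x + E 0 (\<lambda>y. erg_sum p g n (T (int p) y)) x"
proof -
  have "AE x in M. E 0 (\<lambda>y. E 0 (\<lambda>y. g (T (int (p * j)) y)) (T (int p) y)) x
      = E 0 (\<lambda>y. g (T (int (p * Suc j)) y)) x" for j
  proof -
    have "AE x in M. E 0 (\<lambda>y. E 0 (\<lambda>y. g (T (int (p * j)) y)) (T (int p) y)) x
      = E 0 (\<lambda>y. g (T (int (p * j)) (T (int p) y))) x"
      by (rule E_nested_shift) (auto intro: integrable_shift g)
    moreover have "AE x in M. E 0 (\<lambda>y. g (T (int (p * j)) (T (int p) y))) x
      = E 0 (\<lambda>y. g (T (int (p * Suc j)) y)) x"
    proof (rule E_cong)
      show "AE x in M. g (T (int (p * j)) (T (int p) x)) = g (T (int (p * Suc j)) x)"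
        using T_add[of _ "int (p * j)" "int p"] by (intro AE_I2) (simp add: algebra_simps)
    qed (use g in measurable)
    ultimately show ?thesis by eventually_elim simp
  qed
  then have "AE x in M. \<forall>j. E 0 (\<lambda>y. E 0 (\<lambda>y. g (T (int (p * j)) y)) (T (int p) y)) x
      = E 0 (\<lambda>y. g (T (int (p * Suc j)) y)) x"
    by (simp add: AE_all_countable)
  moreover have "AE x in M. E 0 (\<lambda>y. erg_sum p g n (T (int p) y)) x
     = (\<Sum>j<n. E 0 (\<lambda>y. E 0 (\<lambda>y. g (T (int (p * j)) y)) (T (int p) y)) x)"
    unfolding erg_sum_def by (rule E_sum) (auto intro!: integrable_shift E_integrable g)
  moreover have "AE x in M. E 0 g x = g x" by (rule E_F_meas[OF g])
  ultimately show ?thesis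
    by eventually_elim (simp add: erg_sum_def sum.lessThan_Suc_shift distrib_left del: sum.lessThan_Suc)
qed

text \<open>Hopf's lemma for \<open>g - l\<close>: the sums of \<open>g - l\<close> become positive
  exactly where some average of \<open>g\<close> exceeds \<open>l\<close>, and on that set
  \<open>B\<close> the integral of \<open>g\<close> is at least \<open>l\<close> times the measure
  of \<open>B\<close>. The index \<open>k = 0\<close> contributes nothing since \<open>0 < 0\<close>
  fails.\<close>

lemma erg_sum_maximal:
  assumes g: "integrable M g" "g \<in> borel_measurable (\<F> 0)" "\<And>x. 0 \<le> g x" and l: "0 < l"
  shows "measure M {x \<in> space M. \<exists>k\<le>n. real k * l < erg_sum p g k x} \<le> (\<integral>x. g x \<partial>M) / l"
proof -
  define s where "s k x = erg_sum p g k x - real k * l" for k x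
  define B where "B = {x \<in> space M. \<exists>k\<le>n. real k * l < erg_sum p g k x}"
  have [measurable]: "B \<in> sets M" unfolding B_def by measurable
  have iB: "integrable M (indicator B :: 'a \<Rightarrow> real)"
    by (rule integrable_real_indicator) (auto simp: emeasure_eq_measure)
  have s_int: "integrable M (s k)" for k
    unfolding s_def[abs_def] by (intro Bochner_Integration.integrable_diff erg_sum_integrable g) auto
  have f_int: "integrable M (\<lambda>x. g x - l)" using g by simp
  have "0 \<le> (\<integral>x. indicator {x. \<exists>k\<le>n. 0 < s k x} x * (g x - l) \<partial>M)"
  proof (rule hopf_maximal[where i = "int p"])
    show "AE x in M. s (Suc k) x = g x - l + E 0 (\<lambda>y. s k (T (int p) y)) x" for k
    proof -
      have "AE x in M. E 0 (\<lambda>y. s k (T (int p) y)) x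
         = E 0 (\<lambda>y. erg_sum p g k (T (int p) y)) x - E 0 (\<lambda>y. real k * l) x"
        unfolding s_def by (rule E_diff) (auto intro!: integrable_shift erg_sum_integrable g)
      moreover have "AE x in M. E 0 (\<lambda>y. real k * l) x = real k * l" by (rule E_F_meas) auto
      moreover note erg_sum_Suc[OF g(1,2), of p k]
      ultimately show ?thesis by eventually_elim (simp add: s_def algebra_simps)
    qed
    show "s 0 x = 0" for x by (simp add: s_def erg_sum_def)
  qed (rule f_int s_int)+
  also have "\<dots> = (\<integral>x. indicator B x * (g x - l) \<partial>M)"
    by (rule Bochner_Integration.integral_cong) (auto simp: B_def s_def indicator_def)
  also have "\<dots> \<le> (\<integral>x. g x - l * indicator B x \<partial>M)"
  proof (rule integral_mono)
    show "integrable M (\<lambda>x. indicator B x * (g x - l))"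
      by (rule Bochner_Integration.integrable_bound[OF f_int]) (use f_int in \<open>auto simp: indicator_def\<close>)
    show "integrable M (\<lambda>x. g x - l * indicator B x)"
      using g iB by (intro Bochner_Integration.integrable_diff) auto
  qed (use g in \<open>auto simp: indicator_def\<close>)
  also have "\<dots> = (\<integral>x. g x \<partial>M) - l * measure M B"
    using g iB by (subst Bochner_Integration.integral_diff) auto
  finally show ?thesis using l by (simp add: B_def field_simps)
qed

text \<open>A root of an average exceeds \<open>t\<close> only if the average exceeds the square of
  \<open>t\<close>, hence the quadratic decay. The events with \<open>k \<le> n\<close> increase
  with \<open>n\<close>, so the bound survives the supremum.\<close>

lemma maxfun_weak_type:
  assumes g: "integrable M g" "g \<in> borel_measurable (\<F> 0)" "\<And>x. 0 \<le> g x" and t: "0 < t"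
  shows "emeasure M {x \<in> space M. ennreal t < maxfun p g x} \<le> ennreal ((\<integral>x. g x \<partial>M) / t\<^sup>2)"
proof -
  define B where "B n = {x \<in> space M. \<exists>k\<le>n. real k * t\<^sup>2 < erg_sum p g k x}" for n
  have [measurable]: "B n \<in> sets M" for n unfolding B_def by measurable
  have "{x \<in> space M. ennreal t < maxfun p g x} \<subseteq> (\<Union>n. B n)"
  proof
    fix x assume "x \<in> {x \<in> space M. ennreal t < maxfun p g x}"
    then obtain n where x: "x \<in> space M" "ennreal t < ennreal (sqrt (erg_sum p g (Suc n) x / real (Suc n)))"
      by (auto simp: maxfun_def less_SUP_iff)
    then have *: "t < sqrt (erg_sum p g (Suc n) x / real (Suc n))"
      using t by (subst (asm) ennreal_less_iff) auto
    have "t\<^sup>2 < erg_sum p g (Suc n) x / real (Suc n)"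
      using * t by (metis less_eq_real_def not_le real_le_lsqrt)
    then have "real (Suc n) * t\<^sup>2 < erg_sum p g (Suc n) x" by (simp add: field_simps)
    then show "x \<in> (\<Union>n. B n)" using x(1) unfolding B_def by blast
  qed
  then have "emeasure M {x \<in> space M. ennreal t < maxfun p g x} \<le> emeasure M (\<Union>n. B n)"
    by (intro emeasure_mono) auto
  also have "\<dots> = (SUP n. emeasure M (B n))"
    by (intro SUP_emeasure_incseq[symmetric]) (auto simp: B_def incseq_def intro: order_trans)
  also have "\<dots> \<le> ennreal ((\<integral>x. g x \<partial>M) / t\<^sup>2)"
    using erg_sum_maximal[OF g, of "t\<^sup>2" _ p] t
    by (intro SUP_least) (auto simp: B_def emeasure_eq_measure intro!: ennreal_leI)
  finally show ?thesis .
qed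

text \<open>Summing the tail bound \<open>C / t^2\<close> over the levels \<open>a 2^i\<close> gives
  \<open>a + 2 C / a\<close>. The choice \<open>a = sqrt C\<close> yields the constant 3; if
  \<open>C = 0\<close>, let \<open>a\<close> tend to 0.\<close>

lemma maxfun_nn_integral:
  assumes g: "integrable M g" "g \<in> borel_measurable (\<F> 0)" "\<And>x. 0 \<le> g x"
  shows "(\<integral>\<^sup>+x. maxfun p g x \<partial>M) \<le> ennreal (3 * sqrt (\<integral>x. g x \<partial>M))"
proof -
  define C where "C = (\<integral>x. g x \<partial>M)"
  have C: "0 \<le> C" using g by (simp add: C_def)
  have bound: "(\<integral>\<^sup>+x. maxfun p g x \<partial>M) \<le> ennreal (a + 2 * C / a)" if a: "0 < a" for a
  proof -
    have "(\<integral>\<^sup>+x. maxfun p g x \<partial>M) \<le> (\<integral>\<^sup>+x. ennreal a + (\<Sum>i. ennreal (a * 2 ^ i) * indicator {x \<in> space M. ennreal (a * 2 ^ i) < maxfun p g x} x) \<partial>M)"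
    proof (rule nn_integral_mono)
      fix x assume x: "x \<in> space M"
      have "(indicator {z. ennreal (a * 2 ^ i) < z} (maxfun p g x) :: ennreal)
          = indicator {x \<in> space M. ennreal (a * 2 ^ i) < maxfun p g x} x" for i
        using x by (auto simp: indicator_def)
      then show "maxfun p g x \<le> ennreal a + (\<Sum>i. ennreal (a * 2 ^ i) * indicator {x \<in> space M. ennreal (a * 2 ^ i) < maxfun p g x} x)"
        using ennreal_le_dyadic_levels[OF a, of "maxfun p g x"] by simp
    qed
    also have "\<dots> = ennreal a + (\<integral>\<^sup>+x. (\<Sum>i. ennreal (a * 2 ^ i) * indicator {x \<in> space M. ennreal (a * 2 ^ i) < maxfun p g x} x) \<partial>M)"
      by (subst nn_integral_add) (auto simp: emeasure_space_1)
    also have "(\<integral>\<^sup>+x. (\<Sum>i. ennreal (a * 2 ^ i) * indicator {x \<in> space M. ennreal (a * 2 ^ i) < maxfun p g x} x) \<partial>M)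
        = (\<Sum>i. \<integral>\<^sup>+x. ennreal (a * 2 ^ i) * indicator {x \<in> space M. ennreal (a * 2 ^ i) < maxfun p g x} x \<partial>M)"
      by (rule nn_integral_suminf) measurable
    also have "\<dots> = (\<Sum>i. ennreal (a * 2 ^ i) * emeasure M {x \<in> space M. ennreal (a * 2 ^ i) < maxfun p g x})"
      by (subst nn_integral_cmult_indicator) auto
    also have "\<dots> \<le> (\<Sum>i. ennreal (C / a * (1/2) ^ i))"
    proof (rule suminf_le)
      fix i
      have "ennreal (a * 2 ^ i) * emeasure M {x \<in> space M. ennreal (a * 2 ^ i) < maxfun p g x}
          \<le> ennreal (a * 2 ^ i) * ennreal (C / (a * 2 ^ i)\<^sup>2)"
        unfolding C_def using a by (intro mult_left_mono maxfun_weak_type g) auto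
      also have "\<dots> = ennreal (a * 2 ^ i * (C / (a * 2 ^ i)\<^sup>2))"
        using a C by (intro ennreal_mult[symmetric]) auto
      also have "a * 2 ^ i * (C / (a * 2 ^ i)\<^sup>2) = C / a * (1/2) ^ i"
        using a by (simp add: field_simps power2_eq_square)
      finally show "ennreal (a * 2 ^ i) * emeasure M {x \<in> space M. ennreal (a * 2 ^ i) < maxfun p g x}
          \<le> ennreal (C / a * (1/2) ^ i)" .
    qed auto
    also have "\<dots> = ennreal (\<Sum>i. C / a * (1/2) ^ i)"
      using a C by (intro suminf_ennreal2) (auto intro: summable_mult)
    also have "(\<Sum>i. C / a * (1/2) ^ i) = 2 * C / a"
      by (subst suminf_mult) (auto simp: suminf_geometric)
    also have "ennreal a + ennreal (2 * C / a) = ennreal (a + 2 * C / a)"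
      using a C by (intro ennreal_plus[symmetric]) auto
    finally show ?thesis by (simp add: add_left_mono)
  qed
  show ?thesis
  proof (cases "C = 0")
    case True
    have "(\<integral>\<^sup>+x. maxfun p g x \<partial>M) \<le> 0"
      by (rule ennreal_le_epsilon) (use bound True in auto)
    then show ?thesis by simp
  next
    case False
    then have "0 < sqrt C" using C by simp
    from bound[OF this] have "(\<integral>\<^sup>+x. maxfun p g x \<partial>M) \<le> ennreal (sqrt C + 2 * C / sqrt C)" .
    also have "sqrt C + 2 * C / sqrt C = 3 * sqrt C"
      using C False by (simp add: field_simps)
    finally show ?thesis by (simp add: C_def)
  qed
qed

lemma erg_sum_le_maxfun:
  assumes "0 < n"
  shows "ennreal (sqrt (erg_sum p g n x)) \<le> ennreal (sqrt (real n)) * maxfun p g x"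
proof -
  obtain m where m: "n = Suc m" using assms by (cases n) auto
  have "ennreal (sqrt (erg_sum p g n x)) = ennreal (sqrt (real n)) * ennreal (sqrt (erg_sum p g n x / real n))"
    using assms by (simp add: ennreal_mult'[symmetric] real_sqrt_mult[symmetric])
  also have "\<dots> \<le> ennreal (sqrt (real n)) * maxfun p g x"
    unfolding maxfun_def m by (intro mult_left_mono SUP_upper) auto
  finally show ?thesis .
qed

end

section \<open>Martingale blocks\<close>

lemma sum_lessThan_double:
  fixes f :: "nat \<Rightarrow> 'b :: comm_monoid_add"
  shows "(\<Sum>i<2 * m. f i) = (\<Sum>j<m. f (2 * j) + f (2 * j + 1))"
  by (induction m) (auto simp: add.assoc)

context stationary_system
begin

text \<open>Conditioning at time \<open>k\<close> pulls \<open>A\<close> out and annihilates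
  \<open>d\<close>; the tower property then descends to time 0.\<close>

lemma E_orthogonal:
  assumes "in_L2 M A" "in_L2 M d" "A \<in> borel_measurable (\<F> k)" "0 \<le> k"
    and d: "AE x in M. E k d x = 0"
  shows "AE x in M. E 0 (\<lambda>y. A y * d y) x = 0"
proof -
  have int: "integrable M (\<lambda>y. A y * d y)" by (rule in_L2_mult[OF assms(1,2)])
  have "AE x in M. E k (\<lambda>y. A y * d y) x = A x * E k d x"
    using in_L2_borel[OF assms(2)] by (intro E_mult assms(3) int) auto
  with d have "AE x in M. E k (\<lambda>y. A y * d y) x = 0" by eventually_elim simp
  then have "AE x in M. E 0 (E k (\<lambda>y. A y * d y)) x = E 0 (\<lambda>y. 0) x"
    by (rule E_cong) measurable
  moreover have "AE x in M. E 0 (\<lambda>y. 0) x = 0" by (rule E_F_meas) auto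
  moreover have "AE x in M. E 0 (E k (\<lambda>y. A y * d y)) x = E 0 (\<lambda>y. A y * d y) x"
    by (rule E_nested[OF assms(4) int])
  ultimately show ?thesis by eventually_elim simp
qed

lemma E_pythagoras:
  assumes "in_L2 M A" "in_L2 M d" "A \<in> borel_measurable (\<F> k)" "0 \<le> k"
    and d: "AE x in M. E k d x = 0"
  shows "AE x in M. E 0 (\<lambda>y. (A y + d y)\<^sup>2) x = E 0 (\<lambda>y. (A y)\<^sup>2) x + E 0 (\<lambda>y. (d y)\<^sup>2) x"
proof -
  note int = in_L2_sq[OF assms(1)] in_L2_sq[OF assms(2)] in_L2_mult[OF assms(1,2)]
  have eq: "(\<lambda>y. (A y + d y)\<^sup>2) = (\<lambda>y. ((A y)\<^sup>2 + (d y)\<^sup>2) + 2 * (A y * d y))"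
    by (simp add: power2_sum algebra_simps)
  have "AE x in M. E 0 (\<lambda>y. ((A y)\<^sup>2 + (d y)\<^sup>2) + 2 * (A y * d y)) x
     = E 0 (\<lambda>y. (A y)\<^sup>2 + (d y)\<^sup>2) x + E 0 (\<lambda>y. 2 * (A y * d y)) x"
    using int by (intro E_add) auto
  moreover have "AE x in M. E 0 (\<lambda>y. (A y)\<^sup>2 + (d y)\<^sup>2) x = E 0 (\<lambda>y. (A y)\<^sup>2) x + E 0 (\<lambda>y. (d y)\<^sup>2) x"
    using int by (intro E_add) auto
  moreover have "AE x in M. E 0 (\<lambda>y. 2 * (A y * d y)) x = 2 * E 0 (\<lambda>y. A y * d y) x"
    using int by (intro E_cmult) auto
  moreover note E_orthogonal[OF assms]
  ultimately show ?thesis unfolding eq by eventually_elim simp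
qed

lemma E_centered:
  assumes f: "in_L2 M f"
  shows "AE x in M. E 0 (\<lambda>y. f y - E 0 f y) x = 0"
proof -
  have i: "integrable M f" by (rule in_L2_integrable[OF f])
  have "AE x in M. E 0 (\<lambda>y. f y - E 0 f y) x = E 0 f x - E 0 (E 0 f) x"
    by (rule E_diff) (auto intro: i E_integrable)
  moreover have "AE x in M. E 0 (E 0 f) x = E 0 f x" by (rule E_nested) (auto intro: i)
  ultimately show ?thesis by eventually_elim simp
qed

text \<open>Pythagoras for \<open>f\<close> split into \<open>E 0 f\<close> and its centred part,
  both seen from time 0.\<close>

lemma E_variance_le:
  assumes f: "in_L2 M f"
  shows "AE x in M. E 0 (\<lambda>y. (f y - E 0 f y)\<^sup>2) x \<le> E 0 (\<lambda>y. (f y)\<^sup>2) x"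
proof -
  have "AE x in M. E 0 (\<lambda>y. (E 0 f y + (f y - E 0 f y))\<^sup>2) x
      = E 0 (\<lambda>y. (E 0 f y)\<^sup>2) x + E 0 (\<lambda>y. (f y - E 0 f y)\<^sup>2) x"
    by (rule E_pythagoras[where k = 0]) (auto intro: E_in_L2 in_L2_diff f E_centered)
  moreover have "AE x in M. 0 \<le> E 0 (\<lambda>y. (E 0 f y)\<^sup>2) x"
    by (rule E_nonneg) auto
  ultimately show ?thesis by eventually_elim simp
qed

text \<open>For \<open>\<F> 0\<close>-measurable \<open>W\<close> and \<open>0 \<le> q\<close> this
  is the martingale increment over the whole block from time 0 to time \<open>q\<close>: it is known
  at time \<open>q\<close> and has conditional mean 0 at time 0. Its shifts by multiples of a step
  \<open>s \<ge> q\<close> are martingale differences along a sparse filtration.\<close>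

definition mdiff :: "int \<Rightarrow> ('a \<Rightarrow> real) \<Rightarrow> 'a \<Rightarrow> real" where
  "mdiff q W y = W (T q y) - E 0 (\<lambda>z. W (T q z)) y"

lemma mdiff_in_L2:
  assumes "in_L2 M W"
  shows "in_L2 M (mdiff q W)"
  unfolding mdiff_def[abs_def] by (intro in_L2_diff in_L2_shift E_in_L2 assms)

lemma E_mdiff:
  assumes "in_L2 M W"
  shows "AE x in M. E 0 (mdiff q W) x = 0"
  unfolding mdiff_def[abs_def] by (rule E_centered) (intro in_L2_shift assms)

lemma mdiff_measurable:
  assumes "W \<in> borel_measurable (\<F> 0)" "0 \<le> q"
  shows "mdiff q W \<in> borel_measurable (\<F> q)"
proof -
  have [measurable]: "(\<lambda>y. W (T q y)) \<in> borel_measurable (\<F> q)"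
    by (rule shift_borel_measurable_Filt[OF assms(1)]) simp
  have [measurable]: "E 0 (\<lambda>z. W (T q z)) \<in> borel_measurable (\<F> q)"
    by (rule borel_measurable_Filt_mono[OF assms(2) E_borel])
  show ?thesis unfolding mdiff_def[abs_def] by measurable
qed

lemma E_mdiff_sum_power2:
  assumes W: "in_L2 M W" "W \<in> borel_measurable (\<F> 0)" and q: "0 \<le> q" "q \<le> s"
  shows "AE x in M. E 0 (\<lambda>y. (\<Sum>j<m. mdiff q W (T (s * int j) y))\<^sup>2) x
    = (\<Sum>j<m. E 0 (\<lambda>y. (mdiff q W (T (s * int j) y))\<^sup>2) x)"
proof (induction m)
  case 0
  have "AE x in M. E 0 (\<lambda>y. 0) x = 0" by (rule E_F_meas) auto
  then show ?case by simp
next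
  case (Suc m)
  let ?d = "\<lambda>y. mdiff q W (T (s * int m) y)"
  have meas: "(\<lambda>y. \<Sum>j<m. mdiff q W (T (s * int j) y)) \<in> borel_measurable (\<F> (s * int m))"
  proof (rule borel_measurable_sum)
    fix j assume j: "j \<in> {..<m}"
    \<comment> \<open>Block \<open>j\<close> is known at time \<open>s j + q\<close>, and
      \<open>q \<le> s\<close> places this no later than the start of the next block; hence every
      earlier block is known when block \<open>m\<close> begins.\<close>
    have "s * int j + q \<le> s * int j + s" using q by simp
    also have "\<dots> = s * int (Suc j)" by (simp add: algebra_simps)
    also have "\<dots> \<le> s * int m" using q j by (intro mult_left_mono) auto
    finally have le: "s * int j + q \<le> s * int m" .
    show "(\<lambda>y. mdiff q W (T (s * int j) y)) \<in> borel_measurable (\<F> (s * int m))"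
      by (rule shift_borel_measurable_Filt[OF mdiff_measurable[OF W(2) q(1)] le])
  qed
  have zero: "AE x in M. E (s * int m) ?d x = 0"
  proof -
    have "AE x in M. E (s * int m + 0) ?d x = E 0 (mdiff q W) (T (s * int m) x)"
      by (rule E_shift) (intro in_L2_integrable mdiff_in_L2 W)
    moreover have "AE x in M. E 0 (mdiff q W) (T (s * int m) x) = 0"
      by (rule AE_shift[OF E_mdiff[OF W(1)]])
    ultimately show ?thesis by eventually_elim simp
  qed
  have "AE x in M. E 0 (\<lambda>y. ((\<Sum>j<m. mdiff q W (T (s * int j) y)) + ?d y)\<^sup>2) x
      = E 0 (\<lambda>y. (\<Sum>j<m. mdiff q W (T (s * int j) y))\<^sup>2) x + E 0 (\<lambda>y. (?d y)\<^sup>2) x"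
    by (rule E_pythagoras[OF _ _ meas _ zero]) (use q in \<open>auto intro!: in_L2_sum in_L2_shift mdiff_in_L2 W\<close>)
  with Suc show ?case by eventually_elim simp
qed

text \<open>The variance bound at time 0 is composed with \<open>T r\<close> and conditioned once
  more on \<open>\<F> 0\<close>; by the semigroup law the intermediate conditioning disappears on
  both sides.\<close>

lemma E_mdiff_power2_le:
  assumes W: "in_L2 M W" and r: "0 \<le> r"
  shows "AE x in M. E 0 (\<lambda>y. (mdiff q W (T r y))\<^sup>2) x \<le> E 0 (\<lambda>y. (W (T (q + r) y))\<^sup>2) x"
proof -
  have int: "integrable M (\<lambda>y. (mdiff q W y)\<^sup>2)" "integrable M (\<lambda>y. (W (T q y))\<^sup>2)"
    using in_L2_sq[OF mdiff_in_L2[OF W]] in_L2_sq[OF in_L2_shift[OF W]] .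
  have "AE x in M. E 0 (\<lambda>y. (mdiff q W y)\<^sup>2) x \<le> E 0 (\<lambda>y. (W (T q y))\<^sup>2) x"
    unfolding mdiff_def by (rule E_variance_le[OF in_L2_shift[OF W]])
  then have "AE x in M. E 0 (\<lambda>z. E 0 (\<lambda>y. (mdiff q W y)\<^sup>2) (T r z)) x \<le> E 0 (\<lambda>z. E 0 (\<lambda>y. (W (T q y))\<^sup>2) (T r z)) x"
    by (rule E_mono[OF AE_shift]) (intro integrable_shift E_integrable int)+
  moreover note E_nested_shift[OF int(1) r] E_nested_shift[OF int(2) r]
  moreover have "AE x in M. E 0 (\<lambda>y. (W (T q (T r y)))\<^sup>2) x = E 0 (\<lambda>y. (W (T (q + r) y))\<^sup>2) x"
  proof (rule E_cong)
    have [measurable]: "W \<in> borel_measurable M" by (rule in_L2_borel[OF W])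
    show "AE x in M. (W (T q (T r x)))\<^sup>2 = (W (T (q + r) x))\<^sup>2"
      by (rule AE_I2) (simp add: T_add)
    show "(\<lambda>x. (W (T q (T r x)))\<^sup>2) \<in> borel_measurable M"
      "(\<lambda>x. (W (T (q + r) x))\<^sup>2) \<in> borel_measurable M" by measurable
  qed
  ultimately show ?thesis by eventually_elim simp
qed

lemma E_mdiff_sum_le:
  assumes W: "in_L2 M W" "W \<in> borel_measurable (\<F> 0)" and q: "0 \<le> q" "q \<le> s"
  shows "AE x in M. E 0 (\<lambda>y. (\<Sum>j<m. mdiff q W (T (s * int j) y))\<^sup>2) x
    \<le> (\<Sum>j<m. E 0 (\<lambda>y. (W (T (q + s * int j) y))\<^sup>2) x)"
proof -
  have "AE x in M. \<forall>j. E 0 (\<lambda>y. (mdiff q W (T (s * int j) y))\<^sup>2) x \<le> E 0 (\<lambda>y. (W (T (q + s * int j) y))\<^sup>2) x"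
    unfolding AE_all_countable using q by (intro allI E_mdiff_power2_le W) simp
  with E_mdiff_sum_power2[OF assms, of m] show ?thesis
    by eventually_elim (auto intro: sum_mono)
qed

text \<open>Integrating the conditional Pythagoras identity; stationarity makes all \<open>m\<close>
  terms equal.\<close>

lemma mdiff_sum_L2_norm:
  assumes W: "in_L2 M W" "W \<in> borel_measurable (\<F> 0)" and q: "0 \<le> q" "q \<le> s"
  shows "L2_norm M (\<lambda>y. \<Sum>j<m. mdiff q W (T (s * int j) y)) = sqrt (real m) * L2_norm M (mdiff q W)"
proof -
  note L2 = in_L2_shift[OF mdiff_in_L2[OF W(1), of q]]
  have L2s: "in_L2 M (\<lambda>y. \<Sum>j<m. mdiff q W (T (s * int j) y))"
    by (intro in_L2_sum L2)
  have "(L2_norm M (\<lambda>y. \<Sum>j<m. mdiff q W (T (s * int j) y)))\<^sup>2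
     = (\<integral>x. E 0 (\<lambda>y. (\<Sum>j<m. mdiff q W (T (s * int j) y))\<^sup>2) x \<partial>M)"
    unfolding L2_norm_power2 by (rule E_integral[symmetric]) (rule in_L2_sq[OF L2s])
  also have "\<dots> = (\<integral>x. (\<Sum>j<m. E 0 (\<lambda>y. (mdiff q W (T (s * int j) y))\<^sup>2) x) \<partial>M)"
    by (rule integral_cong_AE[OF _ _ E_mdiff_sum_power2[OF assms]]) measurable
  also have "\<dots> = (\<Sum>j<m. \<integral>x. E 0 (\<lambda>y. (mdiff q W (T (s * int j) y))\<^sup>2) x \<partial>M)"
    by (rule Bochner_Integration.integral_sum) (intro E_integrable in_L2_sq L2)
  also have "\<dots> = (\<Sum>j<m. (L2_norm M (\<lambda>y. mdiff q W (T (s * int j) y)))\<^sup>2)"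
    unfolding L2_norm_power2 by (intro sum.cong refl E_integral in_L2_sq L2)
  also have "\<dots> = real m * (L2_norm M (mdiff q W))\<^sup>2"
    by (simp add: L2_norm_shift[OF mdiff_in_L2[OF W(1)]])
  finally have "(L2_norm M (\<lambda>y. \<Sum>j<m. mdiff q W (T (s * int j) y)))\<^sup>2
     = (sqrt (real m) * L2_norm M (mdiff q W))\<^sup>2" by (simp add: power_mult_distrib)
  then show ?thesis by (rule power2_eq_imp_eq) auto
qed

lemma mdiff_L2_norm_le:
  assumes W: "in_L2 M W"
  shows "L2_norm M (mdiff q W) \<le> L2_norm M W"
proof -
  have "(\<integral>x. E 0 (\<lambda>y. (mdiff q W y)\<^sup>2) x \<partial>M) \<le> (\<integral>x. E 0 (\<lambda>y. (W (T q y))\<^sup>2) x \<partial>M)"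
    using E_variance_le[OF in_L2_shift[OF W, of q]]
    by (intro integral_mono_AE E_integrable in_L2_sq mdiff_in_L2 in_L2_shift W) (simp_all add: mdiff_def)
  then have "(\<integral>x. (mdiff q W x)\<^sup>2 \<partial>M) \<le> (\<integral>x. (W (T q x))\<^sup>2 \<partial>M)"
    by (simp add: E_integral in_L2_sq mdiff_in_L2 in_L2_shift W)
  then have "L2_norm M (mdiff q W) \<le> L2_norm M (\<lambda>x. W (T q x))" by (simp add: L2_norm_def)
  then show ?thesis by (simp add: L2_norm_shift[OF W])
qed

section \<open>The dyadic decomposition of partial sums\<close>

definition S :: "('a \<Rightarrow> real) \<Rightarrow> nat \<Rightarrow> 'a \<Rightarrow> real" where
  "S R n y = (\<Sum>i<n. R (T (int i + 1) y))"

lemma psum_eq_S: "psum M \<theta> R n = S R n"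
proof
  fix x
  have "(\<Sum>k=1..n. R (T (int k) x)) = (\<Sum>k<n. R (T (int (Suc k)) x))"
    by (simp add: sum.atLeast1_atMost_eq)
  then show "psum M \<theta> R n x = S R n x"
    by (simp add: psum_def stat_seq_def S_def add.commute)
qed

lemma S_in_L2:
  assumes "in_L2 M R"
  shows "in_L2 M (S R n)"
  unfolding S_def[abs_def] by (intro in_L2_sum in_L2_shift assms)

lemma S_add:
  assumes "y \<in> space M"
  shows "S R (m + n) y = S R m y + S R n (T (int m) y)"
proof -
  have "S R (m + n) y = S R m y + (\<Sum>i<n. R (T (int (m + i) + 1) y))"
    unfolding S_def by (induction n) (auto simp: add.assoc)
  also have "(\<Sum>i<n. R (T (int (m + i) + 1) y)) = S R n (T (int m) y)"
    unfolding S_def using T_add[OF assms, of _ "int m"]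
    by (intro sum.cong refl) (metis add.commute add.left_commute of_nat_add)
  finally show ?thesis .
qed

definition V :: "('a \<Rightarrow> real) \<Rightarrow> nat \<Rightarrow> 'a \<Rightarrow> real" where
  "V R n = E 0 (S R n)"

lemma V_in_L2: "in_L2 M R \<Longrightarrow> in_L2 M (V R n)"
  unfolding V_def by (intro E_in_L2 S_in_L2)

lemma V_measurable: "V R n \<in> borel_measurable (\<F> 0)"
  unfolding V_def by (rule E_borel)

text \<open>The second half of \<open>S R (m + n)\<close> is a shifted \<open>S R n\<close>, and by
  the tower property its conditional expectation at time 0 depends only on \<open>V R n\<close>.
  With \<open>m = n = 2 ^ k\<close> this climbs one dyadic level; in norm it is
  subadditivity.\<close>

lemma V_add:
  assumes R: "in_L2 M R"
  shows "AE x in M. V R (m + n) x = V R m x + E 0 (\<lambda>y. V R n (T (int m) y)) x"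
proof -
  have i: "integrable M (S R n)" for n by (intro in_L2_integrable S_in_L2 R)
  have [measurable]: "S R n \<in> borel_measurable M" for n using i by simp
  have "AE x in M. E 0 (S R (m + n)) x = E 0 (\<lambda>y. S R m y + S R n (T (int m) y)) x"
    by (rule E_cong) (auto simp: S_add)
  moreover have "AE x in M. E 0 (\<lambda>y. S R m y + S R n (T (int m) y)) x
      = E 0 (S R m) x + E 0 (\<lambda>y. S R n (T (int m) y)) x"
    by (rule E_add) (intro i integrable_shift)+
  moreover have "AE x in M. E 0 (\<lambda>y. E 0 (S R n) (T (int m) y)) x = E 0 (\<lambda>y. S R n (T (int m) y)) x"
    by (rule E_nested_shift[OF i]) simp
  ultimately show ?thesis by eventually_elim (simp add: V_def)
qed

text \<open>Each complete block of length \<open>2 ^ k\<close> is replaced by its prediction at the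
  time when it starts.\<close>

definition blocks :: "('a \<Rightarrow> real) \<Rightarrow> nat \<Rightarrow> nat \<Rightarrow> 'a \<Rightarrow> real" where
  "blocks R n k y = (\<Sum>j<n div 2 ^ k. V R (2 ^ k) (T (2 ^ k * int j) y))"

text \<open>Blocks are taken in pairs: the second block of a pair minus its prediction at the start
  of the pair. The increments have length \<open>2 ^ k\<close> and spacing \<open>2 ^ Suc k\<close>,
  so they do not overlap.\<close>

definition mart_part :: "('a \<Rightarrow> real) \<Rightarrow> nat \<Rightarrow> nat \<Rightarrow> 'a \<Rightarrow> real" where
  "mart_part R n k y = (\<Sum>j<n div 2 ^ Suc k. mdiff (2 ^ k) (V R (2 ^ k)) (T (2 ^ Suc k * int j) y))"

text \<open>The last block, which has no partner when the number of complete blocks is odd.\<close>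

definition leftover :: "('a \<Rightarrow> real) \<Rightarrow> nat \<Rightarrow> nat \<Rightarrow> 'a \<Rightarrow> real" where
  "leftover R n k y = (if odd (n div 2 ^ k) then V R (2 ^ k) (T (2 ^ k * int (n div 2 ^ k - 1)) y) else 0)"

text \<open>With \<open>p = 2 ^ k\<close> and \<open>W = V R p\<close>, each pair is
  \<open>W + W o T p = (W o T p - Q^p W) + (W + Q^p W)\<close>. The first bracket is an
  \<open>mdiff\<close>, and the second is \<open>V R (2 p)\<close> by \<open>V_add\<close>, a block
  of the next level.\<close>

lemma blocks_step:
  assumes R: "in_L2 M R"
  shows "AE y in M. blocks R n k y = mart_part R n k y + leftover R n k y + blocks R n (Suc k) y"
proof -
  define p where "p = (2::int) ^ k"
  define W where "W = V R (2 ^ k)"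
  define m where "m = n div 2 ^ Suc k"
  have "AE y in M. V R (2 ^ k + 2 ^ k) y = W y + E 0 (\<lambda>z. W (T (int (2 ^ k)) z)) y"
    unfolding W_def by (rule V_add[OF R])
  then have "AE y in M. \<forall>j. V R (2 ^ k + 2 ^ k) (T (2 * p * int j) y)
      = W (T (2 * p * int j) y) + E 0 (\<lambda>z. W (T (int (2 ^ k)) z)) (T (2 * p * int j) y)"
    unfolding AE_all_countable by (intro allI AE_shift)
  moreover have "AE y in M. y \<in> space M" by simp
  ultimately show ?thesis
  proof eventually_elim
    case (elim y)
    have "mart_part R n k y + blocks R n (Suc k) y
      = (\<Sum>j<m. mdiff p W (T (2 * p * int j) y) + V R (2 ^ k + 2 ^ k) (T (2 * p * int j) y))"
      unfolding mart_part_def blocks_def W_def p_def m_def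
      by (simp add: sum.distrib mult_2[symmetric])
    also have "\<dots> = (\<Sum>j<m. W (T (p * int (2 * j)) y) + W (T (p * int (2 * j + 1)) y))"
    proof (rule sum.cong)
      fix j
      have odd: "T (p * int (2 * j + 1)) y = T p (T (2 * p * int j) y)"
        using T_add[OF elim(2), of p "2 * p * int j"] by (simp add: algebra_simps)
      have even: "p * int (2 * j) = 2 * p * int j" by simp
      show "mdiff p W (T (2 * p * int j) y) + V R (2 ^ k + 2 ^ k) (T (2 * p * int j) y)
          = W (T (p * int (2 * j)) y) + W (T (p * int (2 * j + 1)) y)"
        unfolding odd even mdiff_def spec[OF elim(1)] by (simp add: p_def)
    qed simp
    also have "\<dots> = (\<Sum>i<2 * m. W (T (p * int i) y))"
      by (rule sum_lessThan_double[symmetric])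
    finally have eq: "mart_part R n k y + blocks R n (Suc k) y = (\<Sum>i<2 * m. W (T (p * int i) y))" .
    have m: "m = n div 2 ^ k div 2" unfolding m_def by (simp only: power_Suc2 div_mult2_eq)
    have "blocks R n k y = (\<Sum>i<2 * m. W (T (p * int i) y)) + leftover R n k y"
    proof (cases "odd (n div 2 ^ k)")
      case True
      then have "n div 2 ^ k = Suc (2 * m)" unfolding m by simp
      then show ?thesis by (simp add: blocks_def leftover_def W_def p_def)
    next
      case False
      then have "n div 2 ^ k = 2 * m" unfolding m by simp
      then show ?thesis by (simp add: blocks_def leftover_def W_def p_def)
    qed
    with eq show ?case by simp
  qed
qed

text \<open>Every summand is split into its prediction one step before, which is
  \<open>V R 1\<close> shifted, and the innovation. The factor \<open>1 *\<close> keeps the shape of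
  the \<open>mdiff\<close> lemmas with step \<open>s = 1\<close>.\<close>

lemma S_eq_blocks:
  assumes "y \<in> space M"
  shows "S R n y = (\<Sum>j<n. mdiff 1 R (T (1 * int j) y)) + blocks R n 0 y"
proof -
  have "V R (Suc 0) = E 0 (\<lambda>z. R (T 1 z))"
    by (simp add: V_def S_def[abs_def])
  then have "mdiff 1 R (T (1 * int j) y) + V R (2 ^ 0) (T (2 ^ 0 * int j) y) = R (T (int j + 1) y)" for j
    using T_add[OF assms, of 1 "int j"] by (simp add: mdiff_def add.commute)
  then show ?thesis by (simp add: S_def blocks_def sum.distrib[symmetric])
qed

text \<open>The dyadic decomposition behind the maximal inequality of Peligrad and Utev.\<close>

lemma S_decomposition:
  assumes R: "in_L2 M R"
  shows "AE y in M. S R n y = (\<Sum>j<n. mdiff 1 R (T (1 * int j) y))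
    + (\<Sum>k<n. mart_part R n k y + leftover R n k y)"
proof -
  have "AE y in M. \<forall>k. blocks R n k y = mart_part R n k y + leftover R n k y + blocks R n (Suc k) y"
    unfolding AE_all_countable using blocks_step[OF R] by blast
  moreover have "AE y in M. y \<in> space M" by simp
  ultimately show ?thesis
  proof eventually_elim
    case (elim y)
    have steps: "blocks R n 0 y = (\<Sum>k<K. mart_part R n k y + leftover R n k y) + blocks R n K y" for K
    proof (induction K)
      case (Suc K)
      then show ?case using spec[OF elim(1), of K] by simp
    qed simp
    \<comment> \<open>Since \<open>n < 2 ^ n\<close>, no complete block is left at level
      \<open>n\<close>, so the levels below \<open>n\<close> suffice.\<close>
    have end_0: "blocks R n n y = 0" by (simp add: blocks_def)
    show ?case by (simp only: S_eq_blocks[OF elim(2), of R n] steps[of n] end_0 add_0_right)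
  qed
qed

end

section \<open>The maximal inequality under the Maxwell-Woodroofe condition\<close>

lemma sqrt_divide_power2:
  "sqrt (real n / 2 ^ k) = sqrt (real n) * (1 / sqrt 2) ^ k"
  by (simp add: real_sqrt_divide real_sqrt_power power_one_over field_simps)

lemma divide_sqrt_tendsto_0: "(\<lambda>n. c / sqrt (real n)) \<longlonglongrightarrow> 0"
  by (intro tendsto_divide_0[OF tendsto_const] filterlim_at_top_imp_at_infinity
      filterlim_compose[OF sqrt_at_top filterlim_real_sequentially])

lemma real_div_power2_le: "real (n div 2 ^ k) \<le> real n / 2 ^ k"
  using of_nat_div_le_of_nat[of n "2 ^ k", where 'a = real] by simp

lemma suminf_tail_small:
  fixes f :: "nat \<Rightarrow> real"
  assumes "summable f" "0 < e"
  shows "\<exists>K. (\<Sum>k. f (k + K)) < e"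
proof -
  have "(\<lambda>K. suminf f - (\<Sum>k<K. f k)) \<longlonglongrightarrow> suminf f - suminf f"
    by (intro tendsto_intros summable_LIMSEQ assms)
  then have "eventually (\<lambda>K. suminf f - (\<Sum>k<K. f k) < e) sequentially"
    using assms(2) by (intro order_tendstoD(2)) auto
  then obtain K where "suminf f - (\<Sum>k<K. f k) < e" by (auto simp: eventually_sequentially)
  then show ?thesis using suminf_minus_initial_segment[OF assms(1), of K] by (intro exI[of _ K]) simp
qed

context stationary_system
begin

lemma erg_sum_le_maxfun':
  assumes "real n \<le> c"
  shows "ennreal (sqrt (erg_sum p g n x)) \<le> ennreal (sqrt c) * maxfun p g x"
proof (cases "n = 0")
  case False
  then have "ennreal (sqrt (erg_sum p g n x)) \<le> ennreal (sqrt (real n)) * maxfun p g x"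
    by (intro erg_sum_le_maxfun) simp
  also have "\<dots> \<le> ennreal (sqrt c) * maxfun p g x"
    using assms by (intro mult_right_mono ennreal_leI) auto
  finally show ?thesis .
qed (simp add: erg_sum_def)

lemma AE_erg_sum_terms_nonneg:
  assumes "g \<in> borel_measurable M" "\<And>x. 0 \<le> g x"
  shows "AE x in M. \<forall>i. 0 \<le> E 0 (\<lambda>y. g (T (int (p * i)) y)) x"
  unfolding AE_all_countable
  using assms by (intro allI E_nonneg) auto

lemma mart_part_in_L2: "in_L2 M R \<Longrightarrow> in_L2 M (mart_part R n k)"
  unfolding mart_part_def[abs_def] by (intro in_L2_sum in_L2_shift mdiff_in_L2 V_in_L2)

lemma leftover_in_L2: "in_L2 M R \<Longrightarrow> in_L2 M (leftover R n k)"
  unfolding leftover_def[abs_def]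
  by (cases "odd (n div 2 ^ k)") (auto intro: in_L2_shift V_in_L2 in_L2_zero)

text \<open>Orthogonality leaves squares of \<open>V R (2 ^ k)\<close> at the odd blocks. Adding the
  nonnegative terms of the even blocks completes an ergodic sum of length at most
  \<open>n / 2 ^ k\<close>, and the root of this length is the prefactor.\<close>

lemma mart_part_maxfun:
  assumes R: "in_L2 M R"
  shows "AE x in M. ennreal (sqrt (E 0 (\<lambda>y. (mart_part R n k y)\<^sup>2) x))
    \<le> ennreal (sqrt (real n) * (1 / sqrt 2) ^ k) * maxfun (2 ^ k) (\<lambda>y. (V R (2 ^ k) y)\<^sup>2) x"
proof -
  define g where "g y = (V R (2 ^ k) y)\<^sup>2" for y
  define p :: nat where "p = 2 ^ k"
  define m where "m = n div 2 ^ Suc k"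
  have "m = n div 2 ^ k div 2" unfolding m_def by (simp only: power_Suc2 div_mult2_eq)
  then have m: "2 * m \<le> n div 2 ^ k" by simp
  have [measurable]: "g \<in> borel_measurable M"
    unfolding g_def[abs_def] V_def by measurable
  have "AE x in M. \<forall>i. 0 \<le> E 0 (\<lambda>y. g (T (int (p * i)) y)) x"
    by (rule AE_erg_sum_terms_nonneg, measurable) (simp add: g_def)
  moreover have "AE x in M. E 0 (\<lambda>y. (mart_part R n k y)\<^sup>2) x
      \<le> (\<Sum>j<m. E 0 (\<lambda>y. (V R (2 ^ k) (T (2 ^ k + 2 ^ Suc k * int j) y))\<^sup>2) x)"
    unfolding mart_part_def m_def by (rule E_mdiff_sum_le) (auto intro: V_in_L2 R V_measurable)
  ultimately show ?thesis
  proof eventually_elim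
    case (elim x)
    let ?f = "\<lambda>i. E 0 (\<lambda>y. g (T (int (p * i)) y)) x"
    have "E 0 (\<lambda>y. (mart_part R n k y)\<^sup>2) x \<le> (\<Sum>j<m. ?f (2 * j + 1))"
      using elim(2) by (simp add: g_def p_def algebra_simps)
    also have "\<dots> \<le> (\<Sum>j<m. ?f (2 * j) + ?f (2 * j + 1))"
      using elim(1) by (intro sum_mono) (simp del: of_nat_mult)
    also have "\<dots> = (\<Sum>i<2 * m. ?f i)" by (rule sum_lessThan_double[symmetric])
    also have "\<dots> \<le> (\<Sum>i<n div 2 ^ k. ?f i)"
      using elim(1) m by (intro sum_mono2) auto
    finally have "E 0 (\<lambda>y. (mart_part R n k y)\<^sup>2) x \<le> erg_sum p g (n div 2 ^ k) x"
      by (simp add: erg_sum_def)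
    then have "ennreal (sqrt (E 0 (\<lambda>y. (mart_part R n k y)\<^sup>2) x)) \<le> ennreal (sqrt (erg_sum p g (n div 2 ^ k) x))"
      by (intro ennreal_leI) simp
    also have "\<dots> \<le> ennreal (sqrt (real n / 2 ^ k)) * maxfun p g x"
      by (rule erg_sum_le_maxfun'[OF real_div_power2_le])
    finally show ?case by (simp add: sqrt_divide_power2 p_def g_def[abs_def])
  qed
qed

text \<open>One term of an ergodic sum with nonnegative terms is at most the whole sum, so the
  leftover costs no more than the martingale of the same level.\<close>

lemma leftover_maxfun:
  assumes R: "in_L2 M R"
  shows "AE x in M. ennreal (sqrt (E 0 (\<lambda>y. (leftover R n k y)\<^sup>2) x))
    \<le> ennreal (sqrt (real n) * (1 / sqrt 2) ^ k) * maxfun (2 ^ k) (\<lambda>y. (V R (2 ^ k) y)\<^sup>2) x"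
proof (cases "odd (n div 2 ^ k)")
  case False
  have "AE x in M. E 0 (\<lambda>y. 0) x = 0" by (rule E_F_meas) auto
  then show ?thesis by eventually_elim (simp add: leftover_def False)
next
  case True
  define g where "g y = (V R (2 ^ k) y)\<^sup>2" for y
  define p :: nat where "p = 2 ^ k"
  have [measurable]: "g \<in> borel_measurable M"
    unfolding g_def[abs_def] V_def by measurable
  have "AE x in M. \<forall>i. 0 \<le> E 0 (\<lambda>y. g (T (int (p * i)) y)) x"
    by (rule AE_erg_sum_terms_nonneg, measurable) (simp add: g_def)
  then show ?thesis
  proof eventually_elim
    case (elim x)
    let ?f = "\<lambda>i. E 0 (\<lambda>y. g (T (int (p * i)) y)) x"
    have "n div 2 ^ k - 1 < n div 2 ^ k" using True by (cases "n div 2 ^ k = 0") auto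
    then have "?f (n div 2 ^ k - 1) \<le> (\<Sum>i<n div 2 ^ k. ?f i)"
      using elim by (intro member_le_sum) auto
    then have "E 0 (\<lambda>y. (leftover R n k y)\<^sup>2) x \<le> erg_sum p g (n div 2 ^ k) x"
      using True by (simp add: erg_sum_def leftover_def g_def p_def)
    then have "ennreal (sqrt (E 0 (\<lambda>y. (leftover R n k y)\<^sup>2) x)) \<le> ennreal (sqrt (erg_sum p g (n div 2 ^ k) x))"
      by (intro ennreal_leI) simp
    also have "\<dots> \<le> ennreal (sqrt (real n / 2 ^ k)) * maxfun p g x"
      by (rule erg_sum_le_maxfun'[OF real_div_power2_le])
    finally show ?case by (simp add: sqrt_divide_power2 p_def g_def[abs_def])
  qed
qed

lemma mdiff_sum_maxfun:
  assumes W: "in_L2 M W" "W \<in> borel_measurable (\<F> 0)" and n: "0 < n"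
  shows "AE x in M. ennreal (sqrt (E 0 (\<lambda>y. (\<Sum>j<n. mdiff 1 W (T (1 * int j) y))\<^sup>2) x))
    \<le> ennreal (sqrt (real n)) * (2 * maxfun 1 (\<lambda>y. (W y)\<^sup>2) x)"
proof -
  define g where "g y = (W y)\<^sup>2" for y
  have [measurable]: "W \<in> borel_measurable M" by (rule in_L2_borel[OF W(1)])
  have [measurable]: "g \<in> borel_measurable M" unfolding g_def[abs_def] by measurable
  have "AE x in M. \<forall>i. 0 \<le> E 0 (\<lambda>y. g (T (int (1 * i)) y)) x"
    by (rule AE_erg_sum_terms_nonneg, measurable) (simp add: g_def)
  moreover have "AE x in M. E 0 (\<lambda>y. (\<Sum>j<n. mdiff 1 W (T (1 * int j) y))\<^sup>2) x
      \<le> (\<Sum>j<n. E 0 (\<lambda>y. (W (T (1 + 1 * int j) y))\<^sup>2) x)"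
    by (rule E_mdiff_sum_le) (auto intro: W)
  ultimately show ?thesis
  proof eventually_elim
    case (elim x)
    let ?f = "\<lambda>i. E 0 (\<lambda>y. g (T (int (1 * i)) y)) x"
    have "E 0 (\<lambda>y. (\<Sum>j<n. mdiff 1 W (T (1 * int j) y))\<^sup>2) x \<le> (\<Sum>j<n. ?f (Suc j))"
      using elim(2) by (simp add: g_def)
    \<comment> \<open>The shifts start at 1, so the zeroth term is added to reach an ergodic sum of
      length \<open>n + 1\<close>. Below, \<open>n + 1 \<le> 4 n\<close> is used because 4 has the
      root 2.\<close>
    also have "\<dots> \<le> ?f 0 + (\<Sum>j<n. ?f (Suc j))" using elim(1) by (metis add_le_cancel_right add_0)
    also have "\<dots> = erg_sum 1 g (Suc n) x"
      unfolding erg_sum_def by (rule sum.lessThan_Suc_shift[symmetric])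
    finally have "ennreal (sqrt (E 0 (\<lambda>y. (\<Sum>j<n. mdiff 1 W (T (1 * int j) y))\<^sup>2) x)) \<le> ennreal (sqrt (erg_sum 1 g (Suc n) x))"
      by (intro ennreal_leI) simp
    also have "\<dots> \<le> ennreal (sqrt (4 * real n)) * maxfun 1 g x"
      using n by (intro erg_sum_le_maxfun') simp
    also have "ennreal (sqrt (4 * real n)) = ennreal (sqrt (real n)) * 2"
      by (simp add: real_sqrt_mult ennreal_mult mult.commute)
    finally show ?case by (simp add: g_def[abs_def] mult.assoc)
  qed
qed

section \<open>Quenched and annealed maximal inequalities for partial sums\<close>

definition S_maxfun :: "('a \<Rightarrow> real) \<Rightarrow> 'a \<Rightarrow> ennreal" where
  "S_maxfun R x = 2 * maxfun 1 (\<lambda>y. (R y)\<^sup>2) x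
     + (\<Sum>k. ennreal (2 * (1 / sqrt 2) ^ k) * maxfun (2 ^ k) (\<lambda>y. (V R (2 ^ k) y)\<^sup>2) x)"

definition MW_norm :: "('a \<Rightarrow> real) \<Rightarrow> real" where
  "MW_norm R = L2_norm M R + (\<Sum>k. (1 / sqrt 2) ^ k * L2_norm M (V R (2 ^ k)))"

text \<open>Kept apart from \<open>MW_norm\<close>, whose infinite sum carries no information when
  the series diverges.\<close>

definition MW_summable :: "('a \<Rightarrow> real) \<Rightarrow> bool" where
  "MW_summable R \<longleftrightarrow> summable (\<lambda>k. (1 / sqrt 2) ^ k * L2_norm M (V R (2 ^ k)))"

lemma MW_norm_nonneg: "MW_summable R \<Longrightarrow> 0 \<le> MW_norm R"
  unfolding MW_norm_def MW_summable_def by (intro add_nonneg_nonneg suminf_nonneg) auto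

lemma S_maxfun_borel [measurable]: "S_maxfun R \<in> borel_measurable M"
  unfolding S_maxfun_def[abs_def] by measurable

text \<open>Conditional Minkowski allows the dyadic levels to be estimated one by one, and each
  gives off a factor \<open>sqrt n\<close>. What remains is the same random variable for all
  \<open>n\<close>, which is what turns integral bounds into almost sure limits.\<close>

lemma quenched_maximal:
  assumes R: "in_L2 M R" "R \<in> borel_measurable (\<F> 0)" and n: "0 < n"
  shows "AE x in M. ennreal (sqrt (E 0 (\<lambda>y. (S R n y)\<^sup>2) x)) \<le> ennreal (sqrt (real n)) * S_maxfun R x"
proof -
  define Z where "Z y = (\<Sum>j<n. mdiff 1 R (T (1 * int j) y))" for y
  have Z: "in_L2 M Z" unfolding Z_def[abs_def] by (intro in_L2_sum in_L2_shift mdiff_in_L2 R)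
  have decomp: "AE y in M. S R n y = Z y + (\<Sum>k<n. mart_part R n k y + leftover R n k y)"
    using S_decomposition[OF R(1), of n] by (simp add: Z_def)
  note L2 = mart_part_in_L2[OF R(1)] leftover_in_L2[OF R(1)]
  have [measurable]: "Z \<in> borel_measurable M" "mart_part R n k \<in> borel_measurable M"
    "leftover R n k \<in> borel_measurable M" "S R n \<in> borel_measurable M" for k
    using Z L2 S_in_L2[OF R(1)] by (auto intro: in_L2_borel)
  have nonneg: "AE x in M. 0 \<le> E 0 (\<lambda>y. (f y)\<^sup>2) x" if "f \<in> borel_measurable M" for f
    using that by (intro E_nonneg) auto
  let ?mf = "\<lambda>k x. ennreal (sqrt (real n) * (1 / sqrt 2) ^ k) * maxfun (2 ^ k) (\<lambda>y. (V R (2 ^ k) y)\<^sup>2) x"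
  have "AE x in M. E 0 (\<lambda>y. (S R n y)\<^sup>2) x = E 0 (\<lambda>y. (Z y + (\<Sum>k<n. mart_part R n k y + leftover R n k y))\<^sup>2) x"
    by (rule E_cong) (use decomp in auto)
  moreover have "AE x in M. sqrt (E 0 (\<lambda>y. (Z y + (\<Sum>k<n. mart_part R n k y + leftover R n k y))\<^sup>2) x)
     \<le> sqrt (E 0 (\<lambda>y. (Z y)\<^sup>2) x) + sqrt (E 0 (\<lambda>y. (\<Sum>k<n. mart_part R n k y + leftover R n k y)\<^sup>2) x)"
    by (intro E_minkowski Z in_L2_sum in_L2_add L2)
  moreover have "AE x in M. sqrt (E 0 (\<lambda>y. (\<Sum>k<n. mart_part R n k y + leftover R n k y)\<^sup>2) x)
     \<le> (\<Sum>k<n. sqrt (E 0 (\<lambda>y. (mart_part R n k y + leftover R n k y)\<^sup>2) x))"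
    by (intro E_minkowski_sum in_L2_add L2) simp
  moreover have "AE x in M. \<forall>k. sqrt (E 0 (\<lambda>y. (mart_part R n k y + leftover R n k y)\<^sup>2) x)
     \<le> sqrt (E 0 (\<lambda>y. (mart_part R n k y)\<^sup>2) x) + sqrt (E 0 (\<lambda>y. (leftover R n k y)\<^sup>2) x)"
    unfolding AE_all_countable by (intro allI E_minkowski L2)
  moreover have "AE x in M. \<forall>k. 0 \<le> E 0 (\<lambda>y. (mart_part R n k y)\<^sup>2) x \<and> 0 \<le> E 0 (\<lambda>y. (leftover R n k y)\<^sup>2) x"
    unfolding AE_all_countable AE_conj_iff by (intro allI conjI nonneg) auto
  moreover have "AE x in M. \<forall>k. ennreal (sqrt (E 0 (\<lambda>y. (mart_part R n k y)\<^sup>2) x)) \<le> ?mf k x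
      \<and> ennreal (sqrt (E 0 (\<lambda>y. (leftover R n k y)\<^sup>2) x)) \<le> ?mf k x"
    unfolding AE_all_countable AE_conj_iff by (intro allI conjI mart_part_maxfun leftover_maxfun R)
  moreover have "AE x in M. 0 \<le> E 0 (\<lambda>y. (Z y)\<^sup>2) x" by (rule nonneg) simp
  moreover note mdiff_sum_maxfun[OF R n]
  ultimately show ?thesis
  proof eventually_elim
    case (elim x)
    let ?a = "\<lambda>k. sqrt (E 0 (\<lambda>y. (mart_part R n k y)\<^sup>2) x)"
    let ?b = "\<lambda>k. sqrt (E 0 (\<lambda>y. (leftover R n k y)\<^sup>2) x)"
    let ?c = "\<lambda>k. ennreal (2 * (1 / sqrt 2) ^ k) * maxfun (2 ^ k) (\<lambda>y. (V R (2 ^ k) y)\<^sup>2) x"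
    have "sqrt (E 0 (\<lambda>y. (S R n y)\<^sup>2) x) \<le> sqrt (E 0 (\<lambda>y. (Z y)\<^sup>2) x)
        + (\<Sum>k<n. sqrt (E 0 (\<lambda>y. (mart_part R n k y + leftover R n k y)\<^sup>2) x))"
      using elim(1,2,3) by simp
    also have "\<dots> \<le> sqrt (E 0 (\<lambda>y. (Z y)\<^sup>2) x) + (\<Sum>k<n. ?a k + ?b k)"
      using elim(4) by (intro add_left_mono sum_mono) simp
    finally have "ennreal (sqrt (E 0 (\<lambda>y. (S R n y)\<^sup>2) x))
        \<le> ennreal (sqrt (E 0 (\<lambda>y. (Z y)\<^sup>2) x) + (\<Sum>k<n. ?a k + ?b k))"
      by (rule ennreal_leI)
    also have "\<dots> = ennreal (sqrt (E 0 (\<lambda>y. (Z y)\<^sup>2) x)) + (\<Sum>k<n. ennreal (?a k) + ennreal (?b k))"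
      using elim(5,7) by (simp add: ennreal_plus[symmetric] sum_nonneg del: ennreal_plus)
    also have "\<dots> \<le> ennreal (sqrt (real n)) * (2 * maxfun 1 (\<lambda>y. (R y)\<^sup>2) x) + (\<Sum>k<n. ?mf k x + ?mf k x)"
      using elim(6,8) by (intro add_mono sum_mono) (auto simp: Z_def)
    also have "(\<Sum>k<n. ?mf k x + ?mf k x) = (\<Sum>k<n. ennreal (sqrt (real n)) * ?c k)"
      by (intro sum.cong refl) (simp add: ennreal_mult mult_2[symmetric] ac_simps)
    also have "\<dots> = ennreal (sqrt (real n)) * (\<Sum>k<n. ?c k)"
      by (rule sum_distrib_left[symmetric])
    also have "\<dots> \<le> ennreal (sqrt (real n)) * (\<Sum>k. ?c k)"
      by (intro mult_left_mono sum_le_suminf) auto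
    finally show ?case by (simp add: S_maxfun_def distrib_left add_left_mono)
  qed
qed

text \<open>The maximal function of a square integrates to at most 3 times the L2 norm of the root;
  the coefficients 2 in \<open>S_maxfun\<close> turn this into 6.\<close>

lemma S_maxfun_nn_integral:
  assumes R: "in_L2 M R" "R \<in> borel_measurable (\<F> 0)" and MW: "MW_summable R"
  shows "(\<integral>\<^sup>+x. S_maxfun R x \<partial>M) \<le> ennreal (6 * MW_norm R)"
proof -
  let ?a = "\<lambda>k. (1 / sqrt 2) ^ k * L2_norm M (V R (2 ^ k))"
  have mf: "(\<integral>\<^sup>+x. maxfun p (\<lambda>y. (W y)\<^sup>2) x \<partial>M) \<le> ennreal (3 * L2_norm M W)"
    if "in_L2 M W" "W \<in> borel_measurable (\<F> 0)" for p W
    using maxfun_nn_integral[of "\<lambda>y. (W y)\<^sup>2" p] that by (simp add: L2_norm_def in_L2_sq)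
  have "(\<integral>\<^sup>+x. S_maxfun R x \<partial>M) = 2 * (\<integral>\<^sup>+x. maxfun 1 (\<lambda>y. (R y)\<^sup>2) x \<partial>M)
     + (\<Sum>k. ennreal (2 * (1 / sqrt 2) ^ k) * (\<integral>\<^sup>+x. maxfun (2 ^ k) (\<lambda>y. (V R (2 ^ k) y)\<^sup>2) x \<partial>M))"
    unfolding S_maxfun_def by (simp add: nn_integral_add nn_integral_suminf nn_integral_cmult)
  also have "\<dots> \<le> 2 * ennreal (3 * L2_norm M R) + (\<Sum>k. ennreal (6 * ?a k))"
  proof (intro add_mono mult_left_mono suminf_le)
    fix k
    have "ennreal (2 * (1 / sqrt 2) ^ k) * (\<integral>\<^sup>+x. maxfun (2 ^ k) (\<lambda>y. (V R (2 ^ k) y)\<^sup>2) x \<partial>M)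
        \<le> ennreal (2 * (1 / sqrt 2) ^ k) * ennreal (3 * L2_norm M (V R (2 ^ k)))"
      by (intro mult_left_mono mf V_in_L2 V_measurable R) simp
    also have "\<dots> = ennreal (6 * ?a k)"
      by (subst ennreal_mult[symmetric]) (auto simp: ac_simps)
    finally show "ennreal (2 * (1 / sqrt 2) ^ k) * (\<integral>\<^sup>+x. maxfun (2 ^ k) (\<lambda>y. (V R (2 ^ k) y)\<^sup>2) x \<partial>M)
        \<le> ennreal (6 * ?a k)" .
  qed (use mf[OF R] in auto)
  also have "(\<Sum>k. ennreal (6 * ?a k)) = ennreal (\<Sum>k. 6 * ?a k)"
    using MW by (intro suminf_ennreal2 summable_mult) (auto simp: MW_summable_def)
  also have "(\<Sum>k. 6 * ?a k) = 6 * (\<Sum>k. ?a k)"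
    using MW by (intro suminf_mult) (simp add: MW_summable_def)
  also have "2 * ennreal (3 * L2_norm M R) = ennreal (6 * L2_norm M R)"
    using ennreal_mult[of 2 "3 * L2_norm M R"] by simp
  also have "ennreal (6 * L2_norm M R) + ennreal (6 * (\<Sum>k. ?a k)) = ennreal (6 * MW_norm R)"
    using MW unfolding MW_norm_def MW_summable_def
    by (subst ennreal_plus[symmetric]) (auto intro!: suminf_nonneg simp: distrib_left)
  finally show ?thesis .
qed

text \<open>Not an integrated form of \<open>quenched_maximal\<close>, since \<open>S_maxfun\<close>
  controls only the first moment of the conditional norm. Instead, orthogonality and stationarity
  give the L2 norm of each martingale exactly, level by level.\<close>

lemma S_L2_norm_le:
  assumes R: "in_L2 M R" "R \<in> borel_measurable (\<F> 0)" and MW: "MW_summable R"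
  shows "L2_norm M (S R n) \<le> 2 * sqrt (real n) * MW_norm R"
proof -
  define Z where "Z y = (\<Sum>j<n. mdiff 1 R (T (1 * int j) y))" for y
  have Z: "in_L2 M Z" unfolding Z_def[abs_def] by (intro in_L2_sum in_L2_shift mdiff_in_L2 R)
  have decomp: "AE y in M. S R n y = Z y + (\<Sum>k<n. mart_part R n k y + leftover R n k y)"
    using S_decomposition[OF R(1), of n] by (simp add: Z_def)
  note L2 = mart_part_in_L2[OF R(1)] leftover_in_L2[OF R(1)]
  let ?r = "\<lambda>k. sqrt (real n) * (1 / sqrt 2) ^ k"
  have Z_le: "L2_norm M Z \<le> sqrt (real n) * L2_norm M R"
    unfolding Z_def[abs_def]
    by (subst mdiff_sum_L2_norm[OF R]) (auto intro!: mult_left_mono mdiff_L2_norm_le R)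
  have sq_div: "sqrt (real (n div 2 ^ k)) \<le> ?r k" for k
    unfolding sqrt_divide_power2[symmetric] by (rule real_sqrt_le_mono[OF real_div_power2_le])
  have m_le: "L2_norm M (mart_part R n k) \<le> ?r k * L2_norm M (V R (2 ^ k))" for k
  proof -
    have "n div 2 ^ Suc k \<le> n div 2 ^ k" by (intro div_le_mono2) auto
    then have "sqrt (real (n div 2 ^ Suc k)) \<le> sqrt (real (n div 2 ^ k))"
      by (intro real_sqrt_le_mono of_nat_mono)
    also have "\<dots> \<le> ?r k" by (rule sq_div)
    finally have "sqrt (real (n div 2 ^ Suc k)) * L2_norm M (mdiff (2 ^ k) (V R (2 ^ k)))
        \<le> ?r k * L2_norm M (V R (2 ^ k))"
      by (intro mult_mono mdiff_L2_norm_le V_in_L2 R) auto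
    moreover have "L2_norm M (mart_part R n k)
        = sqrt (real (n div 2 ^ Suc k)) * L2_norm M (mdiff (2 ^ k) (V R (2 ^ k)))"
      unfolding mart_part_def[abs_def]
      by (rule mdiff_sum_L2_norm) (auto intro: V_in_L2 V_measurable R)
    ultimately show ?thesis by simp
  qed
  have l_le: "L2_norm M (leftover R n k) \<le> ?r k * L2_norm M (V R (2 ^ k))" for k
  proof (cases "odd (n div 2 ^ k)")
    case True
    \<comment> \<open>An odd number of blocks is at least one, so the prefactor \<open>?r k\<close>
      is at least 1 and absorbs the single leftover block.\<close>
    then have "1 \<le> n div 2 ^ k" by (cases "n div 2 ^ k = 0") auto
    then have "1 \<le> sqrt (real (n div 2 ^ k))" by simp
    then have "1 \<le> ?r k" using sq_div[of k] by linarith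
    then have "1 * L2_norm M (V R (2 ^ k)) \<le> ?r k * L2_norm M (V R (2 ^ k))"
      by (rule mult_right_mono) simp
    then show ?thesis using True
      by (simp add: leftover_def[abs_def] L2_norm_shift[OF V_in_L2[OF R(1)]])
  qed (simp add: leftover_def[abs_def])
  have "L2_norm M (S R n) = L2_norm M (\<lambda>y. Z y + (\<Sum>k<n. mart_part R n k y + leftover R n k y))"
    by (rule L2_norm_cong_AE)
      (intro decomp in_L2_borel S_in_L2 R in_L2_add Z in_L2_sum L2)+
  also have "\<dots> \<le> L2_norm M Z + L2_norm M (\<lambda>y. \<Sum>k<n. mart_part R n k y + leftover R n k y)"
    by (intro L2_norm_add Z in_L2_sum in_L2_add L2)
  also have "L2_norm M (\<lambda>y. \<Sum>k<n. mart_part R n k y + leftover R n k y)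
      \<le> (\<Sum>k<n. L2_norm M (\<lambda>y. mart_part R n k y + leftover R n k y))"
    by (intro L2_norm_sum in_L2_add L2)
  also have "\<dots> \<le> (\<Sum>k<n. 2 * (?r k * L2_norm M (V R (2 ^ k))))"
  proof (rule sum_mono)
    fix k
    have "L2_norm M (\<lambda>y. mart_part R n k y + leftover R n k y)
        \<le> L2_norm M (mart_part R n k) + L2_norm M (leftover R n k)"
      by (intro L2_norm_add L2)
    then show "L2_norm M (\<lambda>y. mart_part R n k y + leftover R n k y) \<le> 2 * (?r k * L2_norm M (V R (2 ^ k)))"
      using m_le[of k] l_le[of k] by linarith
  qed
  also have "\<dots> = 2 * sqrt (real n) * (\<Sum>k<n. (1 / sqrt 2) ^ k * L2_norm M (V R (2 ^ k)))"
    by (simp add: sum_distrib_left ac_simps)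
  also have "\<dots> \<le> 2 * sqrt (real n) * (\<Sum>k. (1 / sqrt 2) ^ k * L2_norm M (V R (2 ^ k)))"
    using MW by (intro mult_left_mono sum_le_suminf) (auto simp: MW_summable_def)
  also have "L2_norm M Z \<le> 2 * sqrt (real n) * L2_norm M R"
    by (rule order_trans[OF Z_le]) (intro mult_right_mono, auto)
  finally show ?thesis by (simp add: MW_norm_def distrib_left)
qed

lemma S_L2_norm_le_linear:
  assumes R: "in_L2 M R"
  shows "L2_norm M (S R n) \<le> real n * L2_norm M R"
proof -
  have "L2_norm M (S R n) \<le> (\<Sum>i<n. L2_norm M (\<lambda>y. R (T (int i + 1) y)))"
    unfolding S_def[abs_def] by (intro L2_norm_sum in_L2_shift R)
  also have "\<dots> = real n * L2_norm M R" by (simp add: L2_norm_shift[OF R])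
  finally show ?thesis .
qed

text \<open>Dominated convergence for the series in \<open>MW_norm\<close>: the tail is bounded by
  that of \<open>X\<close>, uniformly in \<open>R\<close>, and the finitely many remaining levels
  are bounded linearly by the L2 norm of \<open>R\<close>.\<close>

lemma MW_norm_small:
  assumes X: "MW_summable X" and e: "0 < e"
  shows "\<exists>d>0. \<forall>R. in_L2 M R \<and> L2_norm M R \<le> d \<and> (\<forall>k. L2_norm M (V R (2 ^ k)) \<le> L2_norm M (V X (2 ^ k)))
    \<longrightarrow> MW_summable R \<and> MW_norm R \<le> e"
proof -
  let ?r = "\<lambda>k::nat. (1 / sqrt 2 :: real) ^ k"
  let ?x = "\<lambda>k. ?r k * L2_norm M (V X (2 ^ k))"
  have sx: "summable ?x" using X by (simp add: MW_summable_def)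
  obtain K where K: "(\<Sum>k. ?x (k + K)) < e / 2" using suminf_tail_small[OF sx, of "e / 2"] e by auto
  \<comment> \<open>Collects the factors of the L2 norm of \<open>R\<close>: 1 for the norm itself
    and, for each level of the head, the crude bound \<open>2 ^ k\<close> on the sum times its
    weight.\<close>
  define C where "C = 1 + (\<Sum>k<K. ?r k * 2 ^ k)"
  have C: "1 \<le> C" by (auto simp: C_def intro!: sum_nonneg)
  show ?thesis
  proof (intro exI[of _ "e / (2 * C)"] conjI allI impI; (elim conjE)?)
    show "0 < e / (2 * C)" using e C by simp
    fix R assume R: "in_L2 M R" and small: "L2_norm M R \<le> e / (2 * C)"
      and le: "\<forall>k. L2_norm M (V R (2 ^ k)) \<le> L2_norm M (V X (2 ^ k))"
    let ?y = "\<lambda>k. ?r k * L2_norm M (V R (2 ^ k))"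
    have yx: "?y k \<le> ?x k" for k using le by (intro mult_left_mono) auto
    have sy: "summable ?y"
      by (rule summable_comparison_test'[OF sx]) (use yx in auto)
    then show "MW_summable R" by (simp add: MW_summable_def)
    have "(\<Sum>k<K. ?y k) \<le> (\<Sum>k<K. ?r k * 2 ^ k * L2_norm M R)"
    proof (rule sum_mono)
      fix k
      have "L2_norm M (V R (2 ^ k)) \<le> L2_norm M (S R (2 ^ k))"
        unfolding V_def by (intro E_L2_norm S_in_L2 R)
      also have "\<dots> \<le> 2 ^ k * L2_norm M R" using S_L2_norm_le_linear[OF R, of "2 ^ k"] by simp
      finally have "?r k * L2_norm M (V R (2 ^ k)) \<le> ?r k * (2 ^ k * L2_norm M R)"
        by (rule mult_left_mono) simp
      then show "?y k \<le> ?r k * 2 ^ k * L2_norm M R" by (simp only: mult.assoc)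
    qed
    then have "L2_norm M R + (\<Sum>k<K. ?y k) \<le> C * L2_norm M R"
      by (simp add: C_def distrib_right sum_distrib_right)
    also have "\<dots> \<le> C * (e / (2 * C))" using small C by (intro mult_left_mono) auto
    also have "\<dots> = e / 2" using C by simp
    finally have head: "L2_norm M R + (\<Sum>k<K. ?y k) \<le> e / 2" .
    have "(\<Sum>k. ?y (k + K)) \<le> (\<Sum>k. ?x (k + K))"
      by (intro suminf_le yx) (auto intro!: summable_ignore_initial_segment sx sy)
    moreover have "(\<Sum>k. ?y k) = (\<Sum>k. ?y (k + K)) + (\<Sum>k<K. ?y k)"
      by (rule suminf_split_initial_segment[OF sy])
    ultimately show "MW_norm R \<le> e" using head K by (simp add: MW_norm_def)
  qed
qed

end

section \<open>Approximation by coboundaries\<close>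

lemma ennreal_limsup_zero_imp_tendsto:
  fixes f :: "nat \<Rightarrow> ennreal"
  assumes "limsup f = 0"
  shows "f \<longlonglongrightarrow> 0"
proof -
  have "liminf f = 0" using Liminf_le_Limsup[of sequentially f] assms by simp
  then show ?thesis using tendsto_Limsup[of sequentially f] assms by simp
qed

context stationary_system
begin

text \<open>The limsup is at most \<open>U\<close>, hence has integral at most \<open>e\<close> for
  every \<open>e\<close>. The term with \<open>c x\<close> vanishes at each fixed \<open>x\<close>,
  so \<open>c\<close> is subject to no integrability condition.\<close>

lemma AE_tendsto_zero_of_small_bounds:
  fixes f :: "nat \<Rightarrow> 'a \<Rightarrow> ennreal"
  assumes [measurable]: "\<And>n. f n \<in> borel_measurable M"
    and bd: "\<And>e. 0 < e \<Longrightarrow> \<exists>U c. U \<in> borel_measurable M \<and> (\<integral>\<^sup>+x. U x \<partial>M) \<le> ennreal e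
      \<and> (\<forall>n>0. AE x in M. f n x \<le> ennreal (c x / sqrt (real n)) + U x)"
  shows "AE x in M. (\<lambda>n. f n x) \<longlonglongrightarrow> 0"
proof -
  define L where "L x = limsup (\<lambda>n. f n x)" for x
  have [measurable]: "L \<in> borel_measurable M" unfolding L_def[abs_def] by measurable
  have "(\<integral>\<^sup>+x. L x \<partial>M) \<le> 0"
  proof (rule ennreal_le_epsilon)
    fix e :: real assume "0 < e"
    from bd[OF this] obtain U c where U: "(\<integral>\<^sup>+x. U x \<partial>M) \<le> ennreal e"
      and le: "\<forall>n>0. AE x in M. f n x \<le> ennreal (c x / sqrt (real n)) + U x" by blast
    have "AE x in M. \<forall>n. 0 < n \<longrightarrow> f n x \<le> ennreal (c x / sqrt (real n)) + U x"
      unfolding AE_all_countable using le by (auto simp: AE_impI)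
    then have "AE x in M. L x \<le> U x"
    proof eventually_elim
      case (elim x)
      have "(\<lambda>n. ennreal (c x / sqrt (real n)) + U x) \<longlonglongrightarrow> ennreal 0 + U x"
        by (intro tendsto_add tendsto_ennrealI tendsto_const divide_sqrt_tendsto_0)
      then have lim: "limsup (\<lambda>n. ennreal (c x / sqrt (real n)) + U x) = U x"
        by (auto dest: lim_imp_Limsup[rotated])
      have "L x \<le> limsup (\<lambda>n. ennreal (c x / sqrt (real n)) + U x)"
        unfolding L_def using elim by (intro Limsup_mono) (auto simp: eventually_sequentially intro!: exI[of _ 1])
      then show ?case using lim by simp
    qed
    then have "(\<integral>\<^sup>+x. L x \<partial>M) \<le> (\<integral>\<^sup>+x. U x \<partial>M)" by (rule nn_integral_mono_AE)
    with U show "(\<integral>\<^sup>+x. L x \<partial>M) \<le> 0 + ennreal e" by simp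
  qed
  then have "AE x in M. L x = 0" by (simp add: nn_integral_0_iff_AE)
  then show ?thesis
    by eventually_elim (simp add: L_def ennreal_limsup_zero_imp_tendsto)
qed

text \<open>Needed for the boundary term of a coboundary at time \<open>n\<close>, where
  \<open>g\<close> is merely integrable. Truncating at height \<open>m\<close>, the bounded part
  contributes the constant \<open>sqrt m\<close>; the excess has a small integral, and its term at
  time \<open>n\<close> is at most an ergodic sum, hence under control of its maximal
  function.\<close>

lemma E_shift_truncation_bound:
  assumes g: "integrable M g" "g \<in> borel_measurable (\<F> 0)" "\<And>x. 0 \<le> g x" and e: "0 < e"
  shows "\<exists>U c. 0 \<le> c \<and> U \<in> borel_measurable M \<and> (\<integral>\<^sup>+x. U x \<partial>M) \<le> ennreal e
    \<and> (\<forall>n>0. AE x in M. ennreal (sqrt (E 0 (\<lambda>y. g (T (int n) y)) x)) \<le> ennreal c + ennreal (sqrt (real n)) * U x)"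
proof -
  define h where "h m x = max (g x - real m) 0" for m x
  have [measurable]: "g \<in> borel_measurable M" using g(1) by simp
  have h_meas: "h m \<in> borel_measurable (\<F> 0)" for m
    unfolding h_def[abs_def] using g(2) by measurable
  have h_int: "integrable M (h m)" for m
    by (rule Bochner_Integration.integrable_bound[OF g(1)]) (use g(3) in \<open>auto simp: h_def[abs_def]\<close>)
  have h_nonneg: "0 \<le> h m x" for m x by (simp add: h_def)
  have "(\<lambda>m. \<integral>x. h m x \<partial>M) \<longlonglongrightarrow> (\<integral>x. 0 \<partial>M)"
  proof (rule integral_dominated_convergence[where w = g])
    show "AE x in M. (\<lambda>m. h m x) \<longlonglongrightarrow> 0"
    proof (rule AE_I2, rule tendsto_eventually)
      fix x
      obtain K :: nat where "g x \<le> real K" using real_arch_simple by blast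
      then show "\<forall>\<^sub>F m in sequentially. h m x = 0"
        by (auto simp: eventually_sequentially h_def intro!: exI[of _ K])
    qed
    show "AE x in M. norm (h m x) \<le> g x" for m using g(3) by (intro AE_I2) (simp add: h_def)
  qed (use g h_int in auto)
  \<comment> \<open>The factor 3 of \<open>maxfun_nn_integral\<close> and the factor 2 in
    \<open>U\<close> turn \<open>e / 6\<close> into \<open>e\<close>.\<close>
  moreover have "0 < (e / 6)\<^sup>2" using e by simp
  ultimately have "\<forall>\<^sub>F m in sequentially. (\<integral>x. h m x \<partial>M) < (e / 6)\<^sup>2"
    by (intro order_tendstoD(2)) auto
  then obtain m where m: "(\<integral>x. h m x \<partial>M) < (e / 6)\<^sup>2" by (auto simp: eventually_sequentially)
  define U where "U x = 2 * maxfun 1 (h m) x" for x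
  have [measurable]: "U \<in> borel_measurable M" unfolding U_def[abs_def] by measurable
  have U_int: "(\<integral>\<^sup>+x. U x \<partial>M) \<le> ennreal e"
  proof -
    have "sqrt (\<integral>x. h m x \<partial>M) \<le> e / 6"
      using m e by (intro real_le_lsqrt) auto
    then have "(\<integral>\<^sup>+x. maxfun 1 (h m) x \<partial>M) \<le> ennreal (e / 2)"
      by (intro order_trans[OF maxfun_nn_integral[OF h_int h_meas h_nonneg]] ennreal_leI) simp
    then have "2 * (\<integral>\<^sup>+x. maxfun 1 (h m) x \<partial>M) \<le> 2 * ennreal (e / 2)" by (rule mult_left_mono) simp
    also have "2 * ennreal (e / 2) = ennreal e"
      using e ennreal_mult[of 2 "e / 2"] by simp
    finally show ?thesis by (simp add: U_def nn_integral_cmult)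
  qed
  have "AE x in M. ennreal (sqrt (E 0 (\<lambda>y. g (T (int n) y)) x)) \<le> ennreal (sqrt (real m)) + ennreal (sqrt (real n)) * U x"
    if n: "0 < n" for n
  proof -
    have "AE x in M. E 0 (\<lambda>y. g (T (int n) y)) x \<le> E 0 (\<lambda>y. real m + h m (T (int n) y)) x"
    proof (rule E_mono)
      show "AE y in M. g (T (int n) y) \<le> real m + h m (T (int n) y)"
        by (rule AE_I2) (simp add: h_def)
      show "integrable M (\<lambda>y. g (T (int n) y))" by (rule integrable_shift[OF g(1)])
      show "integrable M (\<lambda>y. real m + h m (T (int n) y))"
        by (rule Bochner_Integration.integrable_add[OF _ integrable_shift[OF h_int]]) simp
    qed
    moreover have "AE x in M. E 0 (\<lambda>y. real m + h m (T (int n) y)) x = E 0 (\<lambda>y. real m) x + E 0 (\<lambda>y. h m (T (int n) y)) x"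
      by (rule E_add[OF _ integrable_shift[OF h_int]]) simp
    moreover have "AE x in M. E 0 (\<lambda>y. real m) x = real m" by (rule E_F_meas) auto
    moreover have "AE x in M. \<forall>i. 0 \<le> E 0 (\<lambda>y. h m (T (int (1 * i)) y)) x"
      by (rule AE_erg_sum_terms_nonneg) (use h_int h_nonneg in auto)
    ultimately show ?thesis
    proof eventually_elim
      case (elim x)
      let ?b = "E 0 (\<lambda>y. h m (T (int n) y)) x"
      have b: "0 \<le> ?b" using elim(4) by simp
      have "E 0 (\<lambda>y. h m (T (int (1 * n)) y)) x \<le> erg_sum 1 (h m) (Suc n) x"
        unfolding erg_sum_def using elim(4) by (intro member_le_sum) auto
      then have b_le: "?b \<le> erg_sum 1 (h m) (Suc n) x" by simp
      have "sqrt (E 0 (\<lambda>y. g (T (int n) y)) x) \<le> sqrt (real m + ?b)" using elim by simp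
      also have "\<dots> \<le> sqrt (real m) + sqrt ?b" using b by (intro sqrt_add_le_add_sqrt) auto
      also have "\<dots> \<le> sqrt (real m) + sqrt (erg_sum 1 (h m) (Suc n) x)" using b_le by simp
      finally have "ennreal (sqrt (E 0 (\<lambda>y. g (T (int n) y)) x)) \<le> ennreal (sqrt (real m) + sqrt (erg_sum 1 (h m) (Suc n) x))"
        by (rule ennreal_leI)
      also have "\<dots> = ennreal (sqrt (real m)) + ennreal (sqrt (erg_sum 1 (h m) (Suc n) x))"
        using b b_le by (intro ennreal_plus) auto
      also have "ennreal (sqrt (erg_sum 1 (h m) (Suc n) x)) \<le> ennreal (sqrt (4 * real n)) * maxfun 1 (h m) x"
        using n by (intro erg_sum_le_maxfun') simp
      also have "ennreal (sqrt (4 * real n)) = ennreal (sqrt (real n)) * 2"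
        by (simp add: real_sqrt_mult ennreal_mult mult.commute)
      finally show ?case by (simp add: U_def mult.assoc add_left_mono)
    qed
  qed
  then show ?thesis using U_int by (intro exI[of _ U] exI[of _ "sqrt (real m)"]) auto
qed

section \<open>Coboundaries of the Markov operator and their martingales\<close>

definition cobd :: "('a \<Rightarrow> real) \<Rightarrow> 'a \<Rightarrow> real" where
  "cobd H x = H x - E 0 (\<lambda>y. H (T 1 y)) x"

text \<open>On integrable \<open>\<F> 0\<close>-measurable functions this agrees almost surely with
  \<open>Proj M \<theta> F0 0\<close>, because \<open>E 0 H = H\<close> there.\<close>

definition P0 :: "('a \<Rightarrow> real) \<Rightarrow> 'a \<Rightarrow> real" where
  "P0 H x = H x - E (-1) H x"

lemma P0_in_L2: "in_L2 M H \<Longrightarrow> in_L2 M (P0 H)"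
  unfolding P0_def[abs_def] by (intro in_L2_diff E_in_L2)

lemma cobd_in_L2: "in_L2 M H \<Longrightarrow> in_L2 M (cobd H)"
  unfolding cobd_def[abs_def] by (intro in_L2_diff E_in_L2 in_L2_shift)

lemma P0_measurable:
  assumes [measurable]: "H \<in> borel_measurable (\<F> 0)"
  shows "P0 H \<in> borel_measurable (\<F> 0)"
proof -
  have [measurable]: "E (-1) H \<in> borel_measurable (\<F> 0)"
    by (rule borel_measurable_Filt_mono[OF _ E_borel]) simp
  show ?thesis unfolding P0_def[abs_def] by measurable
qed

lemma cobd_measurable:
  assumes [measurable]: "H \<in> borel_measurable (\<F> 0)"
  shows "cobd H \<in> borel_measurable (\<F> 0)"
  unfolding cobd_def[abs_def] by measurable

text \<open>One shift moves the conditioning from time -1 to time 0. Thus \<open>mdiff 1 H\<close>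
  and \<open>P0 H\<close> are the same increment at consecutive times.\<close>

lemma P0_shift:
  assumes H: "in_L2 M H"
  shows "AE x in M. P0 H (T 1 x) = mdiff 1 H x"
  using E_shift[OF in_L2_integrable[OF H], of 1 "-1"]
  by eventually_elim (simp add: P0_def mdiff_def)

lemma P0_L2_norm:
  assumes H: "in_L2 M H"
  shows "L2_norm M (P0 H) = L2_norm M (mdiff 1 H)"
proof -
  have "L2_norm M (mdiff 1 H) = L2_norm M (\<lambda>x. P0 H (T 1 x))"
    by (rule L2_norm_cong_AE)
      (use P0_shift[OF H] in \<open>auto intro!: in_L2_borel mdiff_in_L2 in_L2_shift P0_in_L2 H\<close>)
  then show ?thesis by (simp add: L2_norm_shift[OF P0_in_L2[OF H]])
qed

lemma P0_L2_norm_le: "in_L2 M H \<Longrightarrow> L2_norm M (P0 H) \<le> L2_norm M H"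
  by (simp add: P0_L2_norm mdiff_L2_norm_le)

lemma E_minus1_P0:
  assumes H: "in_L2 M H"
  shows "AE x in M. E (-1) (P0 H) x = 0"
proof -
  have "AE x in M. E (-1) (P0 H) x = E (-1) H x - E (-1) (E (-1) H) x"
    unfolding P0_def[abs_def] by (intro E_diff E_integrable in_L2_integrable H)
  moreover have "AE x in M. E (-1) (E (-1) H) x = E (-1) H x"
    by (intro E_nested in_L2_integrable H) simp
  ultimately show ?thesis by eventually_elim simp
qed

lemma P0_diff:
  assumes "in_L2 M G" "in_L2 M H"
  shows "AE x in M. P0 (\<lambda>y. G y - H y) x = P0 G x - P0 H x"
  using E_diff[OF in_L2_integrable[OF assms(1)] in_L2_integrable[OF assms(2)], of "-1"]
  by eventually_elim (simp add: P0_def)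

lemma mdiff_diff:
  assumes "in_L2 M G" "in_L2 M H"
  shows "AE x in M. mdiff q (\<lambda>y. G y - H y) x = mdiff q G x - mdiff q H x"
  using E_diff[OF in_L2_integrable[OF in_L2_shift[OF assms(1), of q]]
      in_L2_integrable[OF in_L2_shift[OF assms(2), of q]], of 0]
  by eventually_elim (simp add: mdiff_def)

text \<open>A shifted \<open>cobd H\<close> is \<open>mdiff 1 H\<close> one step before plus a
  difference of consecutive shifts of \<open>Q H\<close>; the latter telescope to the boundary
  term.\<close>

lemma S_coboundary:
  assumes x: "x \<in> space M"
  shows "S X n x = S (\<lambda>y. X y - cobd H y) n x + (\<Sum>j<n. mdiff 1 H (T (1 * int j) x))
    + (E 0 (\<lambda>y. H (T 1 y)) x - E 0 (\<lambda>y. H (T 1 y)) (T (int n) x))"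
proof (induction n)
  case 0
  then show ?case by (simp add: S_def)
next
  case (Suc n)
  have t: "T (int n + 1) x = T 1 (T (int n) x)" using T_add[OF x, of 1 "int n"] by (simp add: add.commute)
  have "S X (Suc n) x = S X n x + X (T 1 (T (int n) x))" by (simp add: S_def t)
  then show ?case using Suc by (simp add: S_def t mdiff_def cobd_def add.commute[of 1])
qed

lemma S_cong_AE:
  assumes "AE x in M. f x = g x"
  shows "AE x in M. S f n x = S g n x"
proof -
  have "AE x in M. \<forall>i::nat. f (T (int i + 1) x) = g (T (int i + 1) x)"
    unfolding AE_all_countable using AE_shift[OF assms] by blast
  then show ?thesis by eventually_elim (simp add: S_def)
qed

text \<open>Two coboundary decompositions of the same \<open>S X n\<close> are compared. The
  difference of the martingales has norm exactly \<open>sqrt n\<close> times that of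
  \<open>P0 (H - H')\<close>, the remainders cost \<open>sqrt n\<close> times their
  \<open>MW_norm\<close>, and the boundary terms stay bounded; divide by \<open>sqrt n\<close> and
  let \<open>n\<close> grow.\<close>

lemma P0_diff_le_MW_norm:
  assumes H: "in_L2 M H" "H \<in> borel_measurable (\<F> 0)" and H': "in_L2 M H'" "H' \<in> borel_measurable (\<F> 0)"
    and X: "in_L2 M X" "X \<in> borel_measurable (\<F> 0)"
    and MW: "MW_summable (\<lambda>y. X y - cobd H y)" "MW_summable (\<lambda>y. X y - cobd H' y)"
  shows "L2_norm M (\<lambda>x. P0 H x - P0 H' x)
    \<le> 2 * (MW_norm (\<lambda>y. X y - cobd H y) + MW_norm (\<lambda>y. X y - cobd H' y))"
proof -
  define G where "G y = H y - H' y" for y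
  define R where "R y = X y - cobd H y" for y
  define R' where "R' y = X y - cobd H' y" for y
  define QH where "QH = E 0 (\<lambda>y. H (T 1 y))"
  define QH' where "QH' = E 0 (\<lambda>y. H' (T 1 y))"
  have G: "in_L2 M G" "G \<in> borel_measurable (\<F> 0)"
    unfolding G_def[abs_def] using H H' by (auto intro: in_L2_diff)
  have R: "in_L2 M R" "R \<in> borel_measurable (\<F> 0)" "in_L2 M R'" "R' \<in> borel_measurable (\<F> 0)"
    unfolding R_def[abs_def] R'_def[abs_def] using X H H'
    by (auto intro!: in_L2_diff cobd_in_L2 borel_measurable_diff cobd_measurable)
  have Q: "in_L2 M QH" "in_L2 M QH'" unfolding QH_def QH'_def by (intro E_in_L2 in_L2_shift H H')+
  define a where "a = L2_norm M (P0 G)"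
  define b where "b = 2 * (MW_norm R + MW_norm R')"
  define c where "c = 2 * (L2_norm M QH + L2_norm M QH')"
  have key: "sqrt (real n) * a \<le> sqrt (real n) * b + c" for n
  proof -
    define c1 where "c1 x = QH x - QH (T (int n) x)" for x
    define c2 where "c2 x = QH' x - QH' (T (int n) x)" for x
    have L2: "in_L2 M c1" "in_L2 M c2" unfolding c1_def[abs_def] c2_def[abs_def]
      by (intro in_L2_diff in_L2_shift Q)+
    have nc: "L2_norm M c1 \<le> 2 * L2_norm M QH" "L2_norm M c2 \<le> 2 * L2_norm M QH'"
      unfolding c1_def[abs_def] c2_def[abs_def]
      using L2_norm_diff[OF Q(1) in_L2_shift[OF Q(1)], of "int n"] L2_norm_diff[OF Q(2) in_L2_shift[OF Q(2)], of "int n"]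
      by (simp_all add: L2_norm_shift[OF Q(1)] L2_norm_shift[OF Q(2)])
    have "AE x in M. \<forall>j::nat. mdiff 1 G (T (1 * int j) x) = mdiff 1 H (T (1 * int j) x) - mdiff 1 H' (T (1 * int j) x)"
      unfolding AE_all_countable G_def by (intro allI AE_shift mdiff_diff H H')
    moreover have "AE x in M. x \<in> space M" by simp
    ultimately have eq: "AE x in M. (\<Sum>j<n. mdiff 1 G (T (1 * int j) x)) = (S R' n x - S R n x) + (c2 x - c1 x)"
    proof eventually_elim
      case (elim x)
      have "(\<Sum>j<n. mdiff 1 G (T (1 * int j) x))
        = (\<Sum>j<n. mdiff 1 H (T (1 * int j) x)) - (\<Sum>j<n. mdiff 1 H' (T (1 * int j) x))"
        unfolding sum_subtractf[symmetric] using elim(1) by (intro sum.cong refl) blast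
      moreover note S_coboundary[OF elim(2), of X n H, folded R_def QH_def]
        S_coboundary[OF elim(2), of X n H', folded R'_def QH'_def]
      ultimately show ?case unfolding c1_def c2_def by linarith
    qed
    have "sqrt (real n) * a = L2_norm M (\<lambda>x. \<Sum>j<n. mdiff 1 G (T (1 * int j) x))"
      unfolding a_def P0_L2_norm[OF G(1)] by (rule mdiff_sum_L2_norm[symmetric]) (auto intro: G)
    also have "\<dots> = L2_norm M (\<lambda>x. (S R' n x - S R n x) + (c2 x - c1 x))"
      by (rule L2_norm_cong_AE[OF eq])
        (intro in_L2_borel in_L2_sum in_L2_shift mdiff_in_L2 G in_L2_add in_L2_diff S_in_L2 R L2)+
    also have "\<dots> \<le> L2_norm M (\<lambda>x. S R' n x - S R n x) + L2_norm M (\<lambda>x. c2 x - c1 x)"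
      by (intro L2_norm_add in_L2_diff S_in_L2 R L2)
    also have "L2_norm M (\<lambda>x. S R' n x - S R n x) \<le> L2_norm M (S R' n) + L2_norm M (S R n)"
      by (intro L2_norm_diff S_in_L2 R)
    also have "L2_norm M (S R' n) \<le> 2 * sqrt (real n) * MW_norm R'"
      by (rule S_L2_norm_le[OF R(3,4)]) (use MW in \<open>simp add: R'_def[abs_def]\<close>)
    also have "L2_norm M (S R n) \<le> 2 * sqrt (real n) * MW_norm R"
      by (rule S_L2_norm_le[OF R(1,2)]) (use MW in \<open>simp add: R_def[abs_def]\<close>)
    also have "L2_norm M (\<lambda>x. c2 x - c1 x) \<le> L2_norm M c2 + L2_norm M c1"
      by (intro L2_norm_diff L2)
    finally show ?thesis using nc by (simp add: b_def c_def algebra_simps)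
  qed
  have "a \<le> b"
  proof (rule ccontr)
    assume "\<not> a \<le> b"
    then have ab: "0 < a - b" by simp
    obtain n :: nat where "(c / (a - b) + 1)\<^sup>2 < real n" using reals_Archimedean2 by blast
    then have "c / (a - b) + 1 < sqrt (real n)" by (rule real_less_rsqrt)
    then have "c / (a - b) < sqrt (real n)" by simp
    then have "c < sqrt (real n) * (a - b)" using ab by (simp add: field_simps)
    then show False using key[of n] by (simp add: algebra_simps)
  qed
  moreover have "L2_norm M (\<lambda>x. P0 H x - P0 H' x) = a"
    unfolding a_def G_def
    by (rule L2_norm_cong_AE[symmetric])
      (intro P0_diff in_L2_borel P0_in_L2 in_L2_diff H H')+
  ultimately show ?thesis by (simp add: b_def R_def[abs_def] R'_def[abs_def])
qed

lemma sqrt_E_power2: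
  assumes "in_L2 M f" "f \<in> borel_measurable (\<F> 0)"
  shows "AE x in M. sqrt (E 0 (\<lambda>y. (f y)\<^sup>2) x) = \<bar>f x\<bar>"
proof -
  have "AE x in M. E 0 (\<lambda>y. (f y)\<^sup>2) x = (f x)\<^sup>2"
    using assms by (intro E_F_meas in_L2_sq) auto
  then show ?thesis by eventually_elim simp
qed

text \<open>Replacing \<open>P0 H\<close> by \<open>D\<close> in \<open>S_coboundary\<close> adds a
  martingale with increment \<open>P0 H - D\<close>. The four terms are the remainder, the two
  boundary values of \<open>Q H\<close>, and this martingale.\<close>

lemma martingale_approximation_bound:
  assumes X: "in_L2 M X" "X \<in> borel_measurable (\<F> 0)"
    and H: "in_L2 M H" "H \<in> borel_measurable (\<F> 0)"
    and D: "in_L2 M D" "D \<in> borel_measurable (\<F> 0)" "AE x in M. E (-1) D x = 0"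
    and n: "0 < n"
  shows "AE x in M. ennreal (sqrt (E 0 (\<lambda>y. (S X n y - S D n y)\<^sup>2) x))
    \<le> ennreal (sqrt (real n)) * S_maxfun (\<lambda>y. X y - cobd H y) x
      + ennreal \<bar>E 0 (\<lambda>y. H (T 1 y)) x\<bar>
      + ennreal (sqrt (E 0 (\<lambda>y. (E 0 (\<lambda>z. H (T 1 z)) (T (int n) y))\<^sup>2) x))
      + ennreal (sqrt (real n)) * (2 * maxfun 1 (\<lambda>y. (P0 H y - D y)\<^sup>2) x)"
proof -
  define R where "R y = X y - cobd H y" for y
  define QH where "QH = E 0 (\<lambda>y. H (T 1 y))"
  define W where "W y = P0 H y - D y" for y
  define Z where "Z y = (\<Sum>j<n. mdiff 1 W (T (1 * int j) y))" for y
  have R: "in_L2 M R" "R \<in> borel_measurable (\<F> 0)"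
    unfolding R_def[abs_def] using X H
    by (auto intro!: in_L2_diff cobd_in_L2 borel_measurable_diff cobd_measurable)
  have W: "in_L2 M W" "W \<in> borel_measurable (\<F> 0)"
    unfolding W_def[abs_def] using D H
    by (auto intro!: in_L2_diff P0_in_L2 borel_measurable_diff P0_measurable)
  have Q: "in_L2 M QH" "in_L2 M (\<lambda>y. - QH (T (int n) y))" "QH \<in> borel_measurable (\<F> 0)"
    unfolding QH_def using in_L2_cmult[OF in_L2_shift[OF E_in_L2[OF in_L2_shift[OF H(1)]]], of "-1"]
    by (auto intro: E_in_L2 in_L2_shift H)
  have Z: "in_L2 M Z" unfolding Z_def[abs_def] by (intro in_L2_sum in_L2_shift mdiff_in_L2 W)
  have SR: "in_L2 M (S R n)" by (rule S_in_L2[OF R(1)])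
  \<comment> \<open>Both \<open>P0 H\<close> and \<open>D\<close> have conditional mean 0 at time
    -1, so after one shift \<open>mdiff\<close> subtracts nothing from either.\<close>
  have mW: "AE x in M. mdiff 1 W x = mdiff 1 H x - D (T 1 x)"
  proof -
    have "AE x in M. E (1 + -1) (\<lambda>y. D (T 1 y)) x = E (-1) D (T 1 x)"
      by (rule E_shift) (rule in_L2_integrable[OF D(1)])
    moreover have "AE x in M. E (-1) D (T 1 x) = 0" by (rule AE_shift[OF D(3)])
    moreover have "AE x in M. E (1 + -1) (\<lambda>y. P0 H (T 1 y)) x = E (-1) (P0 H) (T 1 x)"
      by (rule E_shift) (intro in_L2_integrable P0_in_L2 H)
    moreover have "AE x in M. E (-1) (P0 H) (T 1 x) = 0" by (rule AE_shift[OF E_minus1_P0[OF H(1)]])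
    moreover have "AE x in M. mdiff 1 W x = mdiff 1 (P0 H) x - mdiff 1 D x"
      unfolding W_def by (intro mdiff_diff P0_in_L2 H D)
    moreover note P0_shift[OF H(1)]
    ultimately show ?thesis by eventually_elim (simp add: mdiff_def)
  qed
  then have "AE x in M. \<forall>j::nat. mdiff 1 W (T (1 * int j) x) = mdiff 1 H (T (1 * int j) x) - D (T 1 (T (1 * int j) x))"
    unfolding AE_all_countable by (intro allI AE_shift)
  moreover have "AE x in M. x \<in> space M" by simp
  ultimately have eq: "AE x in M. S X n x - S D n x = (S R n x + Z x) + (QH x + - QH (T (int n) x))"
  proof eventually_elim
    case (elim x)
    have "T (int j + 1) x = T 1 (T (1 * int j) x)" for j
      using T_add[OF elim(2), of 1 "int j"] by (simp add: add.commute)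
    then have "S D n x = (\<Sum>j<n. D (T 1 (T (1 * int j) x)))"
      by (simp only: S_def)
    then have "Z x = (\<Sum>j<n. mdiff 1 H (T (1 * int j) x)) - S D n x"
      unfolding Z_def using elim(1) by (simp add: sum_subtractf)
    then show ?case
      using S_coboundary[OF elim(2), of X n H, folded R_def QH_def] by linarith
  qed
  have [measurable]: "S X n \<in> borel_measurable M" "S D n \<in> borel_measurable M" "S R n \<in> borel_measurable M"
    "Z \<in> borel_measurable M" "QH \<in> borel_measurable M"
    using X D SR Z Q by (auto intro: in_L2_borel S_in_L2)
  have "AE x in M. E 0 (\<lambda>y. (S X n y - S D n y)\<^sup>2) x = E 0 (\<lambda>y. ((S R n y + Z y) + (QH y + - QH (T (int n) y)))\<^sup>2) x"
    by (rule E_cong) (use eq in auto)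
  moreover have "AE x in M. sqrt (E 0 (\<lambda>y. ((S R n y + Z y) + (QH y + - QH (T (int n) y)))\<^sup>2) x)
      \<le> sqrt (E 0 (\<lambda>y. (S R n y + Z y)\<^sup>2) x) + sqrt (E 0 (\<lambda>y. (QH y + - QH (T (int n) y))\<^sup>2) x)"
    by (intro E_minkowski in_L2_add SR Z Q)
  moreover have "AE x in M. sqrt (E 0 (\<lambda>y. (S R n y + Z y)\<^sup>2) x)
      \<le> sqrt (E 0 (\<lambda>y. (S R n y)\<^sup>2) x) + sqrt (E 0 (\<lambda>y. (Z y)\<^sup>2) x)"
    by (intro E_minkowski SR Z)
  moreover have "AE x in M. sqrt (E 0 (\<lambda>y. (QH y + - QH (T (int n) y))\<^sup>2) x)
      \<le> sqrt (E 0 (\<lambda>y. (QH y)\<^sup>2) x) + sqrt (E 0 (\<lambda>y. (- QH (T (int n) y))\<^sup>2) x)"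
    by (intro E_minkowski Q)
  moreover note sqrt_E_power2[OF Q(1,3)]
  moreover have "AE x in M. 0 \<le> E 0 (\<lambda>y. (S R n y)\<^sup>2) x \<and> 0 \<le> E 0 (\<lambda>y. (Z y)\<^sup>2) x
      \<and> 0 \<le> E 0 (\<lambda>y. (- QH (T (int n) y))\<^sup>2) x"
    unfolding AE_conj_iff by (intro conjI E_nonneg) auto
  moreover note quenched_maximal[OF R n] mdiff_sum_maxfun[OF W n]
  ultimately show ?thesis
  proof eventually_elim
    case (elim x)
    have "sqrt (E 0 (\<lambda>y. (S X n y - S D n y)\<^sup>2) x)
      \<le> sqrt (E 0 (\<lambda>y. (S R n y)\<^sup>2) x) + \<bar>QH x\<bar> + sqrt (E 0 (\<lambda>y. (QH (T (int n) y))\<^sup>2) x) + sqrt (E 0 (\<lambda>y. (Z y)\<^sup>2) x)"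
      using elim(1-5) by simp
    then have "ennreal (sqrt (E 0 (\<lambda>y. (S X n y - S D n y)\<^sup>2) x))
      \<le> ennreal (sqrt (E 0 (\<lambda>y. (S R n y)\<^sup>2) x) + \<bar>QH x\<bar> + sqrt (E 0 (\<lambda>y. (QH (T (int n) y))\<^sup>2) x) + sqrt (E 0 (\<lambda>y. (Z y)\<^sup>2) x))"
      by (rule ennreal_leI)
    also have "\<dots> = ennreal (sqrt (E 0 (\<lambda>y. (S R n y)\<^sup>2) x)) + ennreal \<bar>QH x\<bar>
        + ennreal (sqrt (E 0 (\<lambda>y. (QH (T (int n) y))\<^sup>2) x)) + ennreal (sqrt (E 0 (\<lambda>y. (Z y)\<^sup>2) x))"
      using elim(6) by simp
    also have "\<dots> \<le> ennreal (sqrt (real n)) * S_maxfun R x + ennreal \<bar>QH x\<bar>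
        + ennreal (sqrt (E 0 (\<lambda>y. (QH (T (int n) y))\<^sup>2) x)) + ennreal (sqrt (real n)) * (2 * maxfun 1 (\<lambda>y. (W y)\<^sup>2) x)"
      using elim(7,8) by (intro add_mono order_refl) (auto simp: Z_def)
    finally show ?case by (simp add: R_def[abs_def] QH_def W_def[abs_def])
  qed
qed

end

section \<open>Smoothed partial sums\<close>

text \<open>A subadditive sequence need not be monotone, so \<open>a (4 p)\<close> is bounded by
  averaging \<open>a (p + i) + a (3 p - i)\<close> over \<open>i < p\<close>, which involves
  distinct indices between \<open>p\<close> and \<open>4 p\<close>. For these,
  \<open>j^(3/2)\<close> is at most \<open>(4 p)^(3/2) = 8 p sqrt p\<close>.\<close>

lemma dyadic_summable_of_subadditive:
  fixes a :: "nat \<Rightarrow> real"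
  assumes nonneg: "\<And>n. 0 \<le> a n" and sub: "\<And>m n. a (m + n) \<le> a m + a n"
    and sm: "summable (\<lambda>k. a (Suc k) / real (Suc k) powr (3/2))"
  shows "summable (\<lambda>k. (1 / sqrt 2) ^ k * a (2 ^ k))"
proof -
  define b where "b j = a j / real j powr (3/2)" for j
  define B where "B n = (\<Sum>j<n. b j)" for n
  have b_nonneg: "0 \<le> b j" for j using nonneg by (simp add: b_def)
  have sb: "summable b"
    using sm summable_Suc_iff[of b] by (simp add: b_def)
  have B_le: "B n \<le> suminf b" for n
    unfolding B_def using b_nonneg by (intro sum_le_suminf sb) auto
  have B_nonneg: "0 \<le> B n" for n unfolding B_def by (intro sum_nonneg b_nonneg)
  have B_mono: "B m \<le> B n" if "m \<le> n" for m n
    unfolding B_def using that b_nonneg by (intro sum_mono2) auto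
  have key: "(1 / sqrt 2) ^ (k + 2) * a (2 ^ (k + 2)) \<le> 4 * (B (4 * 2 ^ k) - B (2 ^ k))" for k
  proof -
    define p where "p = (2::nat) ^ k"
    have p: "0 < p" by (simp add: p_def)
    have a_le: "a j \<le> 8 * real p * sqrt (real p) * b j" if j: "0 < j" "j < 4 * p" for j
    proof -
      have "real j powr (3/2) = real j * sqrt (real j)"
        using j powr_add[of "real j" 1 "1/2"] by (simp add: powr_half_sqrt)
      then have "a j = real j * sqrt (real j) * b j" using j by (simp add: b_def)
      also have "\<dots> \<le> (4 * real p) * sqrt (4 * real p) * b j"
        using j by (intro mult_right_mono mult_mono b_nonneg real_sqrt_le_mono) (auto simp: real_of_nat_eq_numeral_power_cancel_iff)
      finally show ?thesis by (simp add: real_sqrt_mult)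
    qed
    have "real p * a (4 * p) = (\<Sum>i<p. a (4 * p))" by simp
    also have "\<dots> \<le> (\<Sum>i<p. a (p + i) + a (3 * p - i))"
    proof (rule sum_mono)
      fix i assume "i \<in> {..<p}"
      then have "4 * p = (p + i) + (3 * p - i)" by simp
      then show "a (4 * p) \<le> a (p + i) + a (3 * p - i)" using sub[of "p + i" "3 * p - i"] by simp
    qed
    \<comment> \<open>The two families run through \<open>p, ..., 2 p - 1\<close> and
      \<open>2 p + 1, ..., 3 p\<close>, so no index is counted twice.\<close>
    also have "\<dots> = (\<Sum>j\<in>(\<lambda>i. p + i) ` {..<p}. a j) + (\<Sum>j\<in>(\<lambda>i. 3 * p - i) ` {..<p}. a j)"
      unfolding sum.distrib by (subst (1 2) sum.reindex) (auto simp: inj_on_def)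
    also have "\<dots> = (\<Sum>j\<in>(\<lambda>i. p + i) ` {..<p} \<union> (\<lambda>i. 3 * p - i) ` {..<p}. a j)"
      by (rule sum.union_disjoint[symmetric]) auto
    also have "\<dots> \<le> (\<Sum>j\<in>{p..<4 * p}. a j)"
      using p by (intro sum_mono2 nonneg) auto
    also have "\<dots> \<le> (\<Sum>j\<in>{p..<4 * p}. 8 * real p * sqrt (real p) * b j)"
      using p by (intro sum_mono a_le) auto
    also have "\<dots> = real p * (8 * sqrt (real p) * (B (4 * p) - B p))"
      using p by (simp add: B_def sum_distrib_left[symmetric] sum_diff[of "{..<4 * p}" "{..<p}", symmetric]
          lessThan_minus_lessThan)
    finally have "a (4 * p) \<le> 8 * sqrt (real p) * (B (4 * p) - B p)" using p by simp
    \<comment> \<open>The level is \<open>k + 2\<close> since \<open>4 p = 2 ^ (k + 2)\<close>; the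
      two extra factors \<open>1 / sqrt 2\<close> reduce the constant 8 to 4.\<close>
    then have "(1 / sqrt 2) ^ (k + 2) * a (4 * p) \<le> (1 / sqrt 2) ^ (k + 2) * (8 * sqrt (real p) * (B (4 * p) - B p))"
      by (rule mult_left_mono) simp
    also have "\<dots> = ((1 / sqrt 2) ^ k * sqrt (real p)) * (4 * (B (4 * p) - B p))"
      by (simp add: power_add power2_eq_square)
    also have "(1 / sqrt 2) ^ k * sqrt (real p) = 1"
      by (simp add: p_def real_sqrt_power power_one_over)
    finally show ?thesis by (simp add: p_def power_add mult.commute)
  qed
  have "summable (\<lambda>k. (1 / sqrt 2) ^ (k + 2) * a (2 ^ (k + 2)))"
  proof (rule summableI_nonneg_bounded)
    fix K
    \<comment> \<open>The windows from \<open>2 ^ k\<close> to \<open>2 ^ (k + 2)\<close> overlap,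
      covering each index at most twice, whence two copies of \<open>suminf b\<close> below.\<close>
    have tele: "(\<Sum>k<K. B (4 * 2 ^ k) - B (2 ^ k)) = B (2 * 2 ^ K) + B (2 ^ K) - B 2 - B 1"
      by (induction K) auto
    have "(\<Sum>k<K. (1 / sqrt 2) ^ (k + 2) * a (2 ^ (k + 2))) \<le> (\<Sum>k<K. 4 * (B (4 * 2 ^ k) - B (2 ^ k)))"
      by (intro sum_mono key)
    also have "\<dots> = 4 * (B (2 * 2 ^ K) + B (2 ^ K) - B 2 - B 1)"
      unfolding tele[symmetric] by (rule sum_distrib_left[symmetric])
    also have "\<dots> \<le> 4 * (suminf b + suminf b - 0 - 0)"
      by (intro mult_left_mono diff_mono add_mono B_le B_nonneg) simp
    finally show "(\<Sum>k<K. (1 / sqrt 2) ^ (k + 2) * a (2 ^ (k + 2))) \<le> 4 * (suminf b + suminf b - 0 - 0)" .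
  qed (use nonneg in auto)
  then show ?thesis by (rule summable_iff_shift[THEN iffD1])
qed

text \<open>The \<open>k\<close>-th term \<open>P\<^sub>0(X\<^sub>k) / (k + 1)\<close> occurs \<open>min N (k + 1)\<close> times in the first \<open>N\<close> inner series;
  \<open>cwt\<close> gives the coefficients of the remainder \<open>X - cobd (smooth X N J)\<close> defined below.\<close>

definition wt :: "nat \<Rightarrow> nat \<Rightarrow> real" where
  "wt N k = real (min N (Suc k)) / real (Suc k)"

definition cwt :: "nat \<Rightarrow> nat \<Rightarrow> nat \<Rightarrow> real" where
  "cwt N J k = (if k < J then real N / (real k * real (Suc k)) else real N / real J)"

text \<open>The weights are 1 below \<open>N\<close>, where the sum telescopes and cancels
  \<open>a 0\<close>. From \<open>N\<close> on they drop by \<open>N / k - N / (k + 1)\<close>,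
  which is the coefficient in \<open>cwt\<close>; the last weight \<open>N / J\<close> stays with
  \<open>a J\<close>.\<close>

lemma wt_summation_by_parts:
  fixes a :: "nat \<Rightarrow> real"
  assumes "1 \<le> N" "N \<le> J"
  shows "a 0 + (\<Sum>k<J. wt N k * (a (Suc k) - a k)) = (\<Sum>k=N..J. cwt N J k * a k)"
proof -
  have "a 0 + (\<Sum>k<J. wt N k * (a (Suc k) - a k))
    = (\<Sum>k=N..<J. real N / (real k * real (Suc k)) * a k) + real N / real J * a J"
    using assms(2)
  proof (induction J rule: dec_induct)
    case base
    have "wt N k = 1" if "k < N" for k using that by (simp add: wt_def min_absorb2)
    then have "(\<Sum>k<N. wt N k * (a (Suc k) - a k)) = (\<Sum>k<N. a (Suc k) - a k)"
      by (intro sum.cong refl) simp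
    then show ?case using assms(1) by (simp add: sum_lessThan_telescope)
  next
    case (step J)
    have J: "0 < real J" using step assms by simp
    have w: "wt N J = real N / real (Suc J)" using step by (simp add: wt_def min_def)
    have id: "real N / real J = real N / (real J * real (Suc J)) + real N / real (Suc J)"
    proof -
      define x where "x = real J"
      have x: "0 < x" using J by (simp add: x_def)
      have "real N / (x + 1) = real N * x / (x * (x + 1))" using x by simp
      then have "real N / (x * (x + 1)) + real N / (x + 1) = real N * (x + 1) / (x * (x + 1))"
        by (simp only: add_divide_distrib[symmetric]) (simp add: algebra_simps)
      also have "\<dots> = real N / x" using x by simp
      finally show ?thesis by (simp add: x_def add.commute)
    qed
    show ?case using step by (simp add: w id algebra_simps)
  qed
  also have "\<dots> = (\<Sum>k=N..J. cwt N J k * a k)"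
  proof -
    have "{N..J} = insert J {N..<J}" using assms by auto
    then show ?thesis by (simp add: cwt_def)
  qed
  finally show ?thesis .
qed

lemma cwt_nonneg: "0 \<le> cwt N J k"
  by (simp add: cwt_def)

text \<open>Summation by parts for a constant sequence.\<close>

lemma cwt_sum: "1 \<le> N \<Longrightarrow> N \<le> J \<Longrightarrow> (\<Sum>k=N..J. cwt N J k) = 1"
  using wt_summation_by_parts[of N J "\<lambda>_. 1"] by simp

text \<open>All inner sums are cut at the same \<open>k < J\<close>; truncated subtraction makes
  those with \<open>J \<le> n\<close> empty.\<close>

lemma sum_wt_rearrange:
  fixes b :: "nat \<Rightarrow> real"
  shows "(\<Sum>k<J. real (min N (Suc k)) * b k) = (\<Sum>n<N. \<Sum>j<J - n. b (n + j))"
proof (induction N)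
  case (Suc N)
  have "(\<Sum>k<J. real (min (Suc N) (Suc k)) * b k)
      = (\<Sum>k<J. real (min N (Suc k)) * b k + (if N \<le> k then b k else 0))"
  proof (rule sum.cong)
    fix k
    show "real (min (Suc N) (Suc k)) * b k = real (min N (Suc k)) * b k + (if N \<le> k then b k else 0)"
      by (cases "N \<le> k") (simp_all add: min_absorb1 min_absorb2 distrib_right)
  qed simp
  also have "\<dots> = (\<Sum>k<J. real (min N (Suc k)) * b k) + (\<Sum>k<J. if N \<le> k then b k else 0)"
    by (rule sum.distrib)
  also have "(\<Sum>k<J. if N \<le> k then b k else 0) = (\<Sum>k\<in>{N..<J}. b k)"
    by (intro sum.mono_neutral_cong_right) auto
  also have "\<dots> = (\<Sum>j<J - N. b (N + j))"
    by (rule sum.reindex_bij_witness[of _ "\<lambda>j. N + j" "\<lambda>k. k - N"]) auto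
  finally show ?case using Suc by simp
qed simp

lemma abel_sum:
  fixes c t :: "nat \<Rightarrow> real"
  assumes "N \<le> J"
  shows "(\<Sum>k=N..<J. c k * (t (Suc k) - t k))
    = c J * t J - c N * t N + (\<Sum>k=N..<J. (c k - c (Suc k)) * t (Suc k))"
  using assms by (induction J rule: dec_induct) (auto simp: algebra_simps)

text \<open>From \<open>(v - u) (v + u) = 1\<close> and \<open>u \<le> v\<close>. It makes the Abel
  sum for harmonic weights telescope.\<close>

lemma inverse_sqrt_Suc_diff:
  fixes x :: real
  assumes "0 < x"
  shows "1 / (sqrt x * (x + 1)) \<le> 2 * (1 / sqrt x - 1 / sqrt (x + 1))"
proof -
  define u v where "u = sqrt x" and "v = sqrt (x + 1)"
  have u: "0 < u" "u \<le> v" "v\<^sup>2 = x + 1" "u\<^sup>2 = x" using assms by (auto simp: u_def v_def)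
  then have v: "0 < v" by linarith
  have "(v - u) * (v + u) = 1" using u(3,4) by (simp add: power2_eq_square algebra_simps)
  then have "1 = (v - u) * (v + u)" by simp
  also have "\<dots> \<le> (v - u) * (2 * v)" using u by (intro mult_left_mono) auto
  finally have "1 / (u * v\<^sup>2) \<le> (v - u) * (2 * v) / (u * v\<^sup>2)"
    using u v by (intro divide_right_mono) auto
  also have "\<dots> = 2 * (1 / u - 1 / v)" using u(1) v by (simp add: field_simps power2_eq_square)
  finally show ?thesis unfolding u(3) by (simp add: u_def v_def)
qed

section \<open>Powers of the operator and the smoothed remainder\<close>

context stationary_system
begin

text \<open>This is \<open>Q^k X\<close>; for \<open>k = 0\<close> it is \<open>X\<close> almost
  surely when \<open>X\<close> is \<open>\<F> 0\<close>-measurable.\<close>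

definition qf :: "('a \<Rightarrow> real) \<Rightarrow> nat \<Rightarrow> 'a \<Rightarrow> real" where
  "qf X k = E 0 (\<lambda>y. X (T (int k) y))"

lemma qf_in_L2: "in_L2 M X \<Longrightarrow> in_L2 M (qf X k)"
  unfolding qf_def by (intro E_in_L2 in_L2_shift)

lemma qf_measurable [measurable]: "qf X k \<in> borel_measurable (\<F> 0)"
  unfolding qf_def by (rule E_borel)

lemma qf_L2_norm: "in_L2 M X \<Longrightarrow> L2_norm M (qf X k) \<le> L2_norm M X"
  unfolding qf_def using E_L2_norm[OF in_L2_shift, of X 0 "int k"] by (simp add: L2_norm_shift)

lemma E_qf_shift:
  assumes X: "in_L2 M X"
  shows "AE x in M. E 0 (\<lambda>y. qf X k (T (int i) y)) x = qf X (k + i) x"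
proof -
  have [measurable]: "X \<in> borel_measurable M" by (rule in_L2_borel[OF X])
  have "AE x in M. E 0 (\<lambda>y. qf X k (T (int i) y)) x = E 0 (\<lambda>y. X (T (int k) (T (int i) y))) x"
    unfolding qf_def by (rule E_nested_shift) (intro in_L2_integrable in_L2_shift X, simp)
  moreover have "AE x in M. E 0 (\<lambda>y. X (T (int k) (T (int i) y))) x = qf X (k + i) x"
    unfolding qf_def by (rule E_cong, rule AE_I2) (simp_all add: T_add)
  ultimately show ?thesis by eventually_elim simp
qed

lemma V_eq_sum_qf:
  assumes X: "in_L2 M X"
  shows "AE x in M. V X n x = (\<Sum>i<n. qf X (Suc i) x)"
proof -
  have "AE x in M. E 0 (\<lambda>y. \<Sum>i<n. X (T (int i + 1) y)) x = (\<Sum>i<n. E 0 (\<lambda>y. X (T (int i + 1) y)) x)"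
    by (intro E_sum in_L2_integrable in_L2_shift X)
  then show ?thesis
    by eventually_elim (simp add: V_def S_def[abs_def] qf_def add.commute)
qed

text \<open>The sum is \<open>Q^0 X\<close> followed by \<open>V X (n - 1)\<close>, which the
  annealed inequality bounds. This growth of order \<open>sqrt n\<close> drives all the Abel
  summations below.\<close>

lemma sum_qf_L2_norm:
  assumes X: "in_L2 M X" "X \<in> borel_measurable (\<F> 0)" and MW: "MW_summable X"
  shows "L2_norm M (\<lambda>x. \<Sum>i<n. qf X i x) \<le> (L2_norm M X + 2 * MW_norm X) * sqrt (real n)"
proof (cases n)
  case (Suc m)
  have MW0: "0 \<le> MW_norm X" by (rule MW_norm_nonneg[OF MW])
  have "L2_norm M (\<lambda>x. \<Sum>i<n. qf X i x) = L2_norm M (\<lambda>x. qf X 0 x + V X m x)"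
  proof (rule L2_norm_cong_AE)
    show "AE x in M. (\<Sum>i<n. qf X i x) = qf X 0 x + V X m x"
      using V_eq_sum_qf[OF X(1), of m]
      by eventually_elim (simp add: Suc sum.lessThan_Suc_shift del: sum.lessThan_Suc)
  qed (intro in_L2_borel in_L2_sum in_L2_add qf_in_L2 V_in_L2 X)+
  also have "\<dots> \<le> L2_norm M (qf X 0) + L2_norm M (V X m)"
    by (intro L2_norm_add qf_in_L2 V_in_L2 X)
  also have "\<dots> \<le> L2_norm M X + L2_norm M (S X m)"
    unfolding V_def by (intro add_mono qf_L2_norm E_L2_norm S_in_L2 X)
  also have "\<dots> \<le> L2_norm M X * sqrt (real n) + 2 * sqrt (real n) * MW_norm X"
  proof (rule add_mono)
    have "L2_norm M X * 1 \<le> L2_norm M X * sqrt (real n)"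
      by (rule mult_left_mono) (auto simp: Suc)
    then show "L2_norm M X \<le> L2_norm M X * sqrt (real n)" by simp
    have "L2_norm M (S X m) \<le> 2 * sqrt (real m) * MW_norm X" by (rule S_L2_norm_le[OF X MW])
    also have "\<dots> \<le> 2 * sqrt (real n) * MW_norm X" using MW0 by (intro mult_right_mono) (auto simp: Suc)
    finally show "L2_norm M (S X m) \<le> 2 * sqrt (real n) * MW_norm X" .
  qed
  finally show ?thesis by (simp add: algebra_simps)
qed simp

text \<open>Abel summation against the partial sums of \<open>Q^i X\<close>. Since the weights
  decrease, the new coefficients are nonnegative and the triangle inequality keeps them without
  absolute values.\<close>

lemma weighted_sum_qf_L2_norm:
  assumes X: "in_L2 M X" and NJ: "N \<le> J"
    and t: "\<And>n. L2_norm M (\<lambda>x. \<Sum>i<n. qf X i x) \<le> C * sqrt (real n)"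
    and c: "\<And>k. 0 \<le> c k" and dec: "\<And>k. N \<le> k \<Longrightarrow> c (Suc k) \<le> c k"
  shows "L2_norm M (\<lambda>x. \<Sum>k=N..<J. c k * qf X k x)
    \<le> C * (c J * sqrt (real J) + c N * sqrt (real N) + (\<Sum>k=N..<J. (c k - c (Suc k)) * sqrt (real (Suc k))))"
proof -
  define Q where "Q n x = (\<Sum>i<n. qf X i x)" for n x
  have Q: "in_L2 M (Q n)" for n unfolding Q_def[abs_def] by (intro in_L2_sum qf_in_L2 X)
  have tQ: "L2_norm M (Q n) \<le> C * sqrt (real n)" for n using t by (simp add: Q_def[abs_def])
  have mul: "L2_norm M (\<lambda>x. a * Q n x) \<le> a * (C * sqrt (real n))" if "0 \<le> a" for a n
    using that tQ by (simp add: L2_norm_cmult mult_left_mono)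
  have "(\<Sum>k=N..<J. c k * qf X k x) = (\<Sum>k=N..<J. c k * (Q (Suc k) x - Q k x))" for x
    by (simp add: Q_def)
  then have "(\<Sum>k=N..<J. c k * qf X k x)
      = (c J * Q J x - c N * Q N x) + (\<Sum>k=N..<J. (c k - c (Suc k)) * Q (Suc k) x)" for x
    using abel_sum[OF NJ, of c "\<lambda>k. Q k x"] by (simp only:)
  then have "L2_norm M (\<lambda>x. \<Sum>k=N..<J. c k * qf X k x)
     = L2_norm M (\<lambda>x. (c J * Q J x - c N * Q N x) + (\<Sum>k=N..<J. (c k - c (Suc k)) * Q (Suc k) x))"
    by (simp only:)
  also have "\<dots> \<le> L2_norm M (\<lambda>x. c J * Q J x - c N * Q N x) + L2_norm M (\<lambda>x. \<Sum>k=N..<J. (c k - c (Suc k)) * Q (Suc k) x)"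
    by (intro L2_norm_add in_L2_intros Q)
  also have "L2_norm M (\<lambda>x. c J * Q J x - c N * Q N x) \<le> L2_norm M (\<lambda>x. c J * Q J x) + L2_norm M (\<lambda>x. c N * Q N x)"
    by (intro L2_norm_diff in_L2_intros Q)
  also have "L2_norm M (\<lambda>x. c J * Q J x) \<le> c J * (C * sqrt (real J))" by (rule mul[OF c])
  also have "L2_norm M (\<lambda>x. c N * Q N x) \<le> c N * (C * sqrt (real N))" by (rule mul[OF c])
  also have "L2_norm M (\<lambda>x. \<Sum>k=N..<J. (c k - c (Suc k)) * Q (Suc k) x)
      \<le> (\<Sum>k=N..<J. L2_norm M (\<lambda>x. (c k - c (Suc k)) * Q (Suc k) x))"
    by (intro L2_norm_sum in_L2_cmult Q)
  also have "\<dots> \<le> (\<Sum>k=N..<J. (c k - c (Suc k)) * (C * sqrt (real (Suc k))))"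
    using dec by (intro sum_mono mul) auto
  finally show ?thesis by (simp add: distrib_left sum_distrib_left ac_simps)
qed

text \<open>The weights have increments of order \<open>k^-2\<close> against partial sums of order
  \<open>sqrt k\<close>, leaving a tail of order \<open>N^(-1/2)\<close>, uniformly in
  \<open>J\<close>. The constant 4 is 1 for each boundary term and 2 for the telescoped sum.\<close>

lemma harmonic_sum_qf_L2_norm:
  assumes X: "in_L2 M X" and N: "1 \<le> N" "N \<le> J" and C: "0 \<le> C"
    and t: "\<And>n. L2_norm M (\<lambda>x. \<Sum>i<n. qf X i x) \<le> C * sqrt (real n)"
  shows "L2_norm M (\<lambda>x. \<Sum>k=N..<J. 1 / real (Suc k) * qf X k x) \<le> 4 * C / sqrt (real N)"
proof -
  have s: "1 / real (Suc n) * sqrt (real n) \<le> 1 / sqrt (real N)" if "N \<le> n" for n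
  proof -
    have "1 / real (Suc n) * sqrt (real n) \<le> 1 / real n * sqrt (real n)"
      using that N by (intro mult_right_mono) (auto intro!: divide_left_mono)
    also have "\<dots> = 1 / sqrt (real n)" using that N by (simp add: field_simps)
    also have "\<dots> \<le> 1 / sqrt (real N)" using that N by (intro divide_left_mono) auto
    finally show ?thesis .
  qed
  have step: "(1 / real (Suc k) - 1 / real (Suc (Suc k))) * sqrt (real (Suc k))
      \<le> 2 * (1 / sqrt (real (Suc k)) - 1 / sqrt (real (Suc (Suc k))))" for k
  proof -
    have "(1 / real (Suc k) - 1 / real (Suc (Suc k))) * sqrt (real (Suc k)) = 1 / (sqrt (real (Suc k)) * (real (Suc k) + 1))"
    proof -
      define s where "s = sqrt (real (Suc k))"
      have s: "0 < s" "real (Suc k) = s\<^sup>2" by (auto simp: s_def)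
      have y: "0 < s\<^sup>2 + 1" by (rule add_nonneg_pos) auto
      have "1 / s\<^sup>2 - 1 / (s\<^sup>2 + 1) = 1 / (s\<^sup>2 * (s\<^sup>2 + 1))"
        using s(1) y by (subst diff_frac_eq) auto
      then have "(1 / s\<^sup>2 - 1 / (s\<^sup>2 + 1)) * s = 1 / (s * (s\<^sup>2 + 1))"
        using s(1) by (simp add: power2_eq_square)
      moreover have "real (Suc (Suc k)) = s\<^sup>2 + 1" using s(2) by simp
      ultimately have "(1 / real (Suc k) - 1 / real (Suc (Suc k))) * s = 1 / (s * (real (Suc k) + 1))"
        by (simp only: s(2))
      then show ?thesis unfolding s_def .
    qed
    also have "\<dots> \<le> 2 * (1 / sqrt (real (Suc k)) - 1 / sqrt (real (Suc k) + 1))"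
      by (rule inverse_sqrt_Suc_diff) simp
    also have "real (Suc k) + 1 = real (Suc (Suc k))" by simp
    finally show ?thesis .
  qed
  have tele: "(\<Sum>k=N..<J. 2 * (1 / sqrt (real (Suc k)) - 1 / sqrt (real (Suc (Suc k)))))
      = 2 * (1 / sqrt (real (Suc N)) - 1 / sqrt (real (Suc J)))"
    using N(2) by (induction J rule: dec_induct) auto
  have "(\<Sum>k=N..<J. (1 / real (Suc k) - 1 / real (Suc (Suc k))) * sqrt (real (Suc k))) \<le> 2 * (1 / sqrt (real (Suc N)) - 1 / sqrt (real (Suc J)))"
    unfolding tele[symmetric] by (intro sum_mono step)
  also have "\<dots> \<le> 2 * (1 / sqrt (real N))"
  proof -
    have "1 / sqrt (real (Suc N)) - 1 / sqrt (real (Suc J)) \<le> 1 / sqrt (real N) - 0"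
      using N by (intro diff_mono divide_left_mono) auto
    then show ?thesis by simp
  qed
  finally have tail: "(\<Sum>k=N..<J. (1 / real (Suc k) - 1 / real (Suc (Suc k))) * sqrt (real (Suc k))) \<le> 2 * (1 / sqrt (real N))" .
  have "L2_norm M (\<lambda>x. \<Sum>k=N..<J. 1 / real (Suc k) * qf X k x)
    \<le> C * (1 / real (Suc J) * sqrt (real J) + 1 / real (Suc N) * sqrt (real N)
      + (\<Sum>k=N..<J. (1 / real (Suc k) - 1 / real (Suc (Suc k))) * sqrt (real (Suc k))))"
    by (rule weighted_sum_qf_L2_norm[OF X N(2) t]) (auto intro!: divide_left_mono)
  also have "\<dots> \<le> C * (4 * (1 / sqrt (real N)))"
    using s[OF N(2)] s[OF order_refl] tail by (intro mult_left_mono C) linarith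
  finally show ?thesis by (simp add: mult.commute)
qed

text \<open>Up to index \<open>J - 1\<close> the coefficients decrease with differences of order
  \<open>N k^-3\<close>, and Abel summation gives order \<open>N^(-1/2)\<close>. The last
  coefficient \<open>N / J\<close> lies outside this pattern and accounts for the second
  summand.\<close>

lemma cwt_sum_qf_L2_norm:
  assumes X: "in_L2 M X" and N: "1 \<le> N" "N \<le> J" and C: "0 \<le> C"
    and t: "\<And>n. L2_norm M (\<lambda>x. \<Sum>i<n. qf X i x) \<le> C * sqrt (real n)"
  shows "L2_norm M (\<lambda>x. \<Sum>k=N..J. cwt N J k * qf X k x) \<le> 4 * C / sqrt (real N) + real N * L2_norm M X / real J"
proof -
  define c where "c k = real N / (real k * real (Suc k))" for k
  have s: "c n * sqrt (real n) \<le> 1 / sqrt (real N)" if "N \<le> n" for n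
  proof -
    have n: "0 < real n" using that N by simp
    have "c n * sqrt (real n) \<le> real n / (real n * real n) * sqrt (real n)"
      unfolding c_def using n that by (intro mult_right_mono frac_le mult_left_mono) auto
    also have "\<dots> = 1 / sqrt (real n)" using n by (simp add: field_simps)
    also have "\<dots> \<le> 1 / sqrt (real N)" using that N by (intro divide_left_mono) auto
    finally show ?thesis .
  qed
  have c_diff: "c k - c (Suc k) = 2 * real N / (real k * real (Suc k) * real (Suc (Suc k)))" if "N \<le> k" for k
  proof -
    define x where "x = real k"
    have x: "0 < x" using that N by (simp add: x_def)
    have "real N / (x * (x + 1)) = real N * (x + 2) / (x * (x + 1) * (x + 2))"
      "real N / ((x + 1) * (x + 2)) = real N * x / (x * (x + 1) * (x + 2))"
      using x by simp_all
    then have "real N / (x * (x + 1)) - real N / ((x + 1) * (x + 2)) = 2 * real N / (x * (x + 1) * (x + 2))"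
      by (simp add: diff_divide_distrib[symmetric] algebra_simps del: times_divide_eq_right)
    then show ?thesis by (simp add: c_def x_def add.commute)
  qed
  have step: "(c k - c (Suc k)) * sqrt (real (Suc k)) \<le> 2 * real N / sqrt (real N) * (1 / real k - 1 / real (Suc k))"
    if k: "N \<le> k" for k
  proof -
    have k0: "0 < real k" using k N by simp
    have "sqrt (real (Suc k)) / real (Suc (Suc k)) \<le> sqrt (real (Suc k)) / real (Suc k)"
      by (intro divide_left_mono) auto
    also have "\<dots> = 1 / sqrt (real (Suc k))" by (simp add: field_simps)
    also have "\<dots> \<le> 1 / sqrt (real N)" using k N by (intro divide_left_mono) auto
    finally have le: "sqrt (real (Suc k)) / real (Suc (Suc k)) \<le> 1 / sqrt (real N)" .
    have "(c k - c (Suc k)) * sqrt (real (Suc k))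
      = 2 * real N / (real k * real (Suc k)) * (sqrt (real (Suc k)) / real (Suc (Suc k)))"
      unfolding c_diff[OF k] by simp
    also have "\<dots> \<le> 2 * real N / (real k * real (Suc k)) * (1 / sqrt (real N))"
      by (intro mult_left_mono le) simp
    also have "\<dots> = 2 * real N / sqrt (real N) * (1 / (real k * real (Suc k)))" by simp
    also have "1 / (real k * real (Suc k)) = 1 / real k - 1 / real (Suc k)"
      using k0 by (simp add: field_simps)
    finally show ?thesis .
  qed
  have tele: "(\<Sum>k=N..<J. 2 * real N / sqrt (real N) * (1 / real k - 1 / real (Suc k)))
      = 2 * real N / sqrt (real N) * (1 / real N - 1 / real J)"
    unfolding sum_distrib_left[symmetric]
    using N(2) by (intro arg_cong[where f = "\<lambda>z. 2 * real N / sqrt (real N) * z"], induction J rule: dec_induct) auto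
  have "(\<Sum>k=N..<J. (c k - c (Suc k)) * sqrt (real (Suc k))) \<le> 2 * real N / sqrt (real N) * (1 / real N - 1 / real J)"
    unfolding tele[symmetric] by (intro sum_mono step) auto
  also have "\<dots> \<le> 2 * real N / sqrt (real N) * (1 / real N)" by (intro mult_left_mono) auto
  also have "\<dots> = 2 * (1 / sqrt (real N))" using N by simp
  finally have tail: "(\<Sum>k=N..<J. (c k - c (Suc k)) * sqrt (real (Suc k))) \<le> 2 * (1 / sqrt (real N))" .
  have "L2_norm M (\<lambda>x. \<Sum>k=N..<J. c k * qf X k x)
    \<le> C * (c J * sqrt (real J) + c N * sqrt (real N) + (\<Sum>k=N..<J. (c k - c (Suc k)) * sqrt (real (Suc k))))"
  proof (rule weighted_sum_qf_L2_norm[OF X N(2) t])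
    show "0 \<le> c k" for k by (simp add: c_def)
    show "c (Suc k) \<le> c k" if "N \<le> k" for k
      using c_diff[OF that] by (metis diff_ge_0_iff_ge divide_nonneg_nonneg mult_nonneg_nonneg of_nat_0_le_iff zero_le_numeral)
  qed
  also have "\<dots> \<le> C * (4 * (1 / sqrt (real N)))"
    using s[OF N(2)] s[OF order_refl] tail by (intro mult_left_mono C) linarith
  finally have main: "L2_norm M (\<lambda>x. \<Sum>k=N..<J. c k * qf X k x) \<le> 4 * C / sqrt (real N)" by (simp add: mult.commute)
  have set: "{N..J} = insert J {N..<J}" using N by auto
  have "(\<Sum>k=N..J. cwt N J k * qf X k x) = real N / real J * qf X J x + (\<Sum>k=N..<J. c k * qf X k x)" for x
    unfolding set by (simp add: cwt_def c_def)
  then have "L2_norm M (\<lambda>x. \<Sum>k=N..J. cwt N J k * qf X k x)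
      = L2_norm M (\<lambda>x. real N / real J * qf X J x + (\<Sum>k=N..<J. c k * qf X k x))" by simp
  also have "\<dots> \<le> L2_norm M (\<lambda>x. real N / real J * qf X J x) + L2_norm M (\<lambda>x. \<Sum>k=N..<J. c k * qf X k x)"
    by (intro L2_norm_add in_L2_cmult in_L2_sum qf_in_L2 X)
  also have "L2_norm M (\<lambda>x. real N / real J * qf X J x) \<le> real N / real J * L2_norm M X"
    unfolding L2_norm_cmult by (simp add: mult_left_mono divide_right_mono qf_L2_norm[OF X])
  finally show ?thesis using main by simp
qed

lemma S_sum: "S (\<lambda>x. \<Sum>k\<in>I. c k * f k x) n x = (\<Sum>k\<in>I. c k * S (f k) n x)"
  unfolding S_def sum_distrib_left by (rule sum.swap)

text \<open>Powers of \<open>Q\<close> commute: \<open>E 0 (S (qf X k) p)\<close> and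
  \<open>Q^k\<close> applied to \<open>V X p\<close> are both the sum of \<open>Q^(k+i) X\<close>
  over \<open>1 \<le> i \<le> p\<close>, and \<open>Q^k\<close> is a contraction of L2.\<close>

lemma E_S_qf_L2_norm:
  assumes X: "in_L2 M X"
  shows "L2_norm M (E 0 (S (qf X k) p)) \<le> L2_norm M (V X p)"
proof -
  have [measurable]: "X \<in> borel_measurable M" by (rule in_L2_borel[OF X])
  have "AE x in M. E 0 (\<lambda>y. \<Sum>i<p. qf X k (T (int i + 1) y)) x = (\<Sum>i<p. E 0 (\<lambda>y. qf X k (T (int i + 1) y)) x)"
    by (intro E_sum in_L2_integrable in_L2_shift qf_in_L2 X)
  moreover have "AE x in M. \<forall>i. E 0 (\<lambda>y. qf X k (T (int (Suc i)) y)) x = qf X (k + Suc i) x"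
    unfolding AE_all_countable by (intro allI E_qf_shift X)
  moreover have "AE x in M. E 0 (\<lambda>y. \<Sum>i<p. X (T (int i + 1) (T (int k) y))) x
      = (\<Sum>i<p. E 0 (\<lambda>y. X (T (int i + 1) (T (int k) y))) x)"
    by (intro E_sum in_L2_integrable in_L2_shift[where f = "\<lambda>y. X (T (int _ + 1) y)"] in_L2_shift[where f = X] X)
  moreover have "AE x in M. \<forall>i. E 0 (\<lambda>y. X (T (int i + 1) (T (int k) y))) x = qf X (k + Suc i) x"
    unfolding AE_all_countable
  proof (rule allI)
    fix i
    have "T (int (k + Suc i)) x = T (int i + 1) (T (int k) x)" if "x \<in> space M" for x
      using T_add[OF that, of "int i + 1" "int k"] by (simp add: ac_simps)
    then show "AE x in M. E 0 (\<lambda>y. X (T (int i + 1) (T (int k) y))) x = qf X (k + Suc i) x"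
      unfolding qf_def by (intro E_cong AE_I2) auto
  qed
  moreover have "AE x in M. E 0 (\<lambda>y. E 0 (S X p) (T (int k) y)) x = E 0 (\<lambda>y. S X p (T (int k) y)) x"
    by (intro E_nested_shift in_L2_integrable S_in_L2 X) simp
  ultimately have eq: "AE x in M. E 0 (S (qf X k) p) x = E 0 (\<lambda>y. V X p (T (int k) y)) x"
    by eventually_elim (simp add: S_def[abs_def] V_def add.commute)
  have "L2_norm M (E 0 (S (qf X k) p)) = L2_norm M (E 0 (\<lambda>y. V X p (T (int k) y)))"
    by (rule L2_norm_cong_AE[OF eq]) auto
  also have "\<dots> \<le> L2_norm M (\<lambda>y. V X p (T (int k) y))"
    by (intro E_L2_norm in_L2_shift V_in_L2 X)
  also have "\<dots> = L2_norm M (V X p)" by (intro L2_norm_shift V_in_L2 X)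
  finally show ?thesis .
qed

text \<open>Convexity of the norm together with \<open>E_S_qf_L2_norm\<close>. Being valid for every
  \<open>p\<close> without a constant, it supplies the domination required by
  \<open>MW_norm_small\<close>.\<close>

lemma V_convex_combination_L2_norm:
  assumes X: "in_L2 M X" and R: "in_L2 M R"
    and eq: "AE x in M. R x = (\<Sum>k\<in>I. c k * qf X k x)"
    and c: "\<And>k. 0 \<le> c k" "(\<Sum>k\<in>I. c k) = 1"
  shows "L2_norm M (V R p) \<le> L2_norm M (V X p)"
proof -
  note L2 = S_in_L2[OF qf_in_L2[OF X]]
  have "AE x in M. S R p x = (\<Sum>k\<in>I. c k * S (qf X k) p x)"
    using S_cong_AE[OF eq, of p] by (simp add: S_sum)
  then have "AE x in M. E 0 (S R p) x = E 0 (\<lambda>x. \<Sum>k\<in>I. c k * S (qf X k) p x) x"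
    by (rule E_cong) (intro in_L2_borel S_in_L2 R in_L2_sum in_L2_cmult L2)+
  moreover have "AE x in M. E 0 (\<lambda>x. \<Sum>k\<in>I. c k * S (qf X k) p x) x = (\<Sum>k\<in>I. E 0 (\<lambda>x. c k * S (qf X k) p x) x)"
    by (intro E_sum in_L2_integrable in_L2_cmult L2)
  moreover have "AE x in M. \<forall>k. E 0 (\<lambda>x. c k * S (qf X k) p x) x = c k * E 0 (S (qf X k) p) x"
    unfolding AE_all_countable by (intro allI E_cmult in_L2_integrable L2)
  ultimately have eq': "AE x in M. E 0 (S R p) x = (\<Sum>k\<in>I. c k * E 0 (S (qf X k) p) x)"
    by eventually_elim simp
  have "L2_norm M (V R p) = L2_norm M (\<lambda>x. \<Sum>k\<in>I. c k * E 0 (S (qf X k) p) x)"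
    unfolding V_def by (rule L2_norm_cong_AE[OF eq']) auto
  also have "\<dots> \<le> (\<Sum>k\<in>I. L2_norm M (\<lambda>x. c k * E 0 (S (qf X k) p) x))"
    by (intro L2_norm_sum in_L2_cmult E_in_L2 L2)
  also have "\<dots> \<le> (\<Sum>k\<in>I. c k * L2_norm M (V X p))"
    unfolding L2_norm_cmult using c by (intro sum_mono) (auto intro!: mult_left_mono E_S_qf_L2_norm X)
  also have "\<dots> = L2_norm M (V X p)" using c by (simp add: sum_distrib_right[symmetric])
  finally show ?thesis .
qed

text \<open>The sum of the first \<open>N\<close> terms of the outer series defining \<open>D\<close> is the limit of
  \<open>P0 (smooth X N J)\<close> as \<open>J\<close> tends to infinity.\<close>

definition smooth :: "('a \<Rightarrow> real) \<Rightarrow> nat \<Rightarrow> nat \<Rightarrow> 'a \<Rightarrow> real" where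
  "smooth X N J x = (\<Sum>k<J. wt N k * qf X k x)"

lemma smooth_in_L2: "in_L2 M X \<Longrightarrow> in_L2 M (smooth X N J)"
  unfolding smooth_def[abs_def] by (intro in_L2_sum in_L2_cmult qf_in_L2)

lemma smooth_measurable: "smooth X N J \<in> borel_measurable (\<F> 0)"
  unfolding smooth_def[abs_def] by measurable

text \<open>\<open>Q\<close> raises each index of \<open>smooth X N J\<close> by one, so
  \<open>X\<close> minus the coboundary is \<open>Q^0 X\<close> plus weighted differences of
  consecutive powers, ready for summation by parts.\<close>

lemma cobd_smooth:
  assumes X: "in_L2 M X" "X \<in> borel_measurable (\<F> 0)" and N: "1 \<le> N" "N \<le> J"
  shows "AE x in M. X x - cobd (smooth X N J) x = (\<Sum>k=N..J. cwt N J k * qf X k x)"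
proof -
  have "AE x in M. E 0 (\<lambda>y. \<Sum>k<J. wt N k * qf X k (T 1 y)) x = (\<Sum>k<J. E 0 (\<lambda>y. wt N k * qf X k (T 1 y)) x)"
    by (intro E_sum in_L2_integrable in_L2_cmult in_L2_shift qf_in_L2 X)
  moreover have "AE x in M. \<forall>k. E 0 (\<lambda>y. wt N k * qf X k (T 1 y)) x = wt N k * E 0 (\<lambda>y. qf X k (T 1 y)) x"
    unfolding AE_all_countable by (intro allI E_cmult in_L2_integrable in_L2_shift qf_in_L2 X)
  moreover have "AE x in M. \<forall>k. E 0 (\<lambda>y. qf X k (T (int 1) y)) x = qf X (k + 1) x"
    unfolding AE_all_countable by (intro allI E_qf_shift X)
  moreover have "AE x in M. qf X 0 x = X x"
    unfolding qf_def using E_F_meas[OF in_L2_integrable[OF X(1)] X(2)] by simp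
  ultimately show ?thesis
  proof eventually_elim
    case (elim x)
    have "E 0 (\<lambda>y. smooth X N J (T 1 y)) x = (\<Sum>k<J. wt N k * qf X (Suc k) x)"
      using elim(1-3) by (simp add: smooth_def)
    then have "X x - cobd (smooth X N J) x = qf X 0 x + (\<Sum>k<J. wt N k * (qf X (Suc k) x - qf X k x))"
      using elim(4) by (simp add: cobd_def smooth_def right_diff_distrib sum_subtractf)
    then show ?case using wt_summation_by_parts[OF N, of "\<lambda>k. qf X k x"] by simp
  qed
qed

text \<open>The order of choice matters: \<open>N\<close> makes \<open>4 C / sqrt N\<close> small,
  and only then can \<open>J\<close>, depending on \<open>N\<close>, make \<open>N / J\<close>
  small.\<close>

lemma smooth_MW_small:
  assumes X: "in_L2 M X" "X \<in> borel_measurable (\<F> 0)" and MW: "MW_summable X" and e: "0 < e"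
  shows "\<exists>N0\<ge>1. \<forall>N\<ge>N0. eventually (\<lambda>J. MW_summable (\<lambda>y. X y - cobd (smooth X N J) y)
    \<and> MW_norm (\<lambda>y. X y - cobd (smooth X N J) y) \<le> e) sequentially"
proof -
  define C where "C = L2_norm M X + 2 * MW_norm X"
  have C: "0 \<le> C" using MW_norm_nonneg[OF MW] by (simp add: C_def)
  have t: "L2_norm M (\<lambda>x. \<Sum>i<n. qf X i x) \<le> C * sqrt (real n)" for n
    unfolding C_def by (rule sum_qf_L2_norm[OF X MW])
  obtain d where d: "0 < d" and small: "\<And>R. in_L2 M R \<Longrightarrow> L2_norm M R \<le> d \<Longrightarrow>
      (\<And>k. L2_norm M (V R (2 ^ k)) \<le> L2_norm M (V X (2 ^ k))) \<Longrightarrow> MW_summable R \<and> MW_norm R \<le> e"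
    using MW_norm_small[OF MW e] by metis
  have "eventually (\<lambda>N. 4 * C / sqrt (real N) < d / 2) sequentially"
    using d by (intro order_tendstoD(2)[OF divide_sqrt_tendsto_0]) auto
  then obtain N1 where N1: "\<And>N. N1 \<le> N \<Longrightarrow> 4 * C / sqrt (real N) < d / 2"
    by (auto simp: eventually_sequentially)
  show ?thesis
  proof (intro exI[of _ "max 1 N1"] conjI allI impI)
    fix N assume N: "max 1 N1 \<le> N"
    have "(\<lambda>J. real N * L2_norm M X / real J) \<longlonglongrightarrow> 0"
      by (rule lim_const_over_n)
    then have "eventually (\<lambda>J. real N * L2_norm M X / real J < d / 2) sequentially"
      using d by (intro order_tendstoD(2)) auto
    then show "eventually (\<lambda>J. MW_summable (\<lambda>y. X y - cobd (smooth X N J) y)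
      \<and> MW_norm (\<lambda>y. X y - cobd (smooth X N J) y) \<le> e) sequentially"
      using eventually_ge_at_top[of N]
    proof eventually_elim
      case (elim J)
      have N': "1 \<le> N" "N \<le> J" using N elim by auto
      let ?R = "\<lambda>y. X y - cobd (smooth X N J) y"
      have R: "in_L2 M ?R" by (intro in_L2_diff cobd_in_L2 smooth_in_L2 X)
      note eq = cobd_smooth[OF X N']
      show ?case
      proof (rule small[OF R])
        have "L2_norm M ?R = L2_norm M (\<lambda>x. \<Sum>k=N..J. cwt N J k * qf X k x)"
          by (rule L2_norm_cong_AE[OF eq]) (intro in_L2_borel R in_L2_sum in_L2_cmult qf_in_L2 X)+
        also have "\<dots> \<le> 4 * C / sqrt (real N) + real N * L2_norm M X / real J"
          by (rule cwt_sum_qf_L2_norm[OF X(1) N' C t])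
        also have "\<dots> \<le> d / 2 + d / 2"
          using N1[of N] N elim by (intro add_mono less_imp_le) simp_all
        also have "\<dots> = d" by simp
        finally show "L2_norm M ?R \<le> d" .
        show "L2_norm M (V ?R (2 ^ k)) \<le> L2_norm M (V X (2 ^ k))" for k
          by (rule V_convex_combination_L2_norm[OF X(1) R eq cwt_nonneg cwt_sum[OF N']])
      qed
    qed
  qed simp
qed

lemma MW_summable_of_powr:
  assumes X: "in_L2 M X"
    and sm: "summable (\<lambda>k. L2_norm M (V X (Suc k)) / real (Suc k) powr (3/2))"
  shows "MW_summable X"
  unfolding MW_summable_def
proof (rule dyadic_summable_of_subadditive[OF _ _ sm])
  fix m n
  have "L2_norm M (V X (m + n)) = L2_norm M (\<lambda>x. V X m x + E 0 (\<lambda>y. V X n (T (int m) y)) x)"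
    by (rule L2_norm_cong_AE[OF V_add[OF X]]) (intro in_L2_borel in_L2_add V_in_L2 E_in_L2 in_L2_shift X)+
  also have "\<dots> \<le> L2_norm M (V X m) + L2_norm M (E 0 (\<lambda>y. V X n (T (int m) y)))"
    by (intro L2_norm_add V_in_L2 E_in_L2 in_L2_shift X)
  also have "L2_norm M (E 0 (\<lambda>y. V X n (T (int m) y))) \<le> L2_norm M (\<lambda>y. V X n (T (int m) y))"
    by (intro E_L2_norm in_L2_shift V_in_L2 X)
  also have "\<dots> = L2_norm M (V X n)" by (intro L2_norm_shift V_in_L2 X)
  finally show "L2_norm M (V X (m + n)) \<le> L2_norm M (V X m) + L2_norm M (V X n)" by simp
qed simp

end

section \<open>The martingale approximation\<close>

lemma ennreal_divide_bound:
  assumes s: "0 < s" and b: "0 \<le> b" and le: "ennreal a \<le> ennreal s * U + ennreal b"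
  shows "ennreal (a / s) \<le> ennreal (b / s) + U"
proof -
  have "ennreal (a / s) = ennreal (1 / s) * ennreal a"
    using s by (simp add: ennreal_mult'[symmetric])
  also have "\<dots> \<le> ennreal (1 / s) * (ennreal s * U + ennreal b)"
    by (intro mult_left_mono le) simp
  also have "\<dots> = (ennreal (1 / s) * ennreal s) * U + ennreal (1 / s) * ennreal b"
    by (simp add: distrib_left mult.assoc)
  also have "ennreal (1 / s) * ennreal s = 1"
    using s by (simp add: ennreal_mult'[symmetric])
  also have "ennreal (1 / s) * ennreal b = ennreal (b / s)"
    using s by (simp add: ennreal_mult'[symmetric])
  finally show ?thesis by (simp add: add.commute)
qed

context stationary_system
begin

abbreviation proj_X :: "('a \<Rightarrow> real) \<Rightarrow> nat \<Rightarrow> 'a \<Rightarrow> real" where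
  "proj_X X k \<equiv> Proj M \<theta> F0 0 (stat_seq M \<theta> X (int k))"

lemma proj_X_in_L2: "in_L2 M X \<Longrightarrow> in_L2 M (proj_X X k)"
  unfolding Proj_def stat_seq_def by (intro in_L2_diff E_in_L2 in_L2_shift)

text \<open>At time -1 the tower property gives \<open>X\<close> composed with \<open>T k\<close>
  and \<open>Q^k X\<close> the same conditional expectation, so \<open>P0 (Q^k X)\<close> is the
  projection of \<open>X\<close> shifted by \<open>k\<close>.\<close>

lemma P0_sum_qf:
  assumes X: "in_L2 M X"
  shows "AE x in M. P0 (\<lambda>y. \<Sum>k\<in>I. c k * qf X k y) x = (\<Sum>k\<in>I. c k * proj_X X k x)"
proof -
  have "AE x in M. E (-1) (\<lambda>y. \<Sum>k\<in>I. c k * qf X k y) x = (\<Sum>k\<in>I. E (-1) (\<lambda>y. c k * qf X k y) x)"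
    by (intro E_sum in_L2_integrable in_L2_cmult qf_in_L2 X)
  moreover have "AE x in M. \<forall>k. E (-1) (\<lambda>y. c k * qf X k y) x = c k * E (-1) (qf X k) x"
    unfolding AE_all_countable by (intro allI E_cmult in_L2_integrable qf_in_L2 X)
  moreover have "AE x in M. \<forall>k. E (-1) (qf X k) x = E (-1) (\<lambda>y. X (T (int k) y)) x"
    unfolding AE_all_countable qf_def by (intro allI E_nested in_L2_integrable in_L2_shift X) simp
  ultimately show ?thesis
    by eventually_elim
      (simp add: P0_def Proj_def stat_seq_def qf_def right_diff_distrib sum_subtractf)
qed

lemma P0_smooth_tendsto:
  assumes X: "in_L2 M X"
    and Y: "\<And>n. L2_sums M (\<lambda>j x. proj_X X (n + j) x / (real (n + j) + 1)) (Y n)"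
  shows "(\<lambda>J. L2_norm M (\<lambda>x. P0 (smooth X N J) x - (\<Sum>n<N. Y n x))) \<longlonglongrightarrow> 0"
proof -
  define a where "a k x = proj_X X k x / (real k + 1)" for k x
  have a_L2: "in_L2 M (a k)" for k unfolding a_def[abs_def] by (intro in_L2_divide proj_X_in_L2 X)
  have Y_L2: "in_L2 M (Y n)" for n using Y[of n] by (simp add: L2_sums_def)
  have lim: "(\<lambda>J. L2_norm M (\<lambda>x. (\<Sum>j<J. a (n + j) x) - Y n x)) \<longlonglongrightarrow> 0" for n
    using Y[of n] by (simp add: L2_sums_def a_def)
  have le: "L2_norm M (\<lambda>x. P0 (smooth X N J) x - (\<Sum>n<N. Y n x))
      \<le> (\<Sum>n<N. L2_norm M (\<lambda>x. (\<Sum>j<J - n. a (n + j) x) - Y n x))" for J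
  proof -
    have "AE x in M. P0 (smooth X N J) x = (\<Sum>n<N. \<Sum>j<J - n. a (n + j) x)"
      using P0_sum_qf[OF X, where I = "{..<J}" and c = "wt N"]
    proof eventually_elim
      case (elim x)
      have "P0 (smooth X N J) x = (\<Sum>k<J. wt N k * proj_X X k x)"
        using elim by (simp add: smooth_def[abs_def])
      also have "\<dots> = (\<Sum>k<J. real (min N (Suc k)) * a k x)"
        by (intro sum.cong refl) (simp add: wt_def a_def add.commute)
      also have "\<dots> = (\<Sum>n<N. \<Sum>j<J - n. a (n + j) x)"
        by (rule sum_wt_rearrange)
      finally show ?case .
    qed
    then have "L2_norm M (\<lambda>x. P0 (smooth X N J) x - (\<Sum>n<N. Y n x))
      = L2_norm M (\<lambda>x. \<Sum>n<N. ((\<Sum>j<J - n. a (n + j) x) - Y n x))"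
      by (intro L2_norm_cong_AE in_L2_borel in_L2_sum in_L2_diff P0_in_L2 smooth_in_L2 X a_L2 Y_L2)
        (auto simp: sum_subtractf)
    also have "\<dots> \<le> (\<Sum>n<N. L2_norm M (\<lambda>x. (\<Sum>j<J - n. a (n + j) x) - Y n x))"
      by (intro L2_norm_sum in_L2_diff in_L2_sum a_L2 Y_L2)
    finally show ?thesis .
  qed
  \<comment> \<open>Cutting at \<open>k = n + j < J\<close> ends the \<open>n\<close>-th inner sum
    at \<open>J - n\<close>; for each of the finitely many \<open>n\<close> this still tends to
    infinity.\<close>
  have sub: "filterlim (\<lambda>J. J - n) sequentially sequentially" for n :: nat
    unfolding filterlim_at_top
  proof
    fix Z show "\<forall>\<^sub>F J in sequentially. Z \<le> J - n"
      using eventually_ge_at_top[of "Z + n"] by eventually_elim simp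
  qed
  have "(\<lambda>J. \<Sum>n<N. L2_norm M (\<lambda>x. (\<Sum>j<J - n. a (n + j) x) - Y n x)) \<longlonglongrightarrow> (\<Sum>n<N. 0)"
    by (intro tendsto_sum filterlim_compose[OF lim sub])
  then have up: "(\<lambda>J. \<Sum>n<N. L2_norm M (\<lambda>x. (\<Sum>j<J - n. a (n + j) x) - Y n x)) \<longlonglongrightarrow> 0"
    by simp
  show ?thesis
    by (rule real_tendsto_sandwich[OF _ _ tendsto_const up]) (auto intro!: always_eventually le)
qed

text \<open>A difference of partial sums is \<open>P0\<close> of a harmonic sum of
  \<open>Q^k X\<close>. As \<open>P0\<close> is a contraction, the uniform bound of
  \<open>harmonic_sum_qf_L2_norm\<close> gives the Cauchy property.\<close>

lemma inner_series_L2: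
  assumes X: "in_L2 M X" "X \<in> borel_measurable (\<F> 0)" and MW: "MW_summable X"
  shows "\<exists>Y. L2_sums M (\<lambda>j x. proj_X X (n + j) x / (real (n + j) + 1)) Y"
proof -
  define C where "C = L2_norm M X + 2 * MW_norm X"
  have C: "0 \<le> C" using MW_norm_nonneg[OF MW] by (simp add: C_def)
  have t: "L2_norm M (\<lambda>x. \<Sum>i<m. qf X i x) \<le> C * sqrt (real m)" for m
    unfolding C_def by (rule sum_qf_L2_norm[OF X MW])
  define a where "a j x = proj_X X (n + j) x / (real (n + j) + 1)" for j x
  have a_L2: "in_L2 M (a j)" for j unfolding a_def[abs_def] by (intro in_L2_divide proj_X_in_L2 X)
  define f where "f J x = (\<Sum>j<J. a j x)" for J x
  have f_L2: "in_L2 M (f J)" for J unfolding f_def[abs_def] by (intro in_L2_sum a_L2)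
  have diff: "L2_norm M (\<lambda>x. f J' x - f J x) \<le> 4 * C / sqrt (real J)" if J: "1 \<le> J" "J \<le> J'" for J J'
  proof -
    let ?H = "\<lambda>x. \<Sum>k=n + J..<n + J'. 1 / real (Suc k) * qf X k x"
    have H: "in_L2 M ?H" by (intro in_L2_sum in_L2_cmult qf_in_L2 X)
    have f_eq: "f J' x - f J x = (\<Sum>k=n + J..<n + J'. 1 / real (Suc k) * proj_X X k x)" for x
    proof -
      have "f J' x = f J x + (\<Sum>j=J..<J'. a j x)"
        unfolding f_def using J by (metis lessThan_atLeast0 sum.atLeastLessThan_concat zero_le)
      also have "(\<Sum>j=J..<J'. a j x) = (\<Sum>k=n + J..<n + J'. 1 / real (Suc k) * proj_X X k x)"
        by (rule sum.reindex_bij_witness[of _ "\<lambda>k. k - n" "\<lambda>j. n + j"]) (auto simp: a_def add.commute)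
      finally show ?thesis by simp
    qed
    have "L2_norm M (\<lambda>x. f J' x - f J x) = L2_norm M (P0 ?H)"
    proof (rule L2_norm_cong_AE)
      show "AE x in M. f J' x - f J x = P0 ?H x"
        using P0_sum_qf[OF X(1), where I = "{n + J..<n + J'}" and c = "\<lambda>k. 1 / real (Suc k)"]
        by eventually_elim (simp only: f_eq)
    qed (intro in_L2_borel in_L2_diff f_L2 P0_in_L2 H)+
    also have "\<dots> \<le> L2_norm M ?H" by (rule P0_L2_norm_le[OF H])
    also have "\<dots> \<le> 4 * C / sqrt (real (n + J))"
      by (rule harmonic_sum_qf_L2_norm[OF X(1) _ _ C t]) (use J in auto)
    also have "\<dots> \<le> 4 * C / sqrt (real J)" using J C by (intro divide_left_mono) auto
    finally show ?thesis .
  qed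
  have "\<exists>g. in_L2 M g \<and> (\<lambda>J. L2_norm M (\<lambda>x. f J x - g x)) \<longlonglongrightarrow> 0"
  proof (rule L2_complete[OF f_L2])
    fix e :: real assume e: "0 < e"
    have "eventually (\<lambda>N. 4 * C / sqrt (real N) < e) sequentially"
      using e by (intro order_tendstoD(2)[OF divide_sqrt_tendsto_0]) auto
    then obtain N where N: "\<And>J. N \<le> J \<Longrightarrow> 4 * C / sqrt (real J) < e"
      by (auto simp: eventually_sequentially)
    show "\<exists>N. \<forall>m\<ge>N. \<forall>k\<ge>N. L2_norm M (\<lambda>x. f m x - f k x) \<le> e"
    proof (intro exI[of _ "max 1 N"] allI impI)
      fix m k assume mk: "max 1 N \<le> m" "max 1 N \<le> k"
      show "L2_norm M (\<lambda>x. f m x - f k x) \<le> e"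
      proof (cases "k \<le> m")
        case True
        then show ?thesis using diff[of k m] N[of k] mk by simp
      next
        case False
        then show ?thesis using diff[of m k] N[of m] mk by (simp add: L2_norm_minus_commute[of M "f m" "f k"])
      qed
    qed
  qed
  then show ?thesis using a_L2 by (auto simp: L2_sums_def f_def a_def[abs_def])
qed

text \<open>The outer partial sums are limits of \<open>P0 (smooth X N J)\<close>, whose mutual
  distances are bounded by the \<open>MW_norm\<close> of the remainders; these are small once
  \<open>N\<close> is large.\<close>

lemma mart_increment_exists:
  assumes X: "in_L2 M X" "X \<in> borel_measurable (\<F> 0)" and MW: "MW_summable X"
  shows "\<exists>D. is_mart_increment M \<theta> F0 X D"
proof -
  have "\<forall>n. \<exists>Y. L2_sums M (\<lambda>j x. proj_X X (n + j) x / (real (n + j) + 1)) Y"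
    by (intro allI inner_series_L2 X MW)
  from choice[OF this] obtain Y
    where Y: "\<And>n. L2_sums M (\<lambda>j x. proj_X X (n + j) x / (real (n + j) + 1)) (Y n)" by blast
  have Y_L2: "in_L2 M (Y n)" for n using Y[of n] by (simp add: L2_sums_def)
  define K where "K N x = (\<Sum>n<N. Y n x)" for N x
  have K_L2: "in_L2 M (K N)" for N unfolding K_def[abs_def] by (intro in_L2_sum Y_L2)
  have "\<exists>g. in_L2 M g \<and> (\<lambda>N. L2_norm M (\<lambda>x. K N x - g x)) \<longlonglongrightarrow> 0"
  proof (rule L2_complete[OF K_L2])
    fix e :: real assume e: "0 < e"
    then obtain N0 where N0: "\<And>N. N0 \<le> N \<Longrightarrow> eventually (\<lambda>J. MW_summable (\<lambda>y. X y - cobd (smooth X N J) y)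
      \<and> MW_norm (\<lambda>y. X y - cobd (smooth X N J) y) \<le> e / 8) sequentially"
      using smooth_MW_small[OF X MW, of "e / 8"] by auto
    have close: "eventually (\<lambda>J. L2_norm M (\<lambda>x. P0 (smooth X N J) x - K N x) < e / 4) sequentially" for N
      unfolding K_def using P0_smooth_tendsto[OF X(1) Y, of N] e by (intro order_tendstoD(2)) auto
    show "\<exists>N. \<forall>m\<ge>N. \<forall>n\<ge>N. L2_norm M (\<lambda>x. K m x - K n x) \<le> e"
    proof (intro exI[of _ N0] allI impI)
      fix m n assume mn: "N0 \<le> m" "N0 \<le> n"
      \<comment> \<open>One \<open>J\<close> serves both \<open>m\<close> and \<open>n\<close>. The
        budget is \<open>2 (e / 8 + e / 8)\<close> for the distance of the projections and
        \<open>e / 4\<close> for each limit.\<close>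
      from eventually_conj[OF eventually_conj[OF N0[OF mn(1)] N0[OF mn(2)]] eventually_conj[OF close[of m] close[of n]]]
      obtain J where MWm: "MW_summable (\<lambda>y. X y - cobd (smooth X m J) y)" "MW_norm (\<lambda>y. X y - cobd (smooth X m J) y) \<le> e / 8"
        and MWn: "MW_summable (\<lambda>y. X y - cobd (smooth X n J) y)" "MW_norm (\<lambda>y. X y - cobd (smooth X n J) y) \<le> e / 8"
        and Km: "L2_norm M (\<lambda>x. P0 (smooth X m J) x - K m x) < e / 4"
        and Kn: "L2_norm M (\<lambda>x. P0 (smooth X n J) x - K n x) < e / 4"
        by (auto simp: eventually_sequentially)
      note P = P0_in_L2[OF smooth_in_L2[OF X(1)]]
      have "L2_norm M (\<lambda>x. P0 (smooth X m J) x - P0 (smooth X n J) x)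
          \<le> 2 * (MW_norm (\<lambda>y. X y - cobd (smooth X m J) y) + MW_norm (\<lambda>y. X y - cobd (smooth X n J) y))"
        by (rule P0_diff_le_MW_norm[OF smooth_in_L2[OF X(1)] smooth_measurable smooth_in_L2[OF X(1)] smooth_measurable X MWm(1) MWn(1)])
      then have PP: "L2_norm M (\<lambda>x. P0 (smooth X m J) x - P0 (smooth X n J) x) \<le> e / 2"
        using MWm(2) MWn(2) by simp
      have "L2_norm M (\<lambda>x. K m x - K n x) \<le> L2_norm M (\<lambda>x. K m x - P0 (smooth X m J) x)
          + L2_norm M (\<lambda>x. P0 (smooth X m J) x - K n x)"
        by (intro L2_norm_diff_triangle K_L2 P)
      also have "L2_norm M (\<lambda>x. P0 (smooth X m J) x - K n x)
        \<le> L2_norm M (\<lambda>x. P0 (smooth X m J) x - P0 (smooth X n J) x) + L2_norm M (\<lambda>x. P0 (smooth X n J) x - K n x)"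
        by (intro L2_norm_diff_triangle K_L2 P)
      finally show "L2_norm M (\<lambda>x. K m x - K n x) \<le> e"
        using PP Km Kn by (simp add: L2_norm_minus_commute[of M "K m"])
    qed
  qed
  then obtain D where "in_L2 M D" "(\<lambda>N. L2_norm M (\<lambda>x. K N x - D x)) \<longlonglongrightarrow> 0" by blast
  then have "L2_sums M Y D" using Y_L2 by (simp add: L2_sums_def K_def)
  then show ?thesis using Y unfolding is_mart_increment_def by blast
qed

text \<open>A single \<open>smooth X N J\<close> serves both purposes: its projection is close to
  \<open>D\<close>, and its coboundary leaves a small remainder.\<close>

lemma mart_increment_approx:
  assumes X: "in_L2 M X" "X \<in> borel_measurable (\<F> 0)" and MW: "MW_summable X"
    and D: "is_mart_increment M \<theta> F0 X D" and e: "0 < e"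
  shows "\<exists>H. in_L2 M H \<and> H \<in> borel_measurable (\<F> 0) \<and> L2_norm M (\<lambda>x. P0 H x - D x) \<le> e
    \<and> MW_summable (\<lambda>y. X y - cobd H y) \<and> MW_norm (\<lambda>y. X y - cobd H y) \<le> e"
proof -
  obtain Y where Y: "\<And>n. L2_sums M (\<lambda>j x. proj_X X (n + j) x / (real (n + j) + 1)) (Y n)"
    and YD: "L2_sums M Y D" using D unfolding is_mart_increment_def by blast
  have L2: "in_L2 M (Y n)" "in_L2 M D" for n using YD by (auto simp: L2_sums_def)
  obtain N0 where N0: "\<And>N. N0 \<le> N \<Longrightarrow> eventually (\<lambda>J. MW_summable (\<lambda>y. X y - cobd (smooth X N J) y)
    \<and> MW_norm (\<lambda>y. X y - cobd (smooth X N J) y) \<le> e) sequentially"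
    using smooth_MW_small[OF X MW e] by auto
  have "(\<lambda>N. L2_norm M (\<lambda>x. (\<Sum>n<N. Y n x) - D x)) \<longlonglongrightarrow> 0" using YD by (simp add: L2_sums_def)
  then have "eventually (\<lambda>N. L2_norm M (\<lambda>x. (\<Sum>n<N. Y n x) - D x) < e / 2) sequentially"
    using e by (intro order_tendstoD(2)) auto
  then obtain N1 where N1: "\<And>N. N1 \<le> N \<Longrightarrow> L2_norm M (\<lambda>x. (\<Sum>n<N. Y n x) - D x) < e / 2"
    by (auto simp: eventually_sequentially)
  define N where "N = max N0 N1"
  have "eventually (\<lambda>J. L2_norm M (\<lambda>x. P0 (smooth X N J) x - (\<Sum>n<N. Y n x)) < e / 2) sequentially"
    using P0_smooth_tendsto[OF X(1) Y, of N] e by (intro order_tendstoD(2)) auto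
  from eventually_conj[OF this N0[of N]]
  obtain J where J: "L2_norm M (\<lambda>x. P0 (smooth X N J) x - (\<Sum>n<N. Y n x)) < e / 2"
    "MW_summable (\<lambda>y. X y - cobd (smooth X N J) y)" "MW_norm (\<lambda>y. X y - cobd (smooth X N J) y) \<le> e"
    by (auto simp: eventually_sequentially N_def)
  have "L2_norm M (\<lambda>x. P0 (smooth X N J) x - D x)
    \<le> L2_norm M (\<lambda>x. P0 (smooth X N J) x - (\<Sum>n<N. Y n x)) + L2_norm M (\<lambda>x. (\<Sum>n<N. Y n x) - D x)"
    by (intro L2_norm_diff_triangle P0_in_L2 smooth_in_L2 X in_L2_sum L2)
  also have "\<dots> \<le> e" using J(1) N1[of N] by (simp add: N_def)
  finally show ?thesis using J(2,3) smooth_in_L2[OF X(1)] smooth_measurable by blast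
qed

lemma small_imp_AE_zero:
  assumes "in_L2 M f" "\<And>e. 0 < e \<Longrightarrow> L2_norm M f \<le> e"
  shows "AE x in M. f x = 0"
proof -
  have "L2_norm M f \<le> 0" by (rule field_le_epsilon) (use assms(2) in auto)
  then have "L2_norm M f = 0" using L2_norm_nonneg[of M f] by linarith
  then show ?thesis by (rule L2_norm_zero_imp_AE[OF assms(1)])
qed

text \<open>\<open>D\<close> is only determined almost surely and need not be \<open>\<F> 0\<close>-measurable; \<open>E 0 D\<close> is a
  version of it which is.\<close>

lemma mart_increment_version:
  assumes X: "in_L2 M X" "X \<in> borel_measurable (\<F> 0)" and MW: "MW_summable X"
    and D: "is_mart_increment M \<theta> F0 X D"
  shows "AE x in M. D x = E 0 D x" and "AE x in M. E (-1) (E 0 D) x = 0"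
    and "\<And>e. 0 < e \<Longrightarrow> \<exists>H. in_L2 M H \<and> H \<in> borel_measurable (\<F> 0) \<and> L2_norm M (\<lambda>x. P0 H x - E 0 D x) \<le> e
      \<and> MW_summable (\<lambda>y. X y - cobd H y) \<and> MW_norm (\<lambda>y. X y - cobd H y) \<le> e"
proof -
  have DL: "in_L2 M D" using D by (auto simp: is_mart_increment_def L2_sums_def)
  have DL': "in_L2 M (E 0 D)" by (rule E_in_L2[OF DL])
  \<comment> \<open>\<open>E 0\<close> fixes the \<open>\<F> 0\<close>-measurable
    \<open>P0 H\<close> and is a contraction, so approximations of \<open>D\<close> approximate its
    version at least as well.\<close>
  have E0: "L2_norm M (\<lambda>x. P0 H x - E 0 D x) \<le> L2_norm M (\<lambda>x. P0 H x - D x)"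
    if H: "in_L2 M H" "H \<in> borel_measurable (\<F> 0)" for H
  proof -
    note P = P0_in_L2[OF H(1)]
    have "AE x in M. E 0 (\<lambda>y. P0 H y - D y) x = E 0 (P0 H) x - E 0 D x"
      by (intro E_diff in_L2_integrable P DL)
    moreover have "AE x in M. E 0 (P0 H) x = P0 H x"
      by (intro E_F_meas in_L2_integrable P P0_measurable H)
    ultimately have "AE x in M. P0 H x - E 0 D x = E 0 (\<lambda>y. P0 H y - D y) x"
      by eventually_elim simp
    then have "L2_norm M (\<lambda>x. P0 H x - E 0 D x) = L2_norm M (E 0 (\<lambda>y. P0 H y - D y))"
      by (rule L2_norm_cong_AE) (intro in_L2_borel in_L2_diff E_in_L2 P DL)+
    also have "\<dots> \<le> L2_norm M (\<lambda>y. P0 H y - D y)" by (intro E_L2_norm in_L2_diff P DL)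
    finally show ?thesis .
  qed
  show approx: "\<exists>H. in_L2 M H \<and> H \<in> borel_measurable (\<F> 0) \<and> L2_norm M (\<lambda>x. P0 H x - E 0 D x) \<le> e
      \<and> MW_summable (\<lambda>y. X y - cobd H y) \<and> MW_norm (\<lambda>y. X y - cobd H y) \<le> e" if "0 < e" for e
    using mart_increment_approx[OF X MW D that] E0 by (meson order_trans)
  have "AE x in M. D x - E 0 D x = 0"
  proof (rule small_imp_AE_zero)
    fix e :: real assume "0 < e"
    then obtain H where H: "in_L2 M H" "H \<in> borel_measurable (\<F> 0)" "L2_norm M (\<lambda>x. P0 H x - D x) \<le> e / 2"
      using mart_increment_approx[OF X MW D, of "e / 2"] by auto
    have "L2_norm M (\<lambda>x. D x - E 0 D x) \<le> L2_norm M (\<lambda>x. D x - P0 H x) + L2_norm M (\<lambda>x. P0 H x - E 0 D x)"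
      by (intro L2_norm_diff_triangle DL DL' P0_in_L2 H)
    then show "L2_norm M (\<lambda>x. D x - E 0 D x) \<le> e"
      using H(3) E0[OF H(1,2)] by (simp add: L2_norm_minus_commute[of M D])
  qed (intro in_L2_diff DL DL')
  then show "AE x in M. D x = E 0 D x" by simp
  \<comment> \<open>Conditioning at time -1 annihilates every \<open>P0 H\<close> and hence leaves
    only the approximation error, which is arbitrarily small.\<close>
  show "AE x in M. E (-1) (E 0 D) x = 0"
  proof (rule small_imp_AE_zero[OF E_in_L2[OF DL']])
    fix e :: real assume "0 < e"
    from approx[OF this] obtain H where H: "in_L2 M H" "H \<in> borel_measurable (\<F> 0)"
      "L2_norm M (\<lambda>x. P0 H x - E 0 D x) \<le> e" by blast
    note P = P0_in_L2[OF H(1)]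
    have "AE x in M. E (-1) (\<lambda>y. P0 H y - E 0 D y) x = E (-1) (P0 H) x - E (-1) (E 0 D) x"
      by (intro E_diff in_L2_integrable P DL')
    with E_minus1_P0[OF H(1)] have "AE x in M. E (-1) (E 0 D) x = -1 * E (-1) (\<lambda>y. P0 H y - E 0 D y) x"
      by eventually_elim simp
    then have "L2_norm M (E (-1) (E 0 D)) = L2_norm M (\<lambda>x. -1 * E (-1) (\<lambda>y. P0 H y - E 0 D y) x)"
      by (rule L2_norm_cong_AE) auto
    also have "\<dots> = L2_norm M (E (-1) (\<lambda>y. P0 H y - E 0 D y))" by (subst L2_norm_cmult) simp
    also have "\<dots> \<le> L2_norm M (\<lambda>y. P0 H y - E 0 D y)" by (intro E_L2_norm in_L2_diff P DL')
    finally show "L2_norm M (E (-1) (E 0 D)) \<le> e" using H(3) by simp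
  qed
qed

text \<open>For fixed \<open>H\<close> the remainder and the martingale with increment
  \<open>P0 H - D\<close> do not vanish after division by \<open>sqrt n\<close>; they are only
  bounded by maximal functions of small integral. Letting \<open>H\<close> vary with
  \<open>e\<close> removes them.\<close>

lemma quenched_martingale_approximation:
  assumes X: "in_L2 M X" "X \<in> borel_measurable (\<F> 0)"
    and D: "in_L2 M D" "D \<in> borel_measurable (\<F> 0)" "AE x in M. E (-1) D x = 0"
    and approx: "\<And>e. 0 < e \<Longrightarrow> \<exists>H. in_L2 M H \<and> H \<in> borel_measurable (\<F> 0) \<and> L2_norm M (\<lambda>x. P0 H x - D x) \<le> e
      \<and> MW_summable (\<lambda>y. X y - cobd H y) \<and> MW_norm (\<lambda>y. X y - cobd H y) \<le> e"
  shows "AE x in M. (\<lambda>n. E 0 (\<lambda>y. (S X n y - S D n y)\<^sup>2) x / real n) \<longlonglongrightarrow> 0"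
proof -
  define f where "f n x = ennreal (sqrt (E 0 (\<lambda>y. (S X n y - S D n y)\<^sup>2) x) / sqrt (real n))" for n x
  have "AE x in M. (\<lambda>n. f n x) \<longlonglongrightarrow> 0"
  proof (rule AE_tendsto_zero_of_small_bounds)
    show "f n \<in> borel_measurable M" for n unfolding f_def[abs_def] by measurable
    fix e :: real assume e: "0 < e"
    \<comment> \<open>The budget is \<open>6 d\<close> for \<open>S_maxfun\<close>, \<open>d\<close>
      for the truncated boundary term, and \<open>2 * 3 d\<close> for the martingale error.\<close>
    define d where "d = e / 13"
    have d: "0 < d" using e by (simp add: d_def)
    from approx[OF d] obtain H where H: "in_L2 M H" "H \<in> borel_measurable (\<F> 0)"
      and PD: "L2_norm M (\<lambda>x. P0 H x - D x) \<le> d"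
      and MW: "MW_summable (\<lambda>y. X y - cobd H y)" "MW_norm (\<lambda>y. X y - cobd H y) \<le> d" by blast
    define R where "R y = X y - cobd H y" for y
    define W where "W y = P0 H y - D y" for y
    define QH where "QH = E 0 (\<lambda>z. H (T 1 z))"
    have R: "in_L2 M R" "R \<in> borel_measurable (\<F> 0)"
      unfolding R_def[abs_def] using X H
      by (auto intro!: in_L2_diff cobd_in_L2 borel_measurable_diff cobd_measurable)
    have W: "in_L2 M W" "W \<in> borel_measurable (\<F> 0)"
      unfolding W_def[abs_def] using D H
      by (auto intro!: in_L2_diff P0_in_L2 borel_measurable_diff P0_measurable)
    have QH_L2: "in_L2 M QH" unfolding QH_def by (intro E_in_L2 in_L2_shift H)
    have QH_meas: "(\<lambda>y. (QH y)\<^sup>2) \<in> borel_measurable (\<F> 0)" unfolding QH_def by measurable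
    obtain Ug c where c: "0 \<le> c" and Ug [measurable]: "Ug \<in> borel_measurable M"
      and Ug_int: "(\<integral>\<^sup>+x. Ug x \<partial>M) \<le> ennreal d"
      and Ug_le: "\<And>n. 0 < n \<Longrightarrow> AE x in M. ennreal (sqrt (E 0 (\<lambda>y. (QH (T (int n) y))\<^sup>2) x)) \<le> ennreal c + ennreal (sqrt (real n)) * Ug x"
      using E_shift_truncation_bound[OF in_L2_sq[OF QH_L2] QH_meas _ d] by auto
    define U where "U x = S_maxfun R x + Ug x + 2 * maxfun 1 (\<lambda>y. (W y)\<^sup>2) x" for x
    have "(\<integral>\<^sup>+x. U x \<partial>M) = (\<integral>\<^sup>+x. S_maxfun R x \<partial>M) + (\<integral>\<^sup>+x. Ug x \<partial>M) + 2 * (\<integral>\<^sup>+x. maxfun 1 (\<lambda>y. (W y)\<^sup>2) x \<partial>M)"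
      unfolding U_def by (simp add: nn_integral_add nn_integral_cmult)
    also have "\<dots> \<le> ennreal (6 * d) + ennreal d + 2 * ennreal (3 * d)"
    proof (intro add_mono mult_left_mono Ug_int)
      show "(\<integral>\<^sup>+x. S_maxfun R x \<partial>M) \<le> ennreal (6 * d)"
        using MW by (intro order_trans[OF S_maxfun_nn_integral[OF R]] ennreal_leI) (simp_all add: R_def[abs_def])
      have "sqrt (\<integral>x. (W x)\<^sup>2 \<partial>M) \<le> d" using PD by (simp add: L2_norm_def W_def)
      then show "(\<integral>\<^sup>+x. maxfun 1 (\<lambda>y. (W y)\<^sup>2) x \<partial>M) \<le> ennreal (3 * d)"
        using W by (intro order_trans[OF maxfun_nn_integral] ennreal_leI) (auto simp: in_L2_sq)
    qed simp
    also have "2 * ennreal (3 * d) = ennreal (6 * d)" using d ennreal_mult[of 2 "3 * d"] by simp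
    also have "ennreal (6 * d) + ennreal d + ennreal (6 * d) = ennreal e"
      using d by (simp add: ennreal_plus[symmetric] d_def del: ennreal_plus)
    finally have U_int: "(\<integral>\<^sup>+x. U x \<partial>M) \<le> ennreal e" .
    \<comment> \<open>The boundary value at time 0 is a number depending only on \<open>x\<close>;
      with the truncation constant \<open>c\<close> it forms the part that vanishes like
      \<open>1 / sqrt n\<close>.\<close>
    have bd: "AE x in M. f n x \<le> ennreal ((\<bar>QH x\<bar> + c) / sqrt (real n)) + U x" if n: "0 < n" for n
      using martingale_approximation_bound[OF X H D n] Ug_le[OF n]
    proof eventually_elim
      case (elim x)
      let ?s = "ennreal (sqrt (real n))"
      have "ennreal (sqrt (E 0 (\<lambda>y. (S X n y - S D n y)\<^sup>2) x))
        \<le> ?s * S_maxfun R x + ennreal \<bar>QH x\<bar>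
          + ennreal (sqrt (E 0 (\<lambda>y. (QH (T (int n) y))\<^sup>2) x)) + ?s * (2 * maxfun 1 (\<lambda>y. (W y)\<^sup>2) x)"
        using elim(1) by (simp add: R_def[abs_def] QH_def W_def[abs_def])
      also have "\<dots> \<le> ?s * S_maxfun R x + ennreal \<bar>QH x\<bar>
          + (ennreal c + ?s * Ug x) + ?s * (2 * maxfun 1 (\<lambda>y. (W y)\<^sup>2) x)"
        by (intro add_mono order_refl elim(2))
      also have "\<dots> = ?s * U x + (ennreal \<bar>QH x\<bar> + ennreal c)"
        unfolding U_def by (simp only: distrib_left add.assoc add.commute add.left_commute)
      also have "ennreal \<bar>QH x\<bar> + ennreal c = ennreal (\<bar>QH x\<bar> + c)" using c by simp
      finally show ?case unfolding f_def using n c by (intro ennreal_divide_bound) auto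
    qed
    show "\<exists>U c. U \<in> borel_measurable M \<and> (\<integral>\<^sup>+x. U x \<partial>M) \<le> ennreal e
      \<and> (\<forall>n>0. AE x in M. f n x \<le> ennreal (c x / sqrt (real n)) + U x)"
    proof (intro exI conjI allI impI)
      show "U \<in> borel_measurable M" unfolding U_def[abs_def] by measurable
    qed (rule U_int, rule bd)
  qed
  moreover have "AE x in M. \<forall>n. 0 \<le> E 0 (\<lambda>y. (S X n y - S D n y)\<^sup>2) x"
    unfolding AE_all_countable
    by (intro allI E_nonneg borel_measurable_power in_L2_borel in_L2_diff S_in_L2 X D) auto
  ultimately show ?thesis
  proof eventually_elim
    case (elim x)
    let ?q = "\<lambda>n. sqrt (E 0 (\<lambda>y. (S X n y - S D n y)\<^sup>2) x) / sqrt (real n)"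
    have "?q \<longlonglongrightarrow> 0"
      using elim by (subst tendsto_ennreal_iff[symmetric]) (auto simp: f_def)
    then have "(\<lambda>n. (?q n)\<^sup>2) \<longlonglongrightarrow> 0\<^sup>2" by (rule tendsto_power)
    \<comment> \<open>At \<open>n = 0\<close> both sides are 0, division by 0 being 0.\<close>
    moreover have "(?q n)\<^sup>2 = E 0 (\<lambda>y. (S X n y - S D n y)\<^sup>2) x / real n" for n
      using elim(2) by (simp add: power_divide)
    ultimately show ?case by simp
  qed
qed

text \<open>Each shifted increment has conditional mean 0 one step before its own time, and the
  tower property carries this down to time 0.\<close>

lemma E_S_martingale:
  assumes D: "in_L2 M D" "AE x in M. E (-1) D x = 0"
  shows "AE x in M. E 0 (S D n) x = 0"
proof -
  have i: "integrable M (\<lambda>y. D (T k y))" for k by (intro in_L2_integrable in_L2_shift D)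
  have "AE x in M. E 0 (\<lambda>y. D (T (int j + 1) y)) x = 0" for j
  proof -
    have "AE x in M. E (int j + 1 + -1) (\<lambda>y. D (T (int j + 1) y)) x = E (-1) D (T (int j + 1) x)"
      by (rule E_shift) (rule in_L2_integrable[OF D(1)])
    moreover have "AE x in M. E (-1) D (T (int j + 1) x) = 0" by (rule AE_shift[OF D(2)])
    ultimately have "AE x in M. E (int j) (\<lambda>y. D (T (int j + 1) y)) x = 0"
      by eventually_elim simp
    then have "AE x in M. E 0 (E (int j) (\<lambda>y. D (T (int j + 1) y))) x = E 0 (\<lambda>y. 0) x"
      by (rule E_cong) auto
    moreover have "AE x in M. E 0 (\<lambda>y. 0) x = 0" by (rule E_F_meas) auto
    moreover have "AE x in M. E 0 (E (int j) (\<lambda>y. D (T (int j + 1) y))) x = E 0 (\<lambda>y. D (T (int j + 1) y)) x"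
      by (rule E_nested[OF _ i]) simp
    ultimately show ?thesis by eventually_elim simp
  qed
  then have "AE x in M. \<forall>j::nat. E 0 (\<lambda>y. D (T (int j + 1) y)) x = 0"
    by (simp add: AE_all_countable)
  moreover have "AE x in M. E 0 (\<lambda>y. \<Sum>j<n. D (T (int j + 1) y)) x = (\<Sum>j<n. E 0 (\<lambda>y. D (T (int j + 1) y)) x)"
    by (rule E_sum) (rule i)
  ultimately show ?thesis by eventually_elim (simp add: S_def[abs_def])
qed

end

section \<open>Little-o consequences and the conclusion\<close>

lemma smallo_of_dominated:
  fixes a b :: "nat \<Rightarrow> real"
  assumes "(\<lambda>n. b n / real n) \<longlonglongrightarrow> 0" "\<And>n. 0 \<le> a n" "\<And>n. a n \<le> b n"
  shows "a \<in> o(\<lambda>n. real n)"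
proof (rule smalloI_tendsto)
  show "(\<lambda>n. a n / real n) \<longlonglongrightarrow> 0"
    by (rule tendsto_sandwich[OF _ _ tendsto_const assms(1)])
      (auto intro!: always_eventually divide_right_mono divide_nonneg_nonneg assms)
  show "\<forall>\<^sub>F n in sequentially. real n \<noteq> 0"
    using eventually_gt_at_top[of 0] by eventually_elim simp
qed

lemma smallo_sqrt_of_power2:
  fixes a :: "nat \<Rightarrow> real"
  assumes "(\<lambda>n. (a n)\<^sup>2) \<in> o(\<lambda>n. real n)"
  shows "a \<in> o(\<lambda>n. sqrt (real n))"
proof (rule smalloI_tendsto)
  have "(\<lambda>n. (a n)\<^sup>2 / real n) \<longlonglongrightarrow> 0" by (rule smalloD_tendsto[OF assms])
  then have "(\<lambda>n. sqrt ((a n)\<^sup>2 / real n)) \<longlonglongrightarrow> sqrt 0" by (rule tendsto_real_sqrt)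
  moreover have "sqrt ((a n)\<^sup>2 / real n) = \<bar>a n / sqrt (real n)\<bar>" for n
    by (simp add: real_sqrt_divide)
  ultimately have "(\<lambda>n. \<bar>a n / sqrt (real n)\<bar>) \<longlonglongrightarrow> 0" by (simp only: real_sqrt_zero)
  then show "(\<lambda>n. a n / sqrt (real n)) \<longlonglongrightarrow> 0" by (rule tendsto_rabs_zero_cancel)
  show "\<forall>\<^sub>F n in sequentially. sqrt (real n) \<noteq> 0"
    using eventually_gt_at_top[of 0] by eventually_elim simp
qed

theorem proposition4p8:
  fixes M :: "'a measure" and \<theta> :: "'a \<Rightarrow> 'a" and F0 :: "'a measure" and X0 :: "'a \<Rightarrow> real"
  assumes "prob_space M"
    and "bimeasurable_preserving M \<theta>"
    and "subalgebra M F0"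
    and "sets F0 \<subseteq> sets (vimage_algebra (space M) \<theta> F0)"
    and "X0 \<in> borel_measurable F0"
    and "in_L2 M X0"
    and "integral\<^sup>L M X0 = 0"
    and "summable (\<lambda>k. L2_norm M (cexp M \<theta> F0 0 (psum M \<theta> X0 (Suc k))) / real (Suc k) powr (3/2))"
  shows "(\<exists>D. is_mart_increment M \<theta> F0 X0 D) \<and>
    (\<forall>D. is_mart_increment M \<theta> F0 X0 D \<longrightarrow>
      (AE x in M. (\<lambda>n. cexp M \<theta> F0 0
          (\<lambda>y. (psum M \<theta> X0 n y - psum M \<theta> D n y - cexp M \<theta> F0 0 (psum M \<theta> X0 n) y)\<^sup>2) x)
          \<in> o(\<lambda>n. real n)) \<and>
      (AE x in M. (\<lambda>n. cexp M \<theta> F0 0 (psum M \<theta> X0 n) x) \<in> o(\<lambda>n. sqrt (real n))) \<and>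
      (AE x in M. (\<lambda>n. cexp M \<theta> F0 0
          (\<lambda>y. (psum M \<theta> X0 n y - psum M \<theta> D n y)\<^sup>2) x)
          \<in> o(\<lambda>n. real n)))"
proof -
  interpret stationary_system M \<theta> F0
    using assms(1-4) by (intro stationary_system.intro stationary_system_axioms.intro)
  \<comment> \<open>\<open>\<F> 0\<close> and \<open>F0\<close> have the same sets, though possibly
    different measures.\<close>
  have X: "in_L2 M X0" "X0 \<in> borel_measurable (\<F> 0)"
    using assms(5,6) measurable_cong_sets[OF sets_Filt_0 refl] by auto
  have MW: "MW_summable X0"
    by (rule MW_summable_of_powr[OF X(1)]) (use assms(8) in \<open>simp add: V_def psum_eq_S\<close>)
  have "(AE x in M. (\<lambda>n. E 0 (\<lambda>y. (S X0 n y - S D n y - E 0 (S X0 n) y)\<^sup>2) x) \<in> o(\<lambda>n. real n)) \<and>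
      (AE x in M. (\<lambda>n. E 0 (S X0 n) x) \<in> o(\<lambda>n. sqrt (real n))) \<and>
      (AE x in M. (\<lambda>n. E 0 (\<lambda>y. (S X0 n y - S D n y)\<^sup>2) x) \<in> o(\<lambda>n. real n))"
    if D: "is_mart_increment M \<theta> F0 X0 D" for D
  proof -
    \<comment> \<open>The bounds require an \<open>\<F> 0\<close>-measurable increment. The sums of
      \<open>D\<close> and \<open>D'\<close> agree almost surely for each \<open>n\<close>, and
      therefore also under \<open>E 0\<close>.\<close>
    define D' where "D' = E 0 D"
    have DL: "in_L2 M D" using D by (auto simp: is_mart_increment_def L2_sums_def)
    note version = mart_increment_version[OF X MW D, folded D'_def]
    have D': "in_L2 M D'" "D' \<in> borel_measurable (\<F> 0)" unfolding D'_def using DL by (auto intro: E_in_L2)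
    define f where "f n y = S X0 n y - S D' n y" for n y
    have f: "in_L2 M (f n)" for n unfolding f_def[abs_def] by (intro in_L2_diff S_in_L2 X D')
    have SL: "in_L2 M (S X0 n)" "in_L2 M (S D n)" for n using S_in_L2 X DL by blast+
    have [measurable]: "f n \<in> borel_measurable M" "S X0 n \<in> borel_measurable M" "S D n \<in> borel_measurable M" for n
      using f SL by (auto intro: in_L2_borel)
    have lim: "AE x in M. (\<lambda>n. E 0 (\<lambda>y. (f n y)\<^sup>2) x / real n) \<longlonglongrightarrow> 0"
      unfolding f_def by (rule quenched_martingale_approximation[OF X D' version(2,3)])
    have nonneg: "AE x in M. \<forall>n. 0 \<le> E 0 (\<lambda>y. (f n y)\<^sup>2) x"
      unfolding AE_all_countable by (intro allI E_nonneg) auto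
    have S_eq: "AE x in M. S X0 n x - S D n x = f n x" for n
      using S_cong_AE[OF version(1), of n] by eventually_elim (simp add: f_def)
    have E_f: "AE x in M. E 0 (f n) x = E 0 (S X0 n) x" for n
    proof -
      have "AE x in M. E 0 (f n) x = E 0 (S X0 n) x - E 0 (S D' n) x"
        unfolding f_def[abs_def] by (intro E_diff in_L2_integrable S_in_L2 X D')
      with E_S_martingale[OF D'(1) version(2), of n] show ?thesis by eventually_elim simp
    qed
    have third: "AE x in M. \<forall>n. E 0 (\<lambda>y. (S X0 n y - S D n y)\<^sup>2) x = E 0 (\<lambda>y. (f n y)\<^sup>2) x"
      unfolding AE_all_countable
    proof (rule allI, rule E_cong)
      show "AE x in M. (S X0 n x - S D n x)\<^sup>2 = (f n x)\<^sup>2" for n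
        using S_eq[of n] by eventually_elim simp
    qed auto
    \<comment> \<open>Jensen's inequality for \<open>f n\<close>, whose conditional expectation is
      that of \<open>S X0 n\<close> because the martingale contributes 0.\<close>
    have second: "AE x in M. \<forall>n. (E 0 (S X0 n) x)\<^sup>2 \<le> E 0 (\<lambda>y. (f n y)\<^sup>2) x"
      unfolding AE_all_countable
    proof
      show "AE x in M. (E 0 (S X0 n) x)\<^sup>2 \<le> E 0 (\<lambda>y. (f n y)\<^sup>2) x" for n
        using E_power2_le[OF f[of n], of 0] E_f[of n] by eventually_elim simp
    qed
    \<comment> \<open>For the same reason the expression squared is \<open>f n\<close> minus its own
      conditional expectation, so it is bounded by the second moment.\<close>
    have first: "AE x in M. \<forall>n. 0 \<le> E 0 (\<lambda>y. (S X0 n y - S D n y - E 0 (S X0 n) y)\<^sup>2) x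
        \<and> E 0 (\<lambda>y. (S X0 n y - S D n y - E 0 (S X0 n) y)\<^sup>2) x \<le> E 0 (\<lambda>y. (f n y)\<^sup>2) x"
      unfolding AE_all_countable
    proof
      fix n
      have "AE x in M. E 0 (\<lambda>y. (S X0 n y - S D n y - E 0 (S X0 n) y)\<^sup>2) x = E 0 (\<lambda>y. (f n y - E 0 (f n) y)\<^sup>2) x"
      proof (rule E_cong)
        show "AE x in M. (S X0 n x - S D n x - E 0 (S X0 n) x)\<^sup>2 = (f n x - E 0 (f n) x)\<^sup>2"
          using S_eq[of n] E_f[of n] by eventually_elim simp
      qed auto
      moreover have "AE x in M. 0 \<le> E 0 (\<lambda>y. (f n y - E 0 (f n) y)\<^sup>2) x"
        by (rule E_nonneg) auto
      moreover note E_variance_le[OF f[of n]]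
      ultimately show "AE x in M. 0 \<le> E 0 (\<lambda>y. (S X0 n y - S D n y - E 0 (S X0 n) y)\<^sup>2) x
        \<and> E 0 (\<lambda>y. (S X0 n y - S D n y - E 0 (S X0 n) y)\<^sup>2) x \<le> E 0 (\<lambda>y. (f n y)\<^sup>2) x"
        by eventually_elim simp
    qed
    show ?thesis
    proof (intro conjI)
      show "AE x in M. (\<lambda>n. E 0 (\<lambda>y. (S X0 n y - S D n y - E 0 (S X0 n) y)\<^sup>2) x) \<in> o(\<lambda>n. real n)"
        using lim first by eventually_elim (auto intro: smallo_of_dominated)
      show "AE x in M. (\<lambda>n. E 0 (S X0 n) x) \<in> o(\<lambda>n. sqrt (real n))"
        using lim second by eventually_elim (auto intro!: smallo_sqrt_of_power2 intro: smallo_of_dominated)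
      show "AE x in M. (\<lambda>n. E 0 (\<lambda>y. (S X0 n y - S D n y)\<^sup>2) x) \<in> o(\<lambda>n. real n)"
        using lim third nonneg by eventually_elim (auto intro: smallo_of_dominated)
    qed
  qed
  then show ?thesis
    unfolding psum_eq_S using mart_increment_exists[OF X MW] by blast
qed

end
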